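(* For every $n \ge 5$, $$\operatorname{Aut}(PVT_n) = \big\langle \operatorname{Aut}_{gr}(PVT_n),\ \operatorname{Aut}_{inv}(PVT_n),\ \operatorname{Inn}(PVT_n) \big\rangle .$$
   Context: The virtual twin group $VT_n$ has generators $s_1,\dots,s_{n-1},\rho_1,\dots,\rho_{n-1}$ and defining relations: $s_i^2=\rho_i^2=1$; $s_is_j=s_js_i$, $\rho_i\rho_j=\rho_j\rho_i$, $\rho_is_j=s_j\rho_i$ for $|i-j|\ge 2$; $\rho_i\rho_{i+1}\rho_i=\rho_{i+1}\rho_i\rho_{i+1}$ and $\rho_i\rho_{i+1}s_i=s_{i+1}\rho_i\rho_{i+1}$ for $1\le i\le n-2$. The pure virtual twin group $PVT_n$ is the kernel of $VT_n\to S_n$, $s_i,\rho_i\mapsto(i,i+1)$. It is generated by $\mathcal S=\{\lambda_{i,j}: 1\le i<j\le n\}$, where $\lambda_{i,i+1}=s_i\rho_i$ and $\lambda_{i,j}=\rho_{j-1}\cdots\rho_{i+1}\lambda_{i,i+1}\rho_{i+1}\cdots\rho_{j-1}$ for $j\neq i+1$; its presentation on these generators is the right-angled Artin presentation with relations $\lambda_{i,j}\lambda_{k,l}=\lambda_{k,l}\lambda_{i,j}$ for pairwise distinct $i,j,k,l$. The graph of $PVT_n$ has vertex set $\mathcal S$, with an edge between two distinct vertices iff they commute (iff their index pairs are disjoint). $\operatorname{Aut}_{gr}(PVT_n)$ is the subgroup of $\operatorname{Aut}(PVT_n)$ generated by the automorphisms induced by automorphisms of this graph; $\operatorname{Aut}_{inv}(PVT_n)$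 is the subgroup generated by the inversions (an inversion sends one generator in $\mathcal S$ to its inverse and fixes all the others); $\operatorname{Inn}(PVT_n)$ is the group of inner automorphisms. *)

theory Defs
  imports "HOL-Algebra.Sym_Groups" "HOL-Algebra.Bij"
begin

section \<open>Groups given by generators and relations\<close>

text \<open>A letter \<open>(x, True)\<close> stands for the generator \<open>x\<close>, and \<open>(x, False)\<close> for its formal inverse.
  A relation is a pair of words, to be read as an equation.\<close>

type_synonym 'g gword = "('g \<times> bool) list"

definition words :: "'g set \<Rightarrow> 'g gword set"
  where "words X = lists (X \<times> UNIV)"

inductive word_eq :: "'g set \<Rightarrow> ('g gword \<times> 'g gword) set \<Rightarrow> 'g gword \<Rightarrow> 'g gword \<Rightarrow> bool"
  for X R
where
  refl: "w \<in> words X \<Longrightarrow> word_eq X R w w"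
| sym: "word_eq X R v w \<Longrightarrow> word_eq X R w v"
| trans: "word_eq X R u v \<Longrightarrow> word_eq X R v w \<Longrightarrow> word_eq X R u w"
| cancel: "u \<in> words X \<Longrightarrow> v \<in> words X \<Longrightarrow> x \<in> X \<Longrightarrow>
    word_eq X R (u @ [(x, e), (x, \<not> e)] @ v) (u @ v)"
| rel: "u \<in> words X \<Longrightarrow> v \<in> words X \<Longrightarrow> l \<in> words X \<Longrightarrow> r \<in> words X \<Longrightarrow> (l, r) \<in> R \<Longrightarrow>
    word_eq X R (u @ l @ v) (u @ r @ v)"

definition word_class :: "'g set \<Rightarrow> ('g gword \<times> 'g gword) set \<Rightarrow> 'g gword \<Rightarrow> 'g gword set"
  where "word_class X R w = {v. word_eq X R w v}"

definition presented_group :: "'g set \<Rightarrow> ('g gword \<times> 'g gword) set \<Rightarrow> 'g gword set monoid"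
  where "presented_group X R =
    \<lparr>carrier = word_class X R ` words X,
     mult = \<lambda>A B. {w. \<exists>u\<in>A. \<exists>v\<in>B. word_eq X R (u @ v) w},
     one = word_class X R []\<rparr>"

definition word_eval :: "('a, 'b) monoid_scheme \<Rightarrow> ('g \<Rightarrow> 'a) \<Rightarrow> 'g gword \<Rightarrow> 'a"
  where "word_eval H f w =
    foldr (\<lambda>(x, e) a. (if e then f x else inv\<^bsub>H\<^esub> (f x)) \<otimes>\<^bsub>H\<^esub> a) w \<one>\<^bsub>H\<^esub>"

text \<open>The homomorphism out of a presented group sending each generator \<open>x\<close> to \<open>f x\<close>. It is
  meaningful only if \<open>f\<close> respects the relations, so that \<open>word_eval H f\<close> is constant on classes;
  see \<open>presented_lift_hom\<close>.\<close>

definition presented_lift :: "('a, 'b) monoid_scheme \<Rightarrow> ('g \<Rightarrow> 'a) \<Rightarrow> 'g gword set \<Rightarrow> 'a"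
  where "presented_lift H f A = the_elem (word_eval H f ` A)"

lemma words_Nil [simp]: "[] \<in> words X"
  and words_Cons [simp]: "p # w \<in> words X \<longleftrightarrow> fst p \<in> X \<and> w \<in> words X"
  and words_append [simp]: "u @ v \<in> words X \<longleftrightarrow> u \<in> words X \<and> v \<in> words X"
  by (auto simp: words_def mem_Times_iff)

lemma word_eq_words: "word_eq X R v w \<Longrightarrow> v \<in> words X \<and> w \<in> words X"
  by (induction rule: word_eq.induct) auto

lemma word_eq_append_left:
  "word_eq X R v w \<Longrightarrow> u \<in> words X \<Longrightarrow> word_eq X R (u @ v) (u @ w)"
proof (induction rule: word_eq.induct)
  case (cancel p q x e)
  then show ?case using word_eq.cancel[of "u @ p" X q x R e] by simp
next
  case (rel p q l r)
  then show ?case using word_eq.rel[of "u @ p" X q l r R] by simp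
qed (auto intro: word_eq.intros)

lemma word_eq_append_right:
  "word_eq X R v w \<Longrightarrow> u \<in> words X \<Longrightarrow> word_eq X R (v @ u) (w @ u)"
proof (induction rule: word_eq.induct)
  case (cancel p q x e)
  then show ?case using word_eq.cancel[of p X "q @ u" x R e] by simp
next
  case (rel p q l r)
  then show ?case using word_eq.rel[of p X "q @ u" l r R] by simp
qed (auto intro: word_eq.intros)

lemma word_eq_append:
  "word_eq X R u u' \<Longrightarrow> word_eq X R v v' \<Longrightarrow> word_eq X R (u @ v) (u' @ v')"
  by (meson word_eq.trans word_eq_append_left word_eq_append_right word_eq_words)

lemma word_class_eq_iff:
  "v \<in> words X \<Longrightarrow> w \<in> words X \<Longrightarrow> word_class X R v = word_class X R w \<longleftrightarrow> word_eq X R v w"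
  unfolding word_class_def
  by (metis (no_types, lifting) Collect_cong mem_Collect_eq word_eq.refl word_eq.sym word_eq.trans)

lemma presented_group_carrier:
  "carrier (presented_group X R) = word_class X R ` words X"
  by (simp add: presented_group_def)

lemma presented_group_one: "\<one>\<^bsub>presented_group X R\<^esub> = word_class X R []"
  by (simp add: presented_group_def)

lemma presented_group_mult:
  assumes "u \<in> words X" "v \<in> words X"
  shows "word_class X R u \<otimes>\<^bsub>presented_group X R\<^esub> word_class X R v = word_class X R (u @ v)"
proof -
  have "(\<exists>u'. word_eq X R u u' \<and> (\<exists>v'. word_eq X R v v' \<and> word_eq X R (u' @ v') w))
      \<longleftrightarrow> word_eq X R (u @ v) w" (is "?L \<longleftrightarrow> ?R") for w
  proof
    assume ?L
    then obtain u' v' where "word_eq X R u u'" "word_eq X R v v'" "word_eq X R (u' @ v') w"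
      by blast
    then show ?R by (rule word_eq.trans[OF word_eq_append])
  next
    assume ?R
    with word_eq.refl[OF assms(1)] word_eq.refl[OF assms(2)] show ?L by blast
  qed
  then show ?thesis
    by (simp add: presented_group_def word_class_def)
qed

lemma word_eq_left_inverse:
  "w \<in> words X \<Longrightarrow> word_eq X R (rev (map (\<lambda>(x, e). (x, \<not> e)) w) @ w) []"
proof (induction w)
  case (Cons p w)
  obtain x e where p: "p = (x, e)" by (cases p)
  let ?i = "rev (map (\<lambda>(x, e). (x, \<not> e)) w)"
  have "?i \<in> words X" using Cons.prems by (auto simp: words_def in_lists_conv_set)
  then have "word_eq X R (?i @ [(x, \<not> e), (x, e)] @ w) (?i @ w)"
    using word_eq.cancel[of ?i X w x R "\<not> e"] Cons.prems p by simp
  moreover have "word_eq X R (?i @ w) []" using Cons by simp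
  ultimately have "word_eq X R (?i @ [(x, \<not> e), (x, e)] @ w) []" by (rule word_eq.trans)
  then show ?case by (simp add: p)
qed (auto intro: word_eq.refl)

lemma group_presented_group: "group (presented_group X R)"
proof (rule groupI)
  fix A assume "A \<in> carrier (presented_group X R)"
  then obtain w where w: "w \<in> words X" "A = word_class X R w"
    by (auto simp: presented_group_carrier)
  let ?i = "rev (map (\<lambda>(x, e). (x, \<not> e)) w)"
  have "?i \<in> words X" using w by (auto simp: words_def in_lists_conv_set)
  then show "\<exists>B\<in>carrier (presented_group X R). B \<otimes>\<^bsub>presented_group X R\<^esub> A = \<one>\<^bsub>presented_group X R\<^esub>"
    using w word_eq_left_inverse[OF w(1)]
    by (intro bexI[of _ "word_class X R ?i"])
      (simp_all add: presented_group_carrier presented_group_one presented_group_mult word_class_eq_iff)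
qed (auto simp: presented_group_carrier presented_group_one presented_group_mult)

context group begin

lemma word_eval_closed: "f \<in> X \<rightarrow> carrier G \<Longrightarrow> w \<in> words X \<Longrightarrow> word_eval G f w \<in> carrier G"
  by (induction w) (auto simp: word_eval_def intro!: m_closed inv_closed dest: Pi_mem)

lemma word_eval_append:
  "f \<in> X \<rightarrow> carrier G \<Longrightarrow> u \<in> words X \<Longrightarrow> v \<in> words X \<Longrightarrow>
    word_eval G f (u @ v) = word_eval G f u \<otimes> word_eval G f v"
proof (induction u)
  case Nil
  then show ?case using word_eval_closed[of f X v] by (simp add: word_eval_def)
next
  case (Cons p u)
  obtain x e where p: "p = (x, e)" by (cases p)
  have "word_eval G f (p # w) = (if e then f x else inv (f x)) \<otimes> word_eval G f w" for w
    by (simp add: word_eval_def p)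
  moreover have "f x \<in> carrier G" using Cons.prems p by auto
  ultimately show ?case
    using Cons word_eval_closed[of f X u] word_eval_closed[of f X v] by (simp add: m_assoc)
qed

lemma word_eval_word_eq:
  assumes f: "f \<in> X \<rightarrow> carrier G"
    and R: "\<And>l r. (l, r) \<in> R \<Longrightarrow> word_eval G f l = word_eval G f r"
  shows "word_eq X R v w \<Longrightarrow> word_eval G f v = word_eval G f w"
proof (induction rule: word_eq.induct)
  case (cancel u v x e)
  have "f x \<in> carrier G" using f cancel by auto
  then have "word_eval G f [(x, e), (x, \<not> e)] = \<one>" by (simp add: word_eval_def)
  then show ?case using cancel word_eval_closed[OF f] by (simp add: word_eval_append[OF f] del: append_Cons)
next
  case (rel u v l r)
  then show ?case using R by (simp add: word_eval_append[OF f])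
qed simp_all

lemma presented_lift_class:
  assumes "f \<in> X \<rightarrow> carrier G"
    and "\<And>l r. (l, r) \<in> R \<Longrightarrow> word_eval G f l = word_eval G f r"
    and "w \<in> words X"
  shows "presented_lift G f (word_class X R w) = word_eval G f w"
proof -
  have "word_eval G f ` word_class X R w = {word_eval G f w}"
    using word_eval_word_eq[OF assms(1,2)] word_eq.refl[OF assms(3)]
    by (force simp: word_class_def)
  then show ?thesis by (simp add: presented_lift_def)
qed

lemma presented_lift_hom:
  assumes "f \<in> X \<rightarrow> carrier G"
    and "\<And>l r. (l, r) \<in> R \<Longrightarrow> word_eval G f l = word_eval G f r"
  shows "presented_lift G f \<in> hom (presented_group X R) G"
  using presented_lift_class[OF assms] word_eval_closed[OF assms(1)] word_eval_append[OF assms(1)]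
  by (auto simp: hom_def presented_group_carrier presented_group_mult)

end


section \<open>The virtual twin group and its pure subgroup\<close>

datatype vt_gen = S nat | Rho nat

abbreviation pos_word :: "'g list \<Rightarrow> 'g gword"
  where "pos_word xs \<equiv> map (\<lambda>x. (x, True)) xs"

definition vt_gens :: "nat \<Rightarrow> vt_gen set"
  where "vt_gens n = S ` {1..<n} \<union> Rho ` {1..<n}"

definition vt_rels :: "nat \<Rightarrow> (vt_gen gword \<times> vt_gen gword) set"
  where "vt_rels n =
      {(pos_word [S i, S i], []) | i. i \<in> {1..<n}}
    \<union> {(pos_word [Rho i, Rho i], []) | i. i \<in> {1..<n}}
    \<union> {(pos_word [S i, S j], pos_word [S j, S i]) | i j.
         i \<in> {1..<n} \<and> j \<in> {1..<n} \<and> \<bar>int i - int j\<bar> \<ge> 2}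
    \<union> {(pos_word [Rho i, Rho j], pos_word [Rho j, Rho i]) | i j.
         i \<in> {1..<n} \<and> j \<in> {1..<n} \<and> \<bar>int i - int j\<bar> \<ge> 2}
    \<union> {(pos_word [Rho i, S j], pos_word [S j, Rho i]) | i j.
         i \<in> {1..<n} \<and> j \<in> {1..<n} \<and> \<bar>int i - int j\<bar> \<ge> 2}
    \<union> {(pos_word [Rho i, Rho (i + 1), Rho i], pos_word [Rho (i + 1), Rho i, Rho (i + 1)]) | i.
         1 \<le> i \<and> i + 1 < n}
    \<union> {(pos_word [Rho i, Rho (i + 1), S i], pos_word [S (i + 1), Rho i, Rho (i + 1)]) | i.
         1 \<le> i \<and> i + 1 < n}"

definition VT :: "nat \<Rightarrow> vt_gen gword set monoid"
  where "VT n = presented_group (vt_gens n) (vt_rels n)"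

fun vt_transp :: "vt_gen \<Rightarrow> nat \<Rightarrow> nat"
  where
    "vt_transp (S i) = transpose i (i + 1)"
  | "vt_transp (Rho i) = transpose i (i + 1)"

definition vt_perm :: "nat \<Rightarrow> vt_gen gword set \<Rightarrow> nat \<Rightarrow> nat"
  where "vt_perm n = presented_lift (sym_group n) vt_transp"

definition PVT :: "nat \<Rightarrow> vt_gen gword set monoid"
  where "PVT n = VT n \<lparr>carrier := kernel (VT n) (sym_group n) (vt_perm n)\<rparr>"

text \<open>For \<open>j = i + 1\<close> both flanking words are empty, leaving \<open>s\<^sub>i \<rho>\<^sub>i\<close>.\<close>

definition lam :: "nat \<Rightarrow> nat \<Rightarrow> nat \<Rightarrow> vt_gen gword set"
  where "lam n i j = word_class (vt_gens n) (vt_rels n)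
    (pos_word (map Rho (rev [i+1..<j]) @ [S i, Rho i] @ map Rho [i+1..<j]))"

definition lams :: "nat \<Rightarrow> vt_gen gword set set"
  where "lams n = {lam n i j | i j. 1 \<le> i \<and> i < j \<and> j \<le> n}"

lemma vt_rels_words: "vt_rels n \<subseteq> words (vt_gens n) \<times> words (vt_gens n)"
  by (auto simp: vt_rels_def vt_gens_def)

lemma group_VT: "group (VT n)"
  by (simp add: VT_def group_presented_group)

lemma vt_transp_in_sym_group: "vt_transp \<in> vt_gens n \<rightarrow> carrier (sym_group n)"
proof
  fix x assume x: "x \<in> vt_gens n"
  have "transpose i (i + 1) permutes {1..n}" if "i \<in> {1..<n}" for i
    using that by (intro permutes_swap_id) simp_all
  with x show "vt_transp x \<in> carrier (sym_group n)"
    unfolding vt_gens_def sym_group_carrier by fastforce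
qed

lemma vt_transp_respects_rels:
  assumes "(l, r) \<in> vt_rels n"
  shows "word_eval (sym_group n) vt_transp l = word_eval (sym_group n) vt_transp r"
  using assms
  by (auto simp: vt_rels_def word_eval_def sym_group_mult sym_group_one fun_eq_iff transpose_def)

lemma vt_perm_class:
  "w \<in> words (vt_gens n) \<Longrightarrow>
    vt_perm n (word_class (vt_gens n) (vt_rels n) w) = word_eval (sym_group n) vt_transp w"
  unfolding vt_perm_def
  by (rule group.presented_lift_class[OF sym_group_is_group vt_transp_in_sym_group vt_transp_respects_rels])

lemma group_hom_vt_perm: "group_hom (VT n) (sym_group n) (vt_perm n)"
  unfolding group_hom_def group_hom_axioms_def vt_perm_def VT_def
  using group.presented_lift_hom[OF sym_group_is_group vt_transp_in_sym_group vt_transp_respects_rels]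
  by (simp add: group_presented_group sym_group_is_group)

lemma group_PVT: "group (PVT n)"
  unfolding PVT_def
  by (rule group.subgroup_imp_group[OF group_VT group_hom.subgroup_kernel[OF group_hom_vt_perm]])

lemma word_eval_conj_rho:
  "word_eval (sym_group n) vt_transp (pos_word (map Rho (rev ks) @ [S i, Rho i] @ map Rho ks)) = id"
proof -
  define E where "E = (\<lambda>xs. word_eval (sym_group n) vt_transp (pos_word xs))"
  have E_Cons: "E (x # xs) = vt_transp x \<circ> E xs" for x xs
    by (simp add: E_def word_eval_def sym_group_mult)
  have E_Nil: "E [] = id"
    by (simp add: E_def word_eval_def sym_group_one)
  have app: "E (xs @ ys) = E xs \<circ> E ys" for xs ys
    by (induction xs) (simp_all add: E_Cons E_Nil comp_assoc)
  have SR: "E [S i, Rho i] = id"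
    by (simp add: E_Cons E_Nil)
  have "E (map Rho (rev ks)) \<circ> E (map Rho ks) = id"
  proof (induction ks)
    case (Cons k ks)
    have "E (map Rho (rev (k # ks))) \<circ> E (map Rho (k # ks)) =
        E (map Rho (rev ks)) \<circ> ((vt_transp (Rho k) \<circ> vt_transp (Rho k)) \<circ> E (map Rho ks))"
      by (simp only: rev.simps map_append list.map app E_Cons E_Nil comp_assoc comp_id id_comp)
    also have "vt_transp (Rho k) \<circ> vt_transp (Rho k) = id" by simp
    finally show ?case using Cons.IH by (simp only: id_comp)
  qed (simp add: E_Nil)
  then have "E (map Rho (rev ks) @ [S i, Rho i] @ map Rho ks) = id"
    by (simp only: app SR id_comp)
  then show ?thesis by (simp only: E_def)
qed

lemma lams_subset_PVT: "lams n \<subseteq> carrier (PVT n)"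
proof
  fix x assume "x \<in> lams n"
  then obtain i j where ij: "1 \<le> i" "i < j" "j \<le> n" "x = lam n i j"
    by (auto simp: lams_def)
  define w where "w = pos_word (map Rho (rev [i+1..<j]) @ [S i, Rho i] @ map Rho [i+1..<j])"
  have w: "w \<in> words (vt_gens n)"
    using ij by (auto simp: w_def words_def vt_gens_def in_lists_conv_set)
  moreover have x: "x = word_class (vt_gens n) (vt_rels n) w"
    by (simp only: ij lam_def w_def)
  moreover have "word_eval (sym_group n) vt_transp w = id"
    unfolding w_def by (rule word_eval_conj_rho)
  ultimately have "vt_perm n x = \<one>\<^bsub>sym_group n\<^esub>"
    by (simp only: vt_perm_class sym_group_one)
  moreover have "x \<in> carrier (VT n)"
    unfolding VT_def presented_group_carrier x by (rule imageI) (rule w)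
  ultimately have "x \<in> kernel (VT n) (sym_group n) (vt_perm n)"
    unfolding kernel_def by blast
  then show "x \<in> carrier (PVT n)"
    by (simp add: PVT_def)
qed


section \<open>The three families of automorphisms\<close>

definition pvt_adj :: "nat \<Rightarrow> vt_gen gword set \<Rightarrow> vt_gen gword set \<Rightarrow> bool"
  where "pvt_adj n x y \<longleftrightarrow> x \<in> lams n \<and> y \<in> lams n \<and> x \<noteq> y \<and>
    x \<otimes>\<^bsub>PVT n\<^esub> y = y \<otimes>\<^bsub>PVT n\<^esub> x"

definition pvt_graph_aut :: "nat \<Rightarrow> (vt_gen gword set \<Rightarrow> vt_gen gword set) \<Rightarrow> bool"
  where "pvt_graph_aut n \<sigma> \<longleftrightarrow> bij_betw \<sigma> (lams n) (lams n) \<and>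
    (\<forall>x\<in>lams n. \<forall>y\<in>lams n. pvt_adj n (\<sigma> x) (\<sigma> y) \<longleftrightarrow> pvt_adj n x y)"

text \<open>The automorphism induced by a graph automorphism \<open>\<sigma>\<close>, respectively the inversion at a
  generator, is determined by its values on the generating set \<open>lams n\<close>. Automorphisms are
  extensional functions on \<open>carrier (PVT n)\<close>, as in \<open>Bij\<close>.\<close>

definition Aut_gr :: "nat \<Rightarrow> (vt_gen gword set \<Rightarrow> vt_gen gword set) set"
  where "Aut_gr n = generate (AutoGroup (PVT n))
    {\<phi> \<in> auto (PVT n). \<exists>\<sigma>. pvt_graph_aut n \<sigma> \<and> (\<forall>x\<in>lams n. \<phi> x = \<sigma> x)}"

definition Aut_inv :: "nat \<Rightarrow> (vt_gen gword set \<Rightarrow> vt_gen gword set) set"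
  where "Aut_inv n = generate (AutoGroup (PVT n))
    {\<phi> \<in> auto (PVT n). \<exists>x\<in>lams n. \<phi> x = inv\<^bsub>PVT n\<^esub> x \<and> (\<forall>y\<in>lams n - {x}. \<phi> y = y)}"

definition Inn :: "('a, 'b) monoid_scheme \<Rightarrow> ('a \<Rightarrow> 'a) set"
  where "Inn G = (\<lambda>g. \<lambda>x\<in>carrier G. g \<otimes>\<^bsub>G\<^esub> x \<otimes>\<^bsub>G\<^esub> inv\<^bsub>G\<^esub> g) ` carrier G"

end

theory Submission
  imports Defs Complex_Main "HOL-Library.Function_Algebras"
begin

text \<open>The group \<open>PVT n\<close> is the right-angled Artin group on the pairs \<open>i < j\<close>, two of which commute
  iff they are disjoint: \<open>VT n\<close> acts on that group by affine bijections, which makes the presentation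
  faithful, and the Coxeter presentation of the symmetric group shows that it is complete.
  Such a group acts on the Cayley graph with its hyperplanes, the classes of parallel edges.

  Let \<open>f\<close> be an automorphism. If \<open>f (x v)\<close> skewers hyperplanes of two labels \<open>a\<close> and \<open>b\<close>, then
  modulo powers of \<open>f (x v)\<close> the images of all generators commuting with \<open>x v\<close> stabilise a hyperplane
  of each label, and by counting ranks in the abelianisation the links of \<open>a\<close> and \<open>b\<close> would nearly agree,
  which never happens for \<open>n \<ge> 5\<close>. So \<open>f (x v)\<close> is conjugate to a generator or its inverse, and up to a graph
  automorphism and inversions \<open>f\<close> conjugates each generator \<open>x v\<close> by some \<open>h v\<close>. The cosets \<open>h v C(x v)\<close>
  of commuting generators meet. As the complement of the star of \<open>a\<close> is connected, each hyperplane
  labelled \<open>a\<close> has all cosets that it does not cross on one side; a Helly argument for these sides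
  produces a common point \<open>g\<close> of the cosets, and conjugation by \<open>g\<close> does the job.\<close>

section \<open>Right-angled Artin groups\<close>

text \<open>A general right-angled Artin group also has transvections and non-inner partial
  conjugations among its automorphisms, so the graph must exclude both. No length reduction over
  elementary automorphisms is made: the shape of a single image \<open>f (x v)\<close> is read off
  from the hyperplanes that it shifts. The count behind this is exact: the star of \<open>v\<close>
  has |lk v| + 1 members with independent images, two labels a and b would force |lk a \<union> lk
  b| \<le> |lk v| + 1, and for n \<ge> 5 the links of two distinct pairs have a union exceeding each
  of them by at least 2. For n = 4 the graph consists of three disjoint edges, and both this count
  and the connectedness of star complements fail. Normal forms of words are avoided throughout: a
  word with no visible cancellation crosses no hyperplane twice, so its labels can be recovered from
  the group element alone.\<close>

definition comm_rels :: "'i set \<Rightarrow> ('i \<Rightarrow> 'i \<Rightarrow> bool) \<Rightarrow> ('i gword \<times> 'i gword) set"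
  where "comm_rels V adj = {(pos_word [a, b], pos_word [b, a]) | a b. a \<in> V \<and> b \<in> V \<and> adj a b}"

definition flip :: "'i \<times> bool \<Rightarrow> 'i \<times> bool"
  where "flip l = (fst l, \<not> snd l)"

definition winv :: "'i gword \<Rightarrow> 'i gword"
  where "winv w = rev (map flip w)"

lemma fst_flip [simp]: "fst (flip l) = fst l"
  and snd_flip [simp]: "snd (flip l) = (\<not> snd l)"
  and flip_flip [simp]: "flip (flip l) = l"
  by (simp_all add: flip_def)

lemma words_iff: "w \<in> words X \<longleftrightarrow> (\<forall>l\<in>set w. fst l \<in> X)"
  by (induction w) auto

lemma words_nth: "w \<in> words X \<Longrightarrow> i < length w \<Longrightarrow> fst (w ! i) \<in> X"
  by (simp add: words_iff)

lemma words_take: "w \<in> words X \<Longrightarrow> take i w \<in> words X"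
  and words_drop: "w \<in> words X \<Longrightarrow> drop i w \<in> words X"
  by (auto simp: words_iff dest: in_set_takeD in_set_dropD)

lemma words_winv [simp]: "winv w \<in> words X \<longleftrightarrow> w \<in> words X"
  by (auto simp: words_iff winv_def)

lemma words_mono: "w \<in> words X \<Longrightarrow> X \<subseteq> Y \<Longrightarrow> w \<in> words Y"
  by (auto simp: words_iff)

lemma length_winv [simp]: "length (winv w) = length w"
  by (simp add: winv_def)

lemma (in group) comm_inv_left:
  assumes "a \<in> carrier G" "b \<in> carrier G" "a \<otimes> b = b \<otimes> a"
  shows "inv a \<otimes> b = b \<otimes> inv a"
proof -
  have "inv a \<otimes> b = inv a \<otimes> (b \<otimes> a) \<otimes> inv a"
    using assms(1,2) by (simp add: m_assoc)
  also have "\<dots> = b \<otimes> inv a"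
    unfolding assms(3)[symmetric] using assms(1,2) by (simp flip: m_assoc)
  finally show ?thesis .
qed

lemma (in group) inv_cancel:
  assumes "a \<in> carrier G" "b \<in> carrier G"
  shows "inv a \<otimes> (a \<otimes> b) = b" and "a \<otimes> (inv a \<otimes> b) = b"
  using assms by (simp_all flip: m_assoc)

text \<open>Generation and faithfulness together express the right-angled presentation without
  fixing the elements of \<open>G\<close> to be word classes, so that the kernel
  \<open>PVT n\<close> can be an instance.\<close>

locale raag = group G for G (structure) +
  fixes x :: "'i \<Rightarrow> 'a" and V :: "'i set" and adj :: "'i \<Rightarrow> 'i \<Rightarrow> bool"
  assumes x_closed: "x \<in> V \<rightarrow> carrier G"
    and finite_V: "finite V"
    and adj_sym: "adj a b \<Longrightarrow> adj b a"
    and adj_irrefl: "\<not> adj a a"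
    and x_comm: "a \<in> V \<Longrightarrow> b \<in> V \<Longrightarrow> adj a b \<Longrightarrow> x a \<otimes> x b = x b \<otimes> x a"
    and generated: "g \<in> carrier G \<Longrightarrow> \<exists>w\<in>words V. word_eval G x w = g"
    and faithful: "w \<in> words V \<Longrightarrow> word_eval G x w = \<one> \<Longrightarrow> word_eq V (comm_rels V adj) w []"
begin

declare inv_cancel [simp]

abbreviation ev :: "'i gword \<Rightarrow> 'a"
  where "ev \<equiv> word_eval G x"

definition val :: "'i \<times> bool \<Rightarrow> 'a"
  where "val l = (if snd l then x (fst l) else inv (x (fst l)))"

definition sub :: "'i set \<Rightarrow> 'a set"
  where "sub T = ev ` words T"

definition lk :: "'i \<Rightarrow> 'i set"
  where "lk a = {b \<in> V. adj a b}"

definition st :: "'i \<Rightarrow> 'i set"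
  where "st a = insert a (lk a)"

lemma x_in [simp]: "a \<in> V \<Longrightarrow> x a \<in> carrier G"
  using x_closed by auto

lemma val_in [simp]: "fst l \<in> V \<Longrightarrow> val l \<in> carrier G"
  by (simp add: val_def)

lemma val_flip: "fst l \<in> V \<Longrightarrow> val (flip l) = inv (val l)"
  by (simp add: val_def)

lemma ev_Nil [simp]: "ev [] = \<one>"
  by (simp add: word_eval_def)

lemma ev_Cons [simp]: "ev (l # w) = val l \<otimes> ev w"
  by (cases l) (simp add: word_eval_def val_def)

lemma ev_in [simp]: "w \<in> words V \<Longrightarrow> ev w \<in> carrier G"
  by (rule word_eval_closed[OF x_closed])

lemma ev_append: "u \<in> words V \<Longrightarrow> v \<in> words V \<Longrightarrow> ev (u @ v) = ev u \<otimes> ev v"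
  by (rule word_eval_append[OF x_closed])

lemma ev_winv: "w \<in> words V \<Longrightarrow> ev (winv w) = inv (ev w)"
proof (induction w)
  case (Cons l w)
  have "ev (winv (l # w)) = ev (winv w) \<otimes> ev [flip l]"
    using Cons.prems ev_append[of "winv w" "[flip l]"] by (simp add: winv_def words_iff)
  then show ?case using Cons by (simp add: val_flip inv_mult_group)
qed (simp add: winv_def)

lemma ev_comm_rels: "(l, r) \<in> comm_rels V adj \<Longrightarrow> ev l = ev r"
  by (auto simp: comm_rels_def val_def intro: x_comm)

text \<open>\<open>faithful\<close> only recognises words with value \<one>; it is applied to
  \<open>v @ winv w\<close>.\<close>

lemma word_eq_iff:
  assumes "v \<in> words V" "w \<in> words V"
  shows "word_eq V (comm_rels V adj) v w \<longleftrightarrow> ev v = ev w"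
proof
  assume "word_eq V (comm_rels V adj) v w"
  then show "ev v = ev w"
    using word_eval_word_eq[OF x_closed, of "comm_rels V adj" v w] ev_comm_rels by blast
next
  assume eq: "ev v = ev w"
  let ?e = "word_eq V (comm_rels V adj)"
  have "ev (v @ winv w) = \<one>" using assms eq by (simp add: ev_append ev_winv)
  then have "?e (v @ winv w) []" using assms by (intro faithful) simp_all
  then have 1: "?e (v @ winv w @ w) w"
    using word_eq_append_right[of _ _ "v @ winv w" "[]" w] assms by simp
  have "winv w = rev (map (\<lambda>(x, e). (x, \<not> e)) w)"
    by (simp add: winv_def flip_def case_prod_beta)
  then have "?e (winv w @ w) []" using word_eq_left_inverse[OF assms(2)] by simp
  then have "?e (v @ winv w @ w) v"
    using word_eq_append_left[of _ _ "winv w @ w" "[]" v] assms by simp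
  with 1 show "?e v w" by (meson word_eq.sym word_eq.trans)
qed

text \<open>The means of defining functions on \<open>G\<close> without normal forms: a function of
  words descends once it ignores free cancellation and swaps of positive commuting letters. Exponent
  sums and signed crossings are obtained in this way.\<close>

lemma ev_invariant:
  assumes "v \<in> words V" "w \<in> words V" "ev v = ev w"
    and can: "\<And>u v a e. u \<in> words V \<Longrightarrow> v \<in> words V \<Longrightarrow> a \<in> V \<Longrightarrow>
      F (u @ [(a, e), (a, \<not> e)] @ v) = F (u @ v)"
    and swp: "\<And>u v a b. u \<in> words V \<Longrightarrow> v \<in> words V \<Longrightarrow> a \<in> V \<Longrightarrow> b \<in> V \<Longrightarrow> adj a b \<Longrightarrow>
      F (u @ [(a, True), (b, True)] @ v) = F (u @ [(b, True), (a, True)] @ v)"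
  shows "F v = F w"
proof -
  have "word_eq V (comm_rels V adj) v w" using assms word_eq_iff by blast
  then show ?thesis
    by (induction rule: word_eq.induct) (use can swp in \<open>auto simp: comm_rels_def\<close>)
qed

definition word_of :: "'a \<Rightarrow> 'i gword"
  where "word_of g = (SOME w. w \<in> words V \<and> ev w = g)"

lemma word_of: "g \<in> carrier G \<Longrightarrow> word_of g \<in> words V \<and> ev (word_of g) = g"
  unfolding word_of_def using generated[of g] by - (rule someI_ex, blast)

lemma letters_induct [consumes 1, case_names one step]:
  assumes "g \<in> carrier G" "P \<one>"
    and st: "\<And>h l. h \<in> carrier G \<Longrightarrow> fst l \<in> V \<Longrightarrow> P h \<Longrightarrow> P (h \<otimes> val l)"
  shows "P g"
proof -
  have "P (ev w)" if "w \<in> words V" for w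
    using that
  proof (induction w rule: rev_induct)
    case (snoc l w)
    then show ?case using st[of "ev w" l] by (simp add: ev_append)
  qed (simp add: assms)
  then show ?thesis using word_of[OF assms(1)] by metis
qed

section \<open>Exponent sums, the coordinates of the abelianisation\<close>

definition degw :: "'i \<Rightarrow> 'i gword \<Rightarrow> int"
  where "degw a w = (\<Sum>l\<leftarrow>w. if fst l = a then (if snd l then 1 else -1) else 0)"

definition deg :: "'i \<Rightarrow> 'a \<Rightarrow> int"
  where "deg a g = degw a (word_of g)"

lemma degw_append: "degw a (u @ v) = degw a u + degw a v"
  by (simp add: degw_def)

lemma deg_ev: assumes "w \<in> words V" shows "deg a (ev w) = degw a w"
proof -
  have "word_of (ev w) \<in> words V" "ev (word_of (ev w)) = ev w"
    using word_of[of "ev w"] assms by simp_all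
  then show ?thesis unfolding deg_def using assms
    by - (rule ev_invariant[where F = "degw a"], auto simp: degw_def)
qed

lemma deg_mult: "g \<in> carrier G \<Longrightarrow> h \<in> carrier G \<Longrightarrow> deg a (g \<otimes> h) = deg a g + deg a h"
  by (metis degw_append deg_ev ev_append word_of words_append)

lemma deg_one [simp]: "deg a \<one> = 0"
  using deg_ev[of "[]" a] by (simp add: degw_def)

lemma deg_inv: "g \<in> carrier G \<Longrightarrow> deg a (inv g) = - deg a g"
  using deg_mult[of g "inv g" a] by simp

lemma deg_x: "b \<in> V \<Longrightarrow> deg a (x b) = (if a = b then 1 else 0)"
  using deg_ev[of "[(b, True)]" a] by (simp add: degw_def val_def)

lemma deg_pow_nat: "g \<in> carrier G \<Longrightarrow> deg a (g [^] (k::nat)) = int k * deg a g"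
  by (induction k) (simp_all add: deg_mult algebra_simps)

lemma deg_pow: assumes "g \<in> carrier G" shows "deg a (g [^] (k::int)) = k * deg a g"
proof (cases k)
  case (nonneg n)
  then show ?thesis using assms by (simp add: int_pow_int deg_pow_nat)
next
  case (neg n)
  have "g [^] k = inv (g [^] Suc n)"
    unfolding neg by (rule int_pow_neg_int[OF assms])
  then have "deg a (g [^] k) = - (int (Suc n) * deg a g)"
    using deg_inv[of "g [^] Suc n" a] deg_pow_nat[OF assms, of a "Suc n"] assms
    by (simp only: nat_pow_closed)
  then show ?thesis by (simp only: neg mult_minus_left)
qed

lemma deg_conj: "g \<in> carrier G \<Longrightarrow> h \<in> carrier G \<Longrightarrow> deg a (g \<otimes> h \<otimes> inv g) = deg a h"
  by (simp add: deg_mult deg_inv)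

lemma sub_subset: "T \<subseteq> V \<Longrightarrow> sub T \<subseteq> carrier G"
  unfolding sub_def using words_mono[of _ T V] by auto

lemma sub_subgroup: assumes "T \<subseteq> V" shows "subgroup (sub T) G"
proof (rule subgroupI)
  show "sub T \<subseteq> carrier G" by (rule sub_subset[OF assms])
  show "sub T \<noteq> {}" using words_Nil unfolding sub_def by blast
next
  fix g assume "g \<in> sub T"
  then obtain w where "w \<in> words T" "g = ev w" by (auto simp: sub_def)
  then show "inv g \<in> sub T"
    unfolding sub_def using ev_winv[of w] words_mono[OF _ assms] by (metis imageI words_winv)
next
  fix g h assume "g \<in> sub T" "h \<in> sub T"
  then obtain u v where "u \<in> words T" "g = ev u" "v \<in> words T" "h = ev v" by (auto simp: sub_def)
  then show "g \<otimes> h \<in> sub T"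
    unfolding sub_def using ev_append[of u v] words_mono[OF _ assms] by (metis imageI words_append)
qed

lemma lk_subset: "lk a \<subseteq> V" and st_subset: "a \<in> V \<Longrightarrow> st a \<subseteq> V"
  by (auto simp: lk_def st_def)

lemma val_in_sub: "fst l \<in> T \<Longrightarrow> T \<subseteq> V \<Longrightarrow> val l \<in> sub T"
  unfolding sub_def by (rule image_eqI[of _ _ "[l]"]) auto

lemma deg_sub: assumes "g \<in> sub T" "T \<subseteq> V" "a \<notin> T" shows "deg a g = 0"
proof -
  obtain w where w: "w \<in> words T" "g = ev w" using assms(1) by (auto simp: sub_def)
  then have "degw a w = 0"
    using assms(3) by (induction w arbitrary: g) (auto simp: degw_def)
  with w show ?thesis using deg_ev[of w a] words_mono[OF w(1) assms(2)] by simp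
qed

lemma val_comm:
  assumes "fst l \<in> V" "fst m \<in> V" "adj (fst l) (fst m)"
  shows "val l \<otimes> val m = val m \<otimes> val l"
proof -
  have c: "val (fst l, True) \<otimes> val m = val m \<otimes> val (fst l, True)"
    using assms(1,2) x_comm[OF assms] comm_inv_left[of "x (fst m)" "x (fst l)"]
    by (cases "snd m") (simp_all add: val_def)
  show ?thesis
    using comm_inv_left[OF _ _ c] c assms(1,2) by (cases "snd l") (simp_all add: val_def)
qed

lemma val_comm_ev:
  assumes "fst l \<in> V" "w \<in> words V" "\<And>m. m \<in> set w \<Longrightarrow> adj (fst l) (fst m)"
  shows "val l \<otimes> ev w = ev w \<otimes> val l"
  using assms(2,3)
proof (induction w)
  case (Cons m w)
  have "val l \<otimes> (val m \<otimes> ev w) = val m \<otimes> (val l \<otimes> ev w)"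
    using val_comm[of l m] Cons.prems assms(1) by (simp flip: m_assoc)
  then show ?case using Cons assms(1) by (simp add: m_assoc)
qed (use assms in simp)

section \<open>Halfspaces\<close>

text \<open>The edges from \<open>z\<close> to \<open>z \<otimes> x a\<close> with \<open>z\<close> in \<open>sub (lk a)\<close> form the hyperplane dual to \<open>x a\<close>.
  The signed number of times a path crosses it is invariant under the relations, so it only depends
  on the end points; this gives halfspaces without any normal form for group elements.\<close>

definition step_crossing :: "'i \<Rightarrow> 'a \<Rightarrow> 'i \<times> bool \<Rightarrow> int"
  where "step_crossing a g l = (if fst l \<noteq> a then 0 else if snd l then of_bool (g \<in> sub (lk a))
    else - of_bool (g \<otimes> val l \<in> sub (lk a)))"

primrec crossings :: "'i \<Rightarrow> 'a \<Rightarrow> 'i gword \<Rightarrow> int"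
  where
    "crossings a g [] = 0"
  | "crossings a g (l # w) = step_crossing a g l + crossings a (g \<otimes> val l) w"

lemma crossings_append:
  "g \<in> carrier G \<Longrightarrow> u \<in> words V \<Longrightarrow> v \<in> words V \<Longrightarrow> crossings a g (u @ v) = crossings a g u + crossings a (g \<otimes> ev u) v"
  by (induction u arbitrary: g) (simp_all add: m_assoc)

lemma sub_mult_iff:
  assumes "T \<subseteq> V" "k \<in> sub T" "g \<in> carrier G"
  shows "g \<otimes> k \<in> sub T \<longleftrightarrow> g \<in> sub T" and "k \<otimes> g \<in> sub T \<longleftrightarrow> g \<in> sub T"
proof -
  interpret s: subgroup "sub T" G by (rule sub_subgroup[OF assms(1)])
  have k: "k \<in> carrier G" using assms by simp
  have e: "inv k \<otimes> (k \<otimes> g) = g" "g \<otimes> k \<otimes> inv k = g"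
    using k assms(3) inv_cancel[of k g] r_inv[of k] by (simp, simp only: m_assoc inv_closed r_one)
  show "g \<otimes> k \<in> sub T \<longleftrightarrow> g \<in> sub T"
    using s.m_closed[OF _ s.m_inv_closed[OF assms(2)]] s.m_closed[OF _ assms(2)] e(2) by metis
  show "k \<otimes> g \<in> sub T \<longleftrightarrow> g \<in> sub T"
    using s.m_closed[OF s.m_inv_closed[OF assms(2)]] s.m_closed[OF assms(2)] e(1) by metis
qed

text \<open>Opposite edges of a commuting square are parallel: a step along \<open>d\<close> in
  \<open>lk c\<close> does not change membership in \<open>sub (lk c)\<close>. So both ways round
  the square have the same signed crossings.\<close>

lemma crossings_swap:
  assumes "g \<in> carrier G" "c \<in> V" "d \<in> V" "adj c d"
  shows "step_crossing a g (c, True) + step_crossing a (g \<otimes> x c) (d, True) = step_crossing a g (d, True) + step_crossing a (g \<otimes> x d) (c, True)"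
proof -
  have "g \<otimes> x d \<in> sub (lk c) \<longleftrightarrow> g \<in> sub (lk c)"
    using assms val_in_sub[of "(d, True)" "lk c"] lk_subset
    by (intro sub_mult_iff(1)) (auto simp: val_def lk_def)
  moreover have "g \<otimes> x c \<in> sub (lk d) \<longleftrightarrow> g \<in> sub (lk d)"
    using assms val_in_sub[of "(c, True)" "lk d"] lk_subset adj_sym
    by (intro sub_mult_iff(1)) (auto simp: val_def lk_def)
  ultimately show ?thesis using assms adj_irrefl by (auto simp: step_crossing_def)
qed

lemma crossings_invariant:
  assumes "v \<in> words V" "w \<in> words V" "ev v = ev w" "g \<in> carrier G"
  shows "crossings a g v = crossings a g w"
proof (rule ev_invariant[where F = "crossings a g", OF assms(1-3)])
  fix u v :: "'i gword" and b :: 'i and e :: bool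
  assume h: "u \<in> words V" "v \<in> words V" "b \<in> V"
  let ?h = "g \<otimes> ev u"
  have "?h \<otimes> val (b, e) \<otimes> val (b, \<not> e) = ?h"
    using h assms(4) by (simp add: m_assoc val_def)
  moreover from this have "step_crossing a ?h (b, e) + step_crossing a (?h \<otimes> val (b, e)) (b, \<not> e) = 0"
    by (auto simp: step_crossing_def)
  moreover have "crossings a ?h ([(b, e), (b, \<not> e)] @ v) = step_crossing a ?h (b, e) + step_crossing a (?h \<otimes> val (b, e)) (b, \<not> e)
      + crossings a (?h \<otimes> val (b, e) \<otimes> val (b, \<not> e)) v"
    by simp
  ultimately have "crossings a ?h ([(b, e), (b, \<not> e)] @ v) = crossings a ?h v" by simp
  then show "crossings a g (u @ [(b, e), (b, \<not> e)] @ v) = crossings a g (u @ v)"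
    using h assms(4) by (simp only: crossings_append words_append words_Cons words_Nil fst_conv simp_thms)
next
  fix u v :: "'i gword" and c d :: 'i
  assume h: "u \<in> words V" "v \<in> words V" "c \<in> V" "d \<in> V" "adj c d"
  let ?h = "g \<otimes> ev u"
  have "?h \<otimes> x c \<otimes> x d = ?h \<otimes> x d \<otimes> x c"
    using h assms(4) by (simp add: m_assoc x_comm[of c d])
  then have "crossings a ?h ([(c, True), (d, True)] @ v) = crossings a ?h ([(d, True), (c, True)] @ v)"
    using crossings_swap[of ?h c d a] h assms(4) by (simp add: val_def)
  then show "crossings a g (u @ [(c, True), (d, True)] @ v) = crossings a g (u @ [(d, True), (c, True)] @ v)"
    using h assms(4) by (simp only: crossings_append words_append words_Cons words_Nil fst_conv simp_thms)
qed

text \<open>The hyperplane meant is the one dual to the edge from \<one> to \<open>x a\<close>. By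
  \<open>side_01\<close> the number is 0 or 1 and thus tells on which side \<open>g\<close>
  lies.\<close>

definition side :: "'i \<Rightarrow> 'a \<Rightarrow> int"
  where "side a g = crossings a \<one> (word_of g)"

lemma side_ev: "w \<in> words V \<Longrightarrow> side a (ev w) = crossings a \<one> w"
  unfolding side_def using word_of[of "ev w"] by (intro crossings_invariant) simp_all

lemma side_one [simp]: "side a \<one> = 0"
  using side_ev[of "[]" a] by simp

lemma side_step:
  assumes "g \<in> carrier G" "fst l \<in> V"
  shows "side a (g \<otimes> val l) = side a g + step_crossing a g l"
proof -
  have w: "word_of g \<in> words V" "ev (word_of g) = g" using word_of assms by auto
  then have "side a (g \<otimes> val l) = side a (ev (word_of g @ [l]))"
    using assms by (simp add: ev_append)
  then show ?thesis using side_ev[of "word_of g @ [l]" a] side_ev[of "word_of g" a] w assms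
    by (simp add: crossings_append)
qed

text \<open>Left multiplication by \<open>sub (lk a)\<close> maps the hyperplane dual to
  \<open>x a\<close> to itself.\<close>

lemma crossings_left:
  assumes "k \<in> sub (lk a)" "g \<in> carrier G" "w \<in> words V"
  shows "crossings a (k \<otimes> g) w = crossings a g w"
  using assms(2,3)
proof (induction w arbitrary: g)
  case (Cons l w)
  have k: "k \<in> carrier G" using assms(1) sub_subset[OF lk_subset] by blast
  have "step_crossing a (k \<otimes> g) l = step_crossing a g l"
    using sub_mult_iff(2)[OF lk_subset assms(1), of g] sub_mult_iff(2)[OF lk_subset assms(1), of "g \<otimes> val l"]
      Cons.prems k by (auto simp: step_crossing_def m_assoc)
  then show ?case using Cons k by (simp add: m_assoc)
qed simp

lemma side_link: assumes "k \<in> sub (lk a)" shows "side a k = 0"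
proof -
  obtain w where w: "w \<in> words (lk a)" "k = ev w" using assms by (auto simp: sub_def)
  have "crossings a g w = 0" for g
    using w(1) by (induction w arbitrary: g) (auto simp: step_crossing_def lk_def adj_irrefl)
  then show ?thesis using w side_ev[of w a] words_mono[OF w(1) lk_subset] by simp
qed

lemma side_left:
  assumes "k \<in> sub (lk a)" "g \<in> carrier G"
  shows "side a (k \<otimes> g) = side a g"
proof -
  have k: "k \<in> carrier G" using assms(1) sub_subset[OF lk_subset] by blast
  have w: "word_of g \<in> words V" "ev (word_of g) = g" "word_of k \<in> words V" "ev (word_of k) = k"
    using word_of assms k by auto
  have "side a (k \<otimes> g) = side a k + crossings a k (word_of g)"
    using side_ev[of "word_of k @ word_of g" a] side_ev[of "word_of k" a] w k
    by (simp add: crossings_append ev_append)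
  also have "\<dots> = side a g"
    using crossings_left[OF assms(1) one_closed w(1)] k side_link[OF assms(1)] by (simp add: side_def)
  finally show ?thesis .
qed

text \<open>A forward crossing starts in \<open>sub (lk a)\<close>, where the value is 0 by
  \<open>side_link\<close>; a backward crossing ends there, hence starts at value 1. So no step
  leaves the set {0, 1}.\<close>

lemma side_01:
  assumes "g \<in> carrier G" "a \<in> V" shows "side a g \<in> {0, 1}"
  using assms(1)
proof (induction rule: letters_induct)
  case (step h l)
  have "side a h = 0" if "fst l = a" "snd l" "h \<in> sub (lk a)"
    using that side_link by blast
  moreover have "side a h = 1" if "fst l = a" "\<not> snd l" "h \<otimes> val l \<in> sub (lk a)"
  proof -
    \<comment> \<open>Retracing the backward edge raises the value from 0 at its end to 1 at
      \<open>h\<close>.\<close>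
    have "side a (h \<otimes> val l \<otimes> val (a, True)) = side a (h \<otimes> val l) + step_crossing a (h \<otimes> val l) (a, True)"
      using step assms by (intro side_step) simp_all
    moreover have "h \<otimes> val l \<otimes> val (a, True) = h"
      using step that assms by (simp add: val_def m_assoc)
    ultimately show ?thesis using that side_link[of "h \<otimes> val l" a] by (simp add: step_crossing_def)
  qed
  ultimately show ?case
    using step side_step[OF step(1,2), of a] unfolding step_crossing_def by (auto split: if_splits)
qed simp

definition halfspace :: "'i \<Rightarrow> 'a \<Rightarrow> 'a set"
  where "halfspace a g = {y \<in> carrier G. side a (inv g \<otimes> y) = 1}"

definition halfspaces :: "'i \<Rightarrow> 'a set set"
  where "halfspaces a = {halfspace a g | g. g \<in> carrier G} \<union> {carrier G - halfspace a g | g. g \<in> carrier G}"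

text \<open>The halfspace entered by the step \<open>l\<close> from \<open>y\<close>. An inverse
  letter runs along its edge backwards, hence the complement and the base point
  \<open>y \<otimes> val l\<close>.\<close>

definition far :: "'a \<Rightarrow> 'i \<times> bool \<Rightarrow> 'a set"
  where "far y l = (if snd l then halfspace (fst l) y else carrier G - halfspace (fst l) (y \<otimes> val l))"

definition cross :: "'a set \<Rightarrow> 'a \<Rightarrow> 'i \<times> bool \<Rightarrow> bool"
  where "cross E y l \<longleftrightarrow> (y \<in> E) \<noteq> (y \<otimes> val l \<in> E)"

lemma halfspaces_subset: "E \<in> halfspaces a \<Longrightarrow> E \<subseteq> carrier G"
  by (auto simp: halfspaces_def halfspace_def)

lemma halfspace_subset: "halfspace a g \<subseteq> carrier G"
  by (auto simp: halfspace_def)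

lemma halfspaces_compl: "E \<in> halfspaces a \<Longrightarrow> carrier G - E \<in> halfspaces a"
  using halfspace_subset by (auto simp: halfspaces_def double_diff)

lemma far_halfspaces: "y \<in> carrier G \<Longrightarrow> fst l \<in> V \<Longrightarrow> far y l \<in> halfspaces (fst l)"
  by (auto simp: far_def halfspaces_def)

text \<open>A hyperplane of label \<open>a\<close> corresponds to a left coset of
  \<open>sub (lk a)\<close>, by \<open>side_left\<close>.\<close>

lemma halfspace_eq:
  assumes "g \<in> carrier G" "h \<in> carrier G" "inv g \<otimes> h \<in> sub (lk a)"
  shows "halfspace a g = halfspace a h"
proof -
  have "side a (inv g \<otimes> y) = side a (inv h \<otimes> y)" if y: "y \<in> carrier G" for y
  proof -
    have "inv g \<otimes> y = (inv g \<otimes> h) \<otimes> (inv h \<otimes> y)"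
      using assms(1,2) y by (simp add: m_assoc)
    then show ?thesis using side_left[OF assms(3), of "inv h \<otimes> y"] assms(1,2) y by simp
  qed
  then show ?thesis by (auto simp: halfspace_def)
qed

text \<open>For an edge crossing the boundary of \<open>halfspace a g\<close> this is the end point in \<open>g sub (lk a)\<close>.\<close>

definition base :: "'a \<Rightarrow> 'i \<times> bool \<Rightarrow> 'a"
  where "base y l = (if snd l then y else y \<otimes> val l)"

lemma base_in: "y \<in> carrier G \<Longrightarrow> fst l \<in> V \<Longrightarrow> base y l \<in> carrier G"
  by (simp add: base_def)

lemma side_cross:
  assumes "a \<in> V" "y \<in> carrier G" "fst l \<in> V"
  shows "(side a y = 1) \<noteq> (side a (y \<otimes> val l) = 1) \<longleftrightarrow> fst l = a \<and> base y l \<in> sub (lk a)"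
  using side_step[OF assms(2,3), of a] side_01[OF assms(2,1)] side_01[of "y \<otimes> val l" a] assms
  by (auto simp: step_crossing_def base_def)

lemma cross_halfspace:
  assumes "a \<in> V" "g \<in> carrier G" "y \<in> carrier G" "fst l \<in> V"
  shows "cross (halfspace a g) y l \<longleftrightarrow> fst l = a \<and> inv g \<otimes> base y l \<in> sub (lk a)"
  using side_cross[OF assms(1), of "inv g \<otimes> y" l] assms
  by (simp add: cross_def halfspace_def base_def m_assoc)

lemma cross_compl: "y \<in> carrier G \<Longrightarrow> fst l \<in> V \<Longrightarrow> cross (carrier G - E) y l \<longleftrightarrow> cross E y l"
  by (auto simp: cross_def)

lemma base_far: "y \<in> carrier G \<Longrightarrow> fst l \<in> V \<Longrightarrow> far y l = (if snd l then halfspace (fst l) (base y l) else carrier G - halfspace (fst l) (base y l))"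
  by (simp add: far_def base_def)

lemma far_props:
  assumes "y \<in> carrier G" "fst l \<in> V"
  shows "y \<notin> far y l" and "y \<otimes> val l \<in> far y l"
proof -
  let ?a = "fst l"
  have 1: "h \<notin> halfspace ?a h" if "h \<in> carrier G" for h using that by (simp add: halfspace_def)
  have 2: "h \<otimes> x ?a \<in> halfspace ?a h" if "h \<in> carrier G" for h
  proof -
    have "\<one> \<in> sub (lk ?a)" by (rule subgroup.one_closed[OF sub_subgroup[OF lk_subset]])
    then show ?thesis
      using cross_halfspace[OF assms(2) that that, of "(?a, True)"] 1[OF that] that assms(2)
      by (simp add: cross_def val_def base_def)
  qed
  show "y \<notin> far y l" "y \<otimes> val l \<in> far y l"
    using 1[of y] 2[of y] 1[of "y \<otimes> val l"] 2[of "y \<otimes> val l"] assms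
    by (auto simp: far_def val_def m_assoc)
qed

lemma cross_far: "y \<in> carrier G \<Longrightarrow> fst l \<in> V \<Longrightarrow> cross (far y l) y l"
  using far_props by (simp add: cross_def)

lemma halfspaces_cases:
  assumes "E \<in> halfspaces a"
  obtains g where "g \<in> carrier G" "E = halfspace a g \<or> E = carrier G - halfspace a g"
  using assms by (auto simp: halfspaces_def)

text \<open>An edge is dual to just one hyperplane; as both sides of it count as halfspaces,
  \<open>E\<close> is determined only up to complement.\<close>

lemma cross_label:
  assumes "E \<in> halfspaces a" "a \<in> V" "y \<in> carrier G" "fst l \<in> V" "cross E y l"
  shows "fst l = a" and "E = far y l \<or> E = carrier G - far y l"
proof -
  obtain g where g: "g \<in> carrier G" "E = halfspace a g \<or> E = carrier G - halfspace a g"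
    using assms(1) by (rule halfspaces_cases)
  then have "cross (halfspace a g) y l" using assms by (auto simp: cross_compl)
  then have c: "fst l = a" "inv g \<otimes> base y l \<in> sub (lk a)"
    using cross_halfspace assms g by blast+
  then show "fst l = a" by simp
  have "halfspace a g = halfspace a (base y l)" using c(2) g assms base_in by (intro halfspace_eq) auto
  then show "E = far y l \<or> E = carrier G - far y l"
    using g(2) c(1) base_far[OF assms(3,4)] halfspace_subset[of a "base y l"] by (auto simp: double_diff)
qed

lemma cross_far_eq:
  assumes "E \<in> halfspaces a" "a \<in> V" "y \<in> carrier G" "fst l \<in> V" "y \<notin> E" "y \<otimes> val l \<in> E"
  shows "E = far y l" and "fst l = a"
proof -
  have "cross E y l" using assms by (simp add: cross_def)
  from cross_label[OF assms(1-4) this] show "fst l = a" "E = far y l"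
    using assms far_props(1)[OF assms(3,4)] by auto
qed

lemma cross_base:
  assumes "E \<in> halfspaces a" "a \<in> V" "y \<in> carrier G" "fst l \<in> V" "cross E y l"
    "z \<in> carrier G" "fst m \<in> V" "cross E z m"
  shows "inv (base y l) \<otimes> base z m \<in> sub (lk a)"
proof -
  obtain g where g: "g \<in> carrier G" "E = halfspace a g \<or> E = carrier G - halfspace a g"
    using assms(1) by (rule halfspaces_cases)
  then have "cross (halfspace a g) y l" "cross (halfspace a g) z m" using assms by (auto simp: cross_compl)
  then have c: "inv g \<otimes> base y l \<in> sub (lk a)" "inv g \<otimes> base z m \<in> sub (lk a)"
    using cross_halfspace assms g by blast+
  interpret s: subgroup "sub (lk a)" G by (rule sub_subgroup[OF lk_subset])
  have b: "base y l \<in> carrier G" "base z m \<in> carrier G" using base_in assms by auto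
  have "inv (base y l) \<otimes> base z m = inv (inv g \<otimes> base y l) \<otimes> (inv g \<otimes> base z m)"
    using b g(1) by (simp add: inv_mult_group m_assoc)
  then show ?thesis using s.m_closed[OF s.m_inv_closed[OF c(1)] c(2)] by simp
qed

text \<open>Right multiplication by \<open>k\<close> is a walk along edges labelled in
  \<open>T\<close>, whereas every edge crossing the boundary of \<open>F\<close> is labelled
  \<open>b\<close>.\<close>

lemma side_right_sub:
  assumes "F \<in> halfspaces b" "b \<in> V" "b \<notin> T" "T \<subseteq> V" "y \<in> carrier G" "k \<in> sub T"
  shows "y \<otimes> k \<in> F \<longleftrightarrow> y \<in> F"
proof -
  obtain w where w: "w \<in> words T" "k = ev w" using assms by (auto simp: sub_def)
  have "y \<otimes> ev w \<in> F \<longleftrightarrow> y \<in> F"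
    using w(1) assms(5)
  proof (induction w arbitrary: y)
    case (Cons l w)
    have l: "fst l \<in> V" "fst l \<noteq> b" "w \<in> words V" using Cons assms words_mono by auto
    have "y \<otimes> val l \<otimes> ev w \<in> F \<longleftrightarrow> y \<otimes> val l \<in> F" using Cons l by auto
    moreover have "y \<otimes> val l \<in> F \<longleftrightarrow> y \<in> F"
      using cross_label(1)[OF assms(1,2) \<open>y \<in> carrier G\<close> l(1)] l by (auto simp: cross_def)
    ultimately show ?case using Cons.prems l by (simp add: m_assoc)
  qed simp
  then show ?thesis using w by simp
qed

text \<open>The edges across the boundary of \<open>E\<close> have their bases in one coset of
  \<open>sub (lk a)\<close>. Walking inside it crosses no hyperplane of label \<open>b\<close>,
  because \<open>b\<close> is not in \<open>lk a\<close>.\<close>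

lemma one_side:
  assumes E: "E \<in> halfspaces a" "a \<in> V" and F: "F \<in> halfspaces b" "b \<in> V" and nadj: "\<not> adj a b"
    and ne: "F \<noteq> E" "F \<noteq> carrier G - E"
    and y: "y \<in> carrier G" "fst l \<in> V" "cross E y l"
    and z: "z \<in> carrier G" "fst m \<in> V" "cross E z m"
  shows "y \<in> F \<longleftrightarrow> z \<in> F"
proof -
  \<comment> \<open>An edge crossing both boundaries would make \<open>E\<close> and
    \<open>F\<close> equal or complementary, by \<open>cross_label\<close>.\<close>
  have nc: "\<not> cross F u k" if "u \<in> carrier G" "fst k \<in> V" "cross E u k" for u k
  proof
    assume c: "cross F u k"
    have "far u k \<subseteq> carrier G" using halfspaces_subset[OF far_halfspaces[OF that(1,2)]] .
    then show False
      using cross_label(2)[OF E that] cross_label(2)[OF F that(1,2) c] ne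
      by (auto simp: double_diff)
  qed
  have b: "base u k \<in> F \<longleftrightarrow> u \<in> F" if "u \<in> carrier G" "fst k \<in> V" "cross E u k" for u k
    using nc[OF that] by (auto simp: base_def cross_def)
  define k where "k = inv (base y l) \<otimes> base z m"
  have k: "k \<in> sub (lk a)" unfolding k_def using cross_base E y z by blast
  have "base z m = base y l \<otimes> k" unfolding k_def using base_in y z by simp
  moreover have "base y l \<otimes> k \<in> F \<longleftrightarrow> base y l \<in> F"
    using nadj F k base_in y by (intro side_right_sub[OF F _ lk_subset]) (auto simp: lk_def)
  ultimately show ?thesis using b[OF y] b[OF z] by simp
qed

lemma halfspaces_cross_ex:
  assumes "E \<in> halfspaces a" "a \<in> V"
  obtains y l where "y \<in> carrier G" "fst l \<in> V" "cross E y l"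
proof -
  obtain g where g: "g \<in> carrier G" "E = halfspace a g \<or> E = carrier G - halfspace a g"
    using assms(1) by (rule halfspaces_cases)
  have "cross (halfspace a g) g (a, True)" using cross_far[of g "(a, True)"] g assms by (simp add: far_def)
  then have "cross E g (a, True)" using g assms by (auto simp: cross_compl)
  then show ?thesis using that[of g "(a, True)"] g assms by simp
qed

lemma halfspaces_ne: assumes "E \<in> halfspaces a" "a \<in> V" shows "E \<noteq> {}" "E \<noteq> carrier G"
  using halfspaces_cross_ex[OF assms] by (force simp: cross_def)+

lemma closed_trivial:
  assumes "Q \<subseteq> carrier G" "q \<in> Q" "\<And>y l. y \<in> Q \<Longrightarrow> fst l \<in> V \<Longrightarrow> y \<otimes> val l \<in> Q"
  shows "Q = carrier G"
proof -
  have "q \<otimes> g \<in> Q" if "g \<in> carrier G" for g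
    using that
  proof (induction rule: letters_induct)
    case one
    then show ?case using assms(1,2) by auto
  next
    case (step h l)
    then show ?case using assms(3)[of "q \<otimes> h" l] assms(1,2) by (auto simp: m_assoc)
  qed
  from this[of "inv q \<otimes> _"] have "g \<in> Q" if "g \<in> carrier G" for g
    using that assms(1,2) by force
  then show ?thesis using assms(1) by blast
qed

text \<open>A step out of \<open>E \<inter> F\<close> would cross one boundary while starting inside
  the other set. So a nonempty intersection is closed under all steps, hence the whole group, which
  no halfspace is.\<close>

lemma disjoint_if_boundaries_outside:
  assumes E: "E \<in> halfspaces a" "a \<in> V" and F: "F \<in> halfspaces b" "b \<in> V"
    and 1: "\<And>y l. y \<in> carrier G \<Longrightarrow> fst l \<in> V \<Longrightarrow> cross E y l \<Longrightarrow> y \<notin> F"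
    and 2: "\<And>y l. y \<in> carrier G \<Longrightarrow> fst l \<in> V \<Longrightarrow> cross F y l \<Longrightarrow> y \<notin> E"
  shows "E \<inter> F = {}"
proof (rule ccontr)
  assume "E \<inter> F \<noteq> {}"
  then obtain q where "q \<in> E \<inter> F" by blast
  moreover have "y \<otimes> val l \<in> E \<inter> F" if "y \<in> E \<inter> F" "fst l \<in> V" for y l
    using 1[of y l] 2[of y l] that halfspaces_subset[OF E(1)] by (auto simp: cross_def)
  moreover have "E \<inter> F \<subseteq> carrier G" using halfspaces_subset E by blast
  ultimately have "E \<inter> F = carrier G" using closed_trivial by blast
  then show False using halfspaces_ne[OF E] halfspaces_subset[OF E(1)] by blast
qed

text \<open>Hyperplanes with nonadjacent labels do not cross. By \<open>one_side\<close> each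
  boundary lies on one side of the other; the sides \<open>E'\<close> and \<open>F'\<close> that
  avoid the other boundary are disjoint.\<close>

lemma quadrants:
  assumes E: "E \<in> halfspaces a" "a \<in> V" and F: "F \<in> halfspaces b" "b \<in> V" and nadj: "\<not> adj a b"
  shows "E \<inter> F = {} \<or> E \<subseteq> F \<or> F \<subseteq> E \<or> E \<union> F = carrier G"
proof (cases "F = E \<or> F = carrier G - E")
  case True
  then show ?thesis using halfspaces_subset[OF E(1)] by auto
next
  case False
  let ?c = "\<lambda>A. carrier G - A"
  have ne: "F \<noteq> E" "F \<noteq> ?c E" "E \<noteq> F" "E \<noteq> ?c F"
    using False halfspaces_subset[OF E(1)] halfspaces_subset[OF F(1)] by (auto simp: double_diff)
  obtain y l where y: "y \<in> carrier G" "fst l \<in> V" "cross E y l" using halfspaces_cross_ex[OF E] .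
  obtain z m where z: "z \<in> carrier G" "fst m \<in> V" "cross F z m" using halfspaces_cross_ex[OF F] .
  have nadj': "\<not> adj b a" using nadj adj_sym by blast
  define E' where "E' = (if z \<in> E then ?c E else E)"
  define F' where "F' = (if y \<in> F then ?c F else F)"
  have E': "E' \<in> halfspaces a" and F': "F' \<in> halfspaces b" using E F halfspaces_compl by (auto simp: E'_def F'_def)
  have "E' \<inter> F' = {}"
  proof (rule disjoint_if_boundaries_outside[OF E' E(2) F' F(2)])
    fix u k assume u: "u \<in> carrier G" "fst k \<in> V" "cross E' u k"
    then have "cross E u k" using u(1,2) by (auto simp: cross_compl E'_def split: if_splits)
    then have "y \<in> F \<longleftrightarrow> u \<in> F" using one_side[OF E F nadj ne(1,2) y] u by blast
    then show "u \<notin> F'" by (auto simp: F'_def)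
  next
    fix u k assume u: "u \<in> carrier G" "fst k \<in> V" "cross F' u k"
    then have "cross F u k" using u(1,2) by (auto simp: cross_compl F'_def split: if_splits)
    then have "z \<in> E \<longleftrightarrow> u \<in> E" using one_side[OF F E nadj' ne(3,4) z] u by blast
    then show "u \<notin> E'" by (auto simp: E'_def)
  qed
  then show ?thesis using halfspaces_subset[OF E(1)] halfspaces_subset[OF F(1)]
    by (auto simp: E'_def F'_def split: if_splits)
qed

lemma nested:
  assumes "E \<in> halfspaces a" "a \<in> V" "F \<in> halfspaces b" "b \<in> V" "\<not> adj a b"
    and "p \<in> carrier G" "p \<notin> E" "p \<notin> F" "r \<in> E" "r \<in> F"
  shows "E \<subseteq> F \<or> F \<subseteq> E"
  using quadrants[OF assms(1-5)] assms(6-) by blast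

section \<open>The action of the group on its halfspaces\<close>

definition translate :: "'a \<Rightarrow> 'a set \<Rightarrow> 'a set"
  where "translate g E = {y \<in> carrier G. inv g \<otimes> y \<in> E}"

lemma translate_halfspace: "g \<in> carrier G \<Longrightarrow> h \<in> carrier G \<Longrightarrow> translate g (halfspace a h) = halfspace a (g \<otimes> h)"
  by (auto simp: translate_def halfspace_def inv_mult_group m_assoc)

lemma translate_compl: "g \<in> carrier G \<Longrightarrow> translate g (carrier G - E) = carrier G - translate g E"
  by (auto simp: translate_def)

lemma translate_halfspaces: assumes "E \<in> halfspaces a" "g \<in> carrier G" shows "translate g E \<in> halfspaces a"
proof -
  obtain h where h: "h \<in> carrier G" "E = halfspace a h \<or> E = carrier G - halfspace a h"
    using assms(1) by (rule halfspaces_cases)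
  have "g \<otimes> h \<in> carrier G" using h assms by simp
  then show ?thesis using h assms translate_halfspace[of g h a] translate_compl[of g "halfspace a h"] by (auto simp: halfspaces_def)
qed

lemma translate_tr: "g \<in> carrier G \<Longrightarrow> h \<in> carrier G \<Longrightarrow> translate g (translate h E) = translate (g \<otimes> h) E"
  by (auto simp: translate_def inv_mult_group m_assoc)

lemma translate_one: "E \<subseteq> carrier G \<Longrightarrow> translate \<one> E = E"
  by (auto simp: translate_def)

lemma translate_mono: "E \<subseteq> F \<Longrightarrow> translate g E \<subseteq> translate g F"
  by (auto simp: translate_def)

lemma translate_mem: "g \<in> carrier G \<Longrightarrow> y \<in> carrier G \<Longrightarrow> g \<otimes> y \<in> translate g E \<longleftrightarrow> y \<in> E"
  by (simp add: translate_def)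

text \<open>A stabiliser of a halfspace preserves the bounding hyperplane, so it is conjugate into the link
  of the label.\<close>

lemma stab_deg:
  assumes E: "E \<in> halfspaces a" "a \<in> V" and g: "g \<in> carrier G" "translate g E = E" and b: "b \<in> V" "\<not> adj a b"
  shows "deg b g = 0"
proof -
  obtain y l where y: "y \<in> carrier G" "fst l \<in> V" "cross E y l" using halfspaces_cross_ex[OF E] .
  have "cross E (g \<otimes> y) l"
    using y g translate_mem[of g y E] translate_mem[of g "y \<otimes> val l" E] by (simp add: cross_def m_assoc)
  then have "inv (base y l) \<otimes> base (g \<otimes> y) l \<in> sub (lk a)"
    using cross_base[OF E y] y g by simp
  moreover have "base (g \<otimes> y) l = g \<otimes> base y l" using y g by (simp add: base_def m_assoc)
  ultimately have "deg b (inv (base y l) \<otimes> (g \<otimes> base y l)) = 0"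
    using b deg_sub[OF _ lk_subset] by (auto simp: lk_def)
  then show ?thesis using base_in[OF y(1,2)] g by (simp add: deg_mult deg_inv)
qed

section \<open>Words without cancellation\<close>

definition pt :: "'a \<Rightarrow> 'i gword \<Rightarrow> nat \<Rightarrow> 'a"
  where "pt y w i = y \<otimes> ev (take i w)"

definition crosses_at :: "'a set \<Rightarrow> 'a \<Rightarrow> 'i gword \<Rightarrow> nat \<Rightarrow> bool"
  where "crosses_at E y w i \<longleftrightarrow> cross E (pt y w i) (w ! i)"

text \<open>The combinatorial trace of a hyperplane crossed twice: the two inverse letters can be
  brought together through letters commuting with them.\<close>

definition cancels :: "'i gword \<Rightarrow> nat \<Rightarrow> nat \<Rightarrow> bool"
  where "cancels w i j \<longleftrightarrow> i < j \<and> j < length w \<and> w ! j = flip (w ! i) \<and>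
    (\<forall>k. i < k \<and> k < j \<longrightarrow> adj (fst (w ! i)) (fst (w ! k)))"

definition nocancel :: "'i gword \<Rightarrow> bool"
  where "nocancel w \<longleftrightarrow> (\<forall>i j. \<not> cancels w i j)"

text \<open>Such a letter can be moved to the end of the word, see \<open>move_last\<close>.\<close>

definition final :: "'i gword \<Rightarrow> nat \<Rightarrow> bool"
  where "final w i \<longleftrightarrow> i < length w \<and> (\<forall>k. i < k \<and> k < length w \<longrightarrow> adj (fst (w ! i)) (fst (w ! k)))"

lemma pt_in [simp]: "y \<in> carrier G \<Longrightarrow> w \<in> words V \<Longrightarrow> pt y w i \<in> carrier G"
  by (simp add: pt_def words_take)

lemma pt_0 [simp]: "y \<in> carrier G \<Longrightarrow> pt y w 0 = y"
  and pt_length [simp]: "pt y w (length w) = y \<otimes> ev w"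
  by (simp_all add: pt_def)

lemma pt_Suc:
  "y \<in> carrier G \<Longrightarrow> w \<in> words V \<Longrightarrow> i < length w \<Longrightarrow> pt y w (Suc i) = pt y w i \<otimes> val (w ! i)"
  by (simp add: pt_def take_Suc_conv_app_nth ev_append words_take words_nth m_assoc)

lemma path_const:
  assumes "y \<in> carrier G" "w \<in> words V" "i \<le> j" "j \<le> length w"
    "\<And>m. i \<le> m \<Longrightarrow> m < j \<Longrightarrow> \<not> crosses_at E y w m"
  shows "pt y w i \<in> E \<longleftrightarrow> pt y w j \<in> E"
  using assms(3,4,5)
proof (induction j rule: dec_induct)
  case (step m)
  then have "\<not> crosses_at E y w m" "m < length w" by simp_all
  then have "pt y w m \<in> E \<longleftrightarrow> pt y w (Suc m) \<in> E"
    using pt_Suc[OF assms(1,2)] by (simp add: crosses_at_def cross_def)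
  with step show ?case by simp
qed simp

lemma path_cross:
  assumes "y \<in> carrier G" "w \<in> words V" "(y \<in> E) \<noteq> (y \<otimes> ev w \<in> E)"
  obtains i where "i < length w" "crosses_at E y w i"
  using path_const[OF assms(1,2), of 0 "length w" E] assms by auto

text \<open>The bases of all edges across one hyperplane lie on the same side, as they differ by
  elements of \<open>sub (lk a)\<close>. So the sign of the letter determines the direction of the
  crossing.\<close>

lemma orient:
  assumes E: "E \<in> halfspaces a" "a \<in> V" and y: "y \<in> carrier G" "fst l \<in> V" "cross E y l"
    and z: "z \<in> carrier G" "fst m \<in> V" "cross E z m" and s: "snd l = snd m"
  shows "y \<in> E \<longleftrightarrow> z \<in> E"
proof -
  define k where "k = inv (base y l) \<otimes> base z m"
  have k: "k \<in> sub (lk a)" unfolding k_def using cross_base[OF E y z] .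
  have "base z m = base y l \<otimes> k" unfolding k_def using base_in y z by simp
  moreover have "base y l \<otimes> k \<in> E \<longleftrightarrow> base y l \<in> E"
    using adj_irrefl E k base_in y by (intro side_right_sub[OF E(1) _ _ lk_subset]) (auto simp: lk_def)
  ultimately have "base y l \<in> E \<longleftrightarrow> base z m \<in> E" by simp
  then show ?thesis using y z s by (auto simp: base_def cross_def)
qed

text \<open>Consider two crossings of one hyperplane at minimal distance along the word. Every
  hyperplane met between them is crossed only once there, so a nonadjacent label would produce
  points in all four quadrants. Thus the letters in between are all adjacent to
  \<open>a\<close>.\<close>

lemma double_crossing_cancels:
  assumes w: "w \<in> words V" "y \<in> carrier G"
    and d: "E \<in> halfspaces a" "a \<in> V" "i < j" "j < length w" "crosses_at E y w i" "crosses_at E y w j"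
  shows "\<not> nocancel w"
  using d
proof (induction "j - i" arbitrary: E a i j rule: less_induct)
  case less
  note E = \<open>E \<in> halfspaces a\<close> \<open>a \<in> V\<close> and ij = \<open>i < j\<close> \<open>j < length w\<close>
  note [simp] = w words_nth[OF w(1)]
  show ?case
  proof (cases "\<exists>F b i' j'. F \<in> halfspaces b \<and> b \<in> V \<and> i' < j' \<and> j' < length w \<and> j' - i' < j - i
      \<and> crosses_at F y w i' \<and> crosses_at F y w j'")
    case True
    then show ?thesis using less.hyps by blast
  next
    case False
    then have min: "\<not> crosses_at F y w j'" if "F \<in> halfspaces b" "b \<in> V" "i' < j'" "j' < length w"
      "j' - i' < j - i" "crosses_at F y w i'" for F b i' j'
      using that by blast
    have il: "i < length w" using ij by simp
    have ci: "cross E (pt y w i) (w ! i)" and cj: "cross E (pt y w j) (w ! j)"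
      using less.prems by (simp_all add: crosses_at_def)
    have lab: "fst (w ! i) = a" "fst (w ! j) = a"
      using cross_label(1)[OF E _ _ ci] cross_label(1)[OF E _ _ cj] il ij by simp_all
    have Eb: "pt y w (Suc i) \<in> E \<longleftrightarrow> pt y w m \<in> E" if "i < m" "m \<le> j" for m
      using that ij min[OF E, of i] less.prems(5) by (intro path_const) auto
    have Ei: "pt y w i \<in> E \<longleftrightarrow> pt y w (Suc i) \<notin> E"
      using ci pt_Suc[of y w i] il by (simp add: cross_def)
    have Ej: "pt y w j \<in> E \<longleftrightarrow> pt y w (Suc j) \<notin> E"
      using cj pt_Suc[of y w j] ij by (simp add: cross_def)
    have "adj a (fst (w ! m))" if m: "i < m" "m < j" for m
    proof (rule ccontr)
      assume na: "\<not> adj a (fst (w ! m))"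
      let ?K = "far (pt y w m) (w ! m)"
      have ml: "m < length w" "Suc m \<le> length w" using m ij by simp_all
      have K: "?K \<in> halfspaces (fst (w ! m))" using ml by (intro far_halfspaces) simp_all
      have Vm: "fst (w ! m) \<in> V" using ml by simp
      have xm: "crosses_at ?K y w m" unfolding crosses_at_def using ml by (intro cross_far) simp_all
      have pm: "pt y w m \<notin> ?K" "pt y w (Suc m) \<in> ?K"
        using far_props[of "pt y w m" "w ! m"] pt_Suc[of y w m] ml by simp_all
      have "pt y w m' \<in> ?K \<longleftrightarrow> pt y w m \<in> ?K" if "i \<le> m'" "m' \<le> m" for m'
      proof (rule path_const)
        fix t assume t: "m' \<le> t" "t < m"
        have "m - t < j - i" using t that m by linarith
        then show "\<not> crosses_at ?K y w t" using min[OF K Vm, of t m] xm t ml by blast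
      qed (use that ml in auto)
      then have K1: "pt y w i \<notin> ?K" "pt y w (Suc i) \<notin> ?K" using pm m by auto
      have "pt y w (Suc m) \<in> ?K \<longleftrightarrow> pt y w m' \<in> ?K" if "Suc m \<le> m'" "m' \<le> Suc j" for m'
      proof (rule path_const)
        fix t assume t: "Suc m \<le> t" "t < m'"
        have "t - m < j - i" "m < t" "t < length w" using t that m ij by linarith+
        then show "\<not> crosses_at ?K y w t" using min[OF K Vm, of m t] xm by blast
      qed (use that ij in auto)
      then have K2: "pt y w j \<in> ?K" "pt y w (Suc j) \<in> ?K" using pm m by auto
      \<comment> \<open>The points at \<open>i\<close>, \<open>Suc i\<close>, \<open>j\<close> and
        \<open>Suc j\<close> lie in the four different quadrants of \<open>E\<close> and
        \<open>?K\<close>.\<close>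
      have "pt y w i \<in> carrier G" "pt y w (Suc i) \<in> carrier G" by simp_all
      then show False
        using quadrants[OF E K Vm na] K1 K2 Ei Ej Eb[of j] ij by blast
    qed
    \<comment> \<open>The second crossing goes back through the hyperplane, so by
      \<open>orient\<close> it has the opposite sign.\<close>
    moreover have "snd (w ! i) \<noteq> snd (w ! j)"
      using orient[OF E _ _ ci _ _ cj] Ei Eb[of j] ij il by auto
    ultimately have "cancels w i j"
      using lab ij by (auto simp: cancels_def flip_def prod_eq_iff)
    then show ?thesis by (auto simp: nocancel_def)
  qed
qed

text \<open>By \<open>double_crossing_cancels\<close> the hyperplane of the letter at
  \<open>i\<close> is crossed nowhere else along the word.\<close>

lemma separates:
  assumes "w \<in> words V" "y \<in> carrier G" "nocancel w" "i < length w"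
  shows "m \<le> i \<Longrightarrow> pt y w m \<notin> far (pt y w i) (w ! i)"
    and "i < m \<Longrightarrow> m \<le> length w \<Longrightarrow> pt y w m \<in> far (pt y w i) (w ! i)"
proof -
  let ?E = "far (pt y w i) (w ! i)"
  have V: "fst (w ! i) \<in> V" using words_nth assms by blast
  have E: "?E \<in> halfspaces (fst (w ! i))" using V assms by (intro far_halfspaces) simp_all
  have xi: "crosses_at ?E y w i" unfolding crosses_at_def using V assms by (intro cross_far) simp_all
  have nx: "\<not> crosses_at ?E y w k" if "k \<noteq> i" "k < length w" for k
    using double_crossing_cancels[OF assms(1,2) E V, of i k]
      double_crossing_cancels[OF assms(1,2) E V, of k i] xi assms that by (cases "k < i") auto
  have p: "pt y w i \<notin> ?E" "pt y w (Suc i) \<in> ?E"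
    using far_props[of "pt y w i" "w ! i"] V pt_Suc[of y w i] assms by simp_all
  show "pt y w m \<notin> ?E" if "m \<le> i"
  proof -
    have "pt y w m \<in> ?E \<longleftrightarrow> pt y w i \<in> ?E" using assms that nx by (intro path_const) auto
    with p show ?thesis by simp
  qed
  show "pt y w m \<in> ?E" if "i < m" "m \<le> length w"
  proof -
    have "pt y w (Suc i) \<in> ?E \<longleftrightarrow> pt y w m \<in> ?E" using assms that nx by (intro path_const) auto
    with p show ?thesis by simp
  qed
qed

text \<open>The hyperplane of each letter of \<open>w\<close> separates \<one> from
  \<open>ev w\<close>, so a word over \<open>T\<close> with the same value crosses it as well and
  contains its label. This takes the place of a normal form theorem.\<close>

lemma nocancel_letters:
  assumes w: "w \<in> words V" "nocancel w" and T: "T \<subseteq> V" "ev w \<in> sub T"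
  shows "w \<in> words T"
proof -
  obtain u where u: "u \<in> words T" "ev u = ev w" using T(2) by (auto simp: sub_def)
  have uV: "u \<in> words V" using u words_mono T by blast
  have "fst (w ! i) \<in> T" if i: "i < length w" for i
  proof -
    let ?E = "far (pt \<one> w i) (w ! i)"
    have V: "fst (w ! i) \<in> V" using words_nth w i by blast
    have E: "?E \<in> halfspaces (fst (w ! i))" using V w by (intro far_halfspaces) simp_all
    have "\<one> \<notin> ?E" "\<one> \<otimes> ev u \<in> ?E"
      using separates(1)[OF w(1) one_closed w(2) i, of 0] i u
        separates(2)[OF w(1) one_closed w(2) i, of "length w"] by simp_all
    then obtain k where k: "k < length u" "crosses_at ?E \<one> u k"
      using path_cross[OF one_closed uV, of ?E] by auto
    then have "fst (u ! k) = fst (w ! i)"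
      using cross_label(1)[OF E V, of "pt \<one> u k" "u ! k"] uV words_nth by (auto simp: crosses_at_def)
    then show ?thesis using words_nth[OF u(1) k(1)] by simp
  qed
  then show ?thesis by (metis words_iff in_set_conv_nth)
qed

lemma move_last:
  assumes "w \<in> words V" "final w i"
  shows "ev w = ev (take i w @ drop (Suc i) w) \<otimes> val (w ! i)"
proof -
  have i: "i < length w" using assms(2) by (simp add: final_def)
  have V: "fst (w ! i) \<in> V" using assms i words_nth by blast
  have d: "drop (Suc i) w \<in> words V" and t: "take i w \<in> words V"
    using assms words_drop words_take by blast+
  have "adj (fst (w ! i)) (fst m)" if "m \<in> set (drop (Suc i) w)" for m
    using that assms(2) by (auto simp: in_set_conv_nth final_def)
  then have c: "val (w ! i) \<otimes> ev (drop (Suc i) w) = ev (drop (Suc i) w) \<otimes> val (w ! i)"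
    using val_comm_ev[OF V d] by blast
  have "ev w = ev (take i w @ [w ! i] @ drop (Suc i) w)"
    using id_take_nth_drop[OF i] by simp
  then show ?thesis using c V d t by (simp add: ev_append m_assoc)
qed

lemma cancels_shorten:
  assumes "w \<in> words V" "cancels w i j"
  obtains w' where "w' \<in> words V" "ev w' = ev w" "length w' < length w"
proof -
  have ij: "i < j" "j < length w" "w ! j = flip (w ! i)"
    and b: "\<And>k. i < k \<Longrightarrow> k < j \<Longrightarrow> adj (fst (w ! i)) (fst (w ! k))"
    using assms(2) by (auto simp: cancels_def)
  define u where "u = take j w"
  define u' where "u' = take i u @ drop (Suc i) u"
  have u: "u \<in> words V" "u' \<in> words V" "drop (Suc j) w \<in> words V"
    using assms(1) by (auto simp: words_take words_drop u_def u'_def)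
  have V: "fst (w ! i) \<in> V" using words_nth assms ij by (meson less_trans)
  have "ev u = ev u' \<otimes> val (w ! i)"
    using move_last[OF u(1), of i] b ij by (simp add: u_def u'_def final_def)
  moreover have "ev w = ev (u @ [w ! j] @ drop (Suc j) w)"
    using id_take_nth_drop[OF ij(2)] by (simp add: u_def)
  ultimately have "ev (u' @ drop (Suc j) w) = ev w"
    using u V by (simp add: ev_append ij(3) val_flip m_assoc)
  moreover have "length (u' @ drop (Suc j) w) < length w"
    using ij by (simp add: u_def u'_def)
  ultimately show ?thesis using that[of "u' @ drop (Suc j) w"] u by simp
qed

lemma shortest_nocancel:
  assumes "w \<in> words V" "\<And>v. v \<in> words V \<Longrightarrow> ev v = ev w \<Longrightarrow> length w \<le> length v"
  shows "nocancel w"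
  unfolding nocancel_def
proof (intro allI notI)
  fix i j assume "cancels w i j"
  then obtain v where "v \<in> words V" "ev v = ev w" "length v < length w"
    using cancels_shorten[OF assms(1)] by blast
  then show False using assms(2)[of v] by simp
qed

lemma drop_final:
  assumes w: "w \<in> words V" "final w i" and T: "T \<subseteq> V" "fst (w ! i) \<in> T" "k \<in> sub T"
  obtains v k' where "v \<in> words V" "k' \<in> sub T" "ev w \<otimes> k = ev v \<otimes> k'" "length v < length w"
proof -
  interpret s: subgroup "sub T" G by (rule sub_subgroup[OF T(1)])
  let ?v = "take i w @ drop (Suc i) w"
  have v: "?v \<in> words V" using w(1) by (simp add: words_take words_drop)
  have vl: "val (w ! i) \<in> sub T" using val_in_sub T by blast
  have "ev w \<otimes> k = ev ?v \<otimes> (val (w ! i) \<otimes> k)"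
    using move_last[OF w] v s.mem_carrier[OF vl] s.mem_carrier[OF T(3)] by (simp add: m_assoc)
  moreover have "length ?v < length w" using w(2) by (auto simp: final_def)
  ultimately show ?thesis using that[OF v s.m_closed[OF vl T(3)]] by blast
qed

text \<open>Take a shortest representative of the left coset of \<open>y\<close>; a final letter
  from \<open>T\<close> could be absorbed into \<open>k\<close> by
  \<open>drop_final\<close>.\<close>

lemma minimal_coset_word:
  assumes "y \<in> carrier G" "T \<subseteq> V"
  obtains w k where "w \<in> words V" "k \<in> sub T" "y = ev w \<otimes> k" "nocancel w"
    "\<And>i. final w i \<Longrightarrow> fst (w ! i) \<notin> T"
proof -
  interpret s: subgroup "sub T" G by (rule sub_subgroup[OF assms(2)])
  let ?P = "\<lambda>w. w \<in> words V \<and> (\<exists>k\<in>sub T. y = ev w \<otimes> k)"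
  have "?P (word_of y)" using word_of[OF assms(1)] s.one_closed assms(1) by fastforce
  then obtain w where w: "?P w" and min: "\<And>v. ?P v \<Longrightarrow> length w \<le> length v"
    using ex_has_least_nat[of ?P _ length] by blast
  then obtain k where k: "k \<in> sub T" "y = ev w \<otimes> k" by blast
  have "nocancel w" using w min by (intro shortest_nocancel) auto
  moreover have "fst (w ! i) \<notin> T" if i: "final w i" for i
  proof
    assume "fst (w ! i) \<in> T"
    then obtain v k' where "v \<in> words V" "k' \<in> sub T" "ev w \<otimes> k = ev v \<otimes> k'" "length v < length w"
      using drop_final[OF _ i assms(2) _ k(1)] w by blast
    then show False using min[of v] k by auto
  qed
  ultimately show ?thesis using that w k by blast
qed

text \<open>The conjugating word stays visible: once \<open>w\<close> has no final letter in the
  star of the middle letter, \<open>nocancel_letters\<close> applies to the whole conjugate and so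
  constrains \<open>w\<close> itself.\<close>

lemma nocancel_conj:
  assumes nc: "nocancel w"
    and fin: "\<And>i. final w i \<Longrightarrow> fst (w ! i) \<notin> st (fst l)"
    and w: "w \<in> words V"
  shows "nocancel (w @ [l] @ winv w)"
  unfolding nocancel_def
proof (intro allI notI)
  fix i j assume c: "cancels (w @ [l] @ winv w) i j"
  let ?n = "length w" and ?W = "w @ [l] @ winv w"
  have W1: "?W ! p = w ! p" if "p < ?n" for p using that by (simp add: nth_append)
  have W2: "?W ! ?n = l" by simp
  \<comment> \<open>Positions past the middle mirror those before it: \<open>p\<close> corresponds
    to \<open>2 * ?n - p\<close>.\<close>
  have W3: "?W ! p = flip (w ! (2 * ?n - p))" if "?n < p" "p \<le> 2 * ?n" for p
    using that by (auto simp: nth_append winv_def rev_nth nth_Cons' intro!: arg_cong[of _ _ "\<lambda>k. flip (w ! k)"])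
  have ij: "i < j" "j \<le> 2 * ?n" "?W ! j = flip (?W ! i)"
    and b: "\<And>k. i < k \<Longrightarrow> k < j \<Longrightarrow> adj (fst (?W ! i)) (fst (?W ! k))"
    using c by (auto simp: cancels_def)
  consider "j < ?n" | "i < ?n" "?n \<le> j" | "i = ?n" "?n < j" | "?n < i" using ij by linarith
  then show False
  proof cases
    case 1
    then have "cancels w i j"
      using ij b W1 unfolding cancels_def by auto
    then show False using nc by (simp add: nocancel_def)
  next
    case 2
    have i: "?W ! i = w ! i" using W1 2 by simp
    \<comment> \<open>Commuting with the rest of \<open>w\<close>, this letter is final; so it can
      neither be the inverse of \<open>l\<close> nor commute with \<open>l\<close>.\<close>
    have "adj (fst (w ! i)) (fst (w ! k))" if "i < k" "k < ?n" for k
      using b[of k] that 2 i W1[of k] by simp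
    then have ns: "fst (w ! i) \<notin> st (fst l)" using fin 2 by (simp add: final_def)
    show False
    proof (cases "j = ?n")
      case True
      then show False using ij W2 i ns by (simp add: st_def)
    next
      case False
      then have "adj (fst (w ! i)) (fst l)" using b[of ?n] W2 i 2 by simp
      then show False using ns adj_sym words_nth[OF w] 2 by (auto simp: st_def lk_def)
    qed
  next
    case 3
    let ?i = "2 * ?n - j"
    have "flip (w ! ?i) = flip l" using 3 ij W2 W3[of j] by simp
    then have i: "w ! ?i = l" by (metis flip_flip)
    have "adj (fst (w ! ?i)) (fst (w ! k))" if "?i < k" "k < ?n" for k
      using b[of "2 * ?n - k"] that 3 ij W3[of "2 * ?n - k"] W2 i by simp
    then have "fst (w ! ?i) \<notin> st (fst l)" using fin[of ?i] 3 ij by (simp add: final_def)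
    then show False using i by (simp add: st_def)
  next
    case 4
    let ?i = "2 * ?n - j" and ?j = "2 * ?n - i"
    have e: "?W ! i = flip (w ! ?j)" "?W ! j = flip (w ! ?i)" using W3[of i] W3[of j] 4 ij by simp_all
    then have f: "w ! ?j = flip (w ! ?i)" using ij by (metis flip_flip)
    have "adj (fst (w ! ?i)) (fst (w ! k))" if "?i < k" "k < ?j" for k
      using b[of "2 * ?n - k"] that 4 ij W3[of "2 * ?n - k"] e f by simp
    then have "cancels w ?i ?j" using f ij 4 by (auto simp: cancels_def)
    then show False using nc by (simp add: nocancel_def)
  qed
qed

section \<open>Centralisers of generators and commuting conjugates\<close>

lemma st_comm:
  assumes "u \<in> V" "k \<in> sub (st u)"
  shows "x u \<otimes> k = k \<otimes> x u"
proof -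
  obtain w where w: "w \<in> words (st u)" "k = ev w" using assms by (auto simp: sub_def)
  have "x u \<otimes> ev w = ev w \<otimes> x u"
    using w(1)
  proof (induction w)
    case (Cons l w)
    have l: "fst l \<in> V" "w \<in> words V"
      using Cons.prems st_subset[OF assms(1)] words_mono by auto
    have "x u \<otimes> val l = val l \<otimes> x u"
    proof (cases "fst l = u")
      case True
      then show ?thesis using assms by (simp add: val_def)
    next
      case False
      then have "adj u (fst l)" using Cons.prems by (simp add: st_def lk_def)
      then show ?thesis using val_comm[of "(u, True)" l] assms l by (simp add: val_def)
    qed
    then have "x u \<otimes> (val l \<otimes> ev w) = val l \<otimes> (x u \<otimes> ev w)"
      using assms l by (simp flip: m_assoc)
    then show ?case using Cons assms l by (simp add: m_assoc)
  qed (use assms in simp)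
  then show ?thesis using w by simp
qed

lemma ev_conj_word: "w \<in> words V \<Longrightarrow> fst l \<in> V \<Longrightarrow> ev (w @ [l] @ winv w) = ev w \<otimes> val l \<otimes> inv (ev w)"
  by (simp add: ev_append ev_winv m_assoc)

lemma comm_conj_trivial:
  assumes "a \<in> carrier G" "b \<in> carrier G" "a \<otimes> b = b \<otimes> a"
  shows "a \<otimes> b \<otimes> inv a = b"
  using assms by (simp add: m_assoc)

text \<open>Write \<open>y = ev w \<otimes> k\<close> with \<open>w\<close> shortest modulo
  \<open>sub (st u)\<close>. The conjugate of \<open>x u\<close> by \<open>w\<close> has no
  cancellation and equals \<open>x u\<close>, so \<open>w\<close> uses only the label
  \<open>u\<close>; its last letter may not do so, which leaves the empty word.\<close>

lemma centralizer:
  assumes u: "u \<in> V" and y: "y \<in> carrier G" "x u \<otimes> y = y \<otimes> x u"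
  shows "y \<in> sub (st u)"
proof -
  note sV = st_subset[OF u]
  obtain w k where w: "w \<in> words V" "nocancel w" and k: "k \<in> sub (st u)" "y = ev w \<otimes> k"
    and fin: "\<And>i. final w i \<Longrightarrow> fst (w ! i) \<notin> st u"
    using minimal_coset_word[OF y(1) sV] by metis
  have kc: "k \<in> carrier G" using k sub_subset[OF sV] by blast
  have "ev w = y \<otimes> inv k" using k kc w by (simp add: m_assoc)
  then have "ev w \<otimes> x u = x u \<otimes> ev w"
    using y comm_inv_left[OF kc x_in[OF u] st_comm[OF u k(1), symmetric]] kc u
    by (simp add: m_assoc flip: m_assoc[of "x u" y])
  then have "ev (w @ [(u, True)] @ winv w) = x u"
    using comm_conj_trivial[of "ev w" "x u"] w u ev_conj_word[OF w(1), of "(u, True)"]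
    by (simp add: val_def)
  moreover have "x u \<in> sub {u}" using val_in_sub[of "(u, True)" "{u}"] u by (simp add: val_def)
  moreover have "nocancel (w @ [(u, True)] @ winv w)"
    using nocancel_conj[OF w(2) _ w(1), of "(u, True)"] fin by simp
  ultimately have "w @ [(u, True)] @ winv w \<in> words {u}"
    using nocancel_letters[of "w @ [(u, True)] @ winv w" "{u}"] w u by simp
  then have wu: "w \<in> words {u}" by simp
  have "w = []"
  proof (rule ccontr)
    assume "w \<noteq> []"
    then have "fst (w ! (length w - 1)) \<notin> st u" by (intro fin) (auto simp: final_def)
    then show False using words_nth[OF wu, of "length w - 1"] \<open>w \<noteq> []\<close> by (simp add: st_def)
  qed
  then show ?thesis using k kc by simp
qed

lemma commuting_conjugates:
  assumes u: "u \<in> V" and v: "v \<in> V" and h: "h \<in> carrier G"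
    and c: "x u \<otimes> (h \<otimes> x v \<otimes> inv h) = (h \<otimes> x v \<otimes> inv h) \<otimes> x u"
  obtains p q where "p \<in> sub (st u)" "q \<in> sub (st v)" "h = p \<otimes> q"
proof -
  interpret su: subgroup "sub (st u)" G by (rule sub_subgroup[OF st_subset[OF u]])
  interpret sv: subgroup "sub (st v)" G by (rule sub_subgroup[OF st_subset[OF v]])
  define y where "y = h \<otimes> x v \<otimes> inv h"
  \<comment> \<open>The words representing the double coset of \<open>h\<close> modulo
    \<open>sub (st u)\<close> on the left and \<open>sub (st v)\<close> on the right.\<close>
  let ?P = "\<lambda>w. w \<in> words V \<and> (\<exists>p\<in>sub (st u). p \<otimes> h \<in> ev w <# sub (st v))"
  obtain w0 k0 where "w0 \<in> words V" "k0 \<in> sub (st v)" "h = ev w0 \<otimes> k0"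
    using minimal_coset_word[OF h st_subset[OF v]] by metis
  then have "w0 \<in> words V" "\<one> \<otimes> h \<in> ev w0 <# sub (st v)" using h by (auto simp: l_coset_def)
  then have "?P w0" using su.one_closed by blast
  then obtain w where w: "?P w" and min: "\<And>v. ?P v \<Longrightarrow> length w \<le> length v"
    using ex_has_least_nat[of ?P _ length] by blast
  then obtain p q where p: "p \<in> sub (st u)" and q: "q \<in> sub (st v)" and e: "p \<otimes> h = ev w \<otimes> q"
    by (auto simp: l_coset_def)
  have pc: "p \<in> carrier G" and qc: "q \<in> carrier G" and wV: "w \<in> words V" using p q w by auto
  show ?thesis
  proof (cases w)
    case Nil
    then have "h = inv p \<otimes> q" using e pc qc h by (metis ev_Nil inv_cancel(1) l_one)
    then show ?thesis using that su.m_inv_closed[OF p] q by blast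
  next
    case (Cons l w')
    have "nocancel w" using w min by (intro shortest_nocancel) auto
    moreover have "fst (w ! i) \<notin> st v" if i: "final w i" for i
    proof
      assume "fst (w ! i) \<in> st v"
      then obtain u' k' where "u' \<in> words V" "k' \<in> sub (st v)" "ev w \<otimes> q = ev u' \<otimes> k'" "length u' < length w"
        using drop_final[OF wV i st_subset[OF v] _ q] by blast
      then show False using min[of u'] e p by (auto simp: l_coset_def)
    qed
    ultimately have nc: "nocancel (w @ [(v, True)] @ winv w)"
      using nocancel_conj[of w "(v, True)"] wV by simp
    have ew: "ev w = p \<otimes> h \<otimes> inv q" using e pc qc h wV by (simp add: m_assoc)
    have "inv q \<otimes> (x v \<otimes> q) = x v" using st_comm[OF v q] qc v by simp
    then have qv: "inv q \<otimes> (x v \<otimes> (q \<otimes> z)) = x v \<otimes> z" if "z \<in> carrier G" for z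
      using that qc v by (simp flip: m_assoc)
    have W: "ev (w @ [(v, True)] @ winv w) = p \<otimes> y \<otimes> inv p"
    proof -
      have "ev (w @ [(v, True)] @ winv w) = ev w \<otimes> x v \<otimes> inv (ev w)"
        using ev_conj_word[OF wV, of "(v, True)"] v by (simp only: val_def fst_conv snd_conv if_True)
      then show ?thesis
        unfolding ew y_def using pc qc h v qv by (simp add: inv_mult_group m_assoc)
    qed
    have yc: "y \<in> carrier G" using h v by (simp add: y_def)
    have pu: "x u \<otimes> p = p \<otimes> x u" "x u \<otimes> inv p = inv p \<otimes> x u"
      using st_comm[OF u] p su.m_inv_closed by auto
    have "x u \<otimes> (p \<otimes> y \<otimes> inv p) = (x u \<otimes> p) \<otimes> (y \<otimes> inv p)" using pc yc u by (simp add: m_assoc)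
    also have "\<dots> = p \<otimes> (x u \<otimes> y) \<otimes> inv p" unfolding pu using pc yc u by (simp add: m_assoc)
    also have "\<dots> = p \<otimes> y \<otimes> (x u \<otimes> inv p)" using c yc pc u by (simp add: y_def[symmetric] m_assoc)
    also have "\<dots> = (p \<otimes> y \<otimes> inv p) \<otimes> x u" unfolding pu using pc yc u by (simp add: m_assoc)
    finally have "ev (w @ [(v, True)] @ winv w) \<in> sub (st u)"
      unfolding W using pc yc u by (intro centralizer) simp_all
    then have "w @ [(v, True)] @ winv w \<in> words (st u)"
      using nocancel_letters[OF _ nc st_subset[OF u]] wV v by simp
    then have lu: "fst l \<in> st u" by (simp add: Cons)
    have lV: "fst l \<in> V" "w' \<in> words V" using wV Cons by auto
    have "inv (val l) \<in> sub (st u)"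
      using su.m_inv_closed val_in_sub[OF lu st_subset[OF u]] by blast
    moreover have "inv (val l) \<otimes> p \<otimes> h = ev w' \<otimes> q"
      using e pc h lV qc by (simp add: Cons m_assoc)
    ultimately have "?P w'" using su.m_closed[OF _ p] q lV by (auto simp: l_coset_def)
    then show ?thesis using min[of w'] by (simp add: Cons)
  qed
qed

section \<open>Skewered halfspaces\<close>

text \<open>Take a shortest word among all conjugates. A cancellation in \<open>w @ w\<close> over
  less than a period would shorten a rotation of \<open>w\<close>; over exactly one period the
  letters agree instead of being inverse; over more, a label would be adjacent to itself.\<close>

lemma cyclic_word:
  assumes y: "y \<in> carrier G"
  obtains w h where "w \<in> words V" "h \<in> carrier G" "y = h \<otimes> ev w \<otimes> inv h" "nocancel (w @ w)"
proof -
  let ?P = "\<lambda>w. w \<in> words V \<and> (\<exists>h\<in>carrier G. y = h \<otimes> ev w \<otimes> inv h)"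
  have "?P (word_of y)" using word_of[OF y] y by (auto intro!: bexI[of _ \<one>])
  then obtain w where w: "?P w" and min: "\<And>v. ?P v \<Longrightarrow> length w \<le> length v"
    using ex_has_least_nat[of ?P _ length] by blast
  then obtain h where h: "h \<in> carrier G" "y = h \<otimes> ev w \<otimes> inv h" by blast
  let ?k = "length w"
  have nth: "(w @ w) ! p = w ! (p mod ?k)" if "p < 2 * ?k" for p
  proof (cases "p < ?k")
    case False
    then have "p mod ?k = p - ?k" using that by (simp add: mod_if)
    then show ?thesis using False by (simp add: nth_append)
  qed (simp add: nth_append)
  have "nocancel (w @ w)"
    unfolding nocancel_def
  proof (intro allI notI)
    fix i j assume c: "cancels (w @ w) i j"
    then have ij: "i < j" "j < 2 * ?k" "(w @ w) ! j = flip ((w @ w) ! i)"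
      and b: "\<And>p. i < p \<Longrightarrow> p < j \<Longrightarrow> adj (fst ((w @ w) ! i)) (fst ((w @ w) ! p))"
      by (auto simp: cancels_def)
    show False
    proof (cases "j - i < ?k")
      case False
      then have same: "(w @ w) ! (i + ?k) = (w @ w) ! i" using nth[of i] nth[of "i + ?k"] ij by simp
      show False
      proof (cases "j = i + ?k")
        case True
        then have "(w @ w) ! i = flip ((w @ w) ! i)" using ij(3) same by simp
        then have "snd ((w @ w) ! i) = snd (flip ((w @ w) ! i))" by (rule arg_cong)
        then show False by simp
      next
        case neq: False
        then have "adj (fst ((w @ w) ! i)) (fst ((w @ w) ! (i + ?k)))" using b[of "i + ?k"] False ij by force
        then show False using same adj_irrefl by simp
      qed
    next
      case True
      then have ne: "w \<noteq> []" by auto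
      let ?r = "rotate i w"
      have rn: "?r ! t = (w @ w) ! (i + t)" if "t < ?k" "i + t < 2 * ?k" for t
        using nth_rotate[OF that(1), of i] nth[OF that(2)] by simp
      have "cancels ?r 0 (j - i)"
        unfolding cancels_def
      proof (intro conjI allI impI)
        show "?r ! (j - i) = flip (?r ! 0)" using rn[of 0] rn[of "j - i"] ij True ne by simp
        fix p assume p: "0 < p \<and> p < j - i"
        then have "i + p < j" "i + p < 2 * ?k" using ij by linarith+
        then show "adj (fst (?r ! 0)) (fst (?r ! p))" using p rn[of 0] rn[of p] b[of "i + p"] ij True ne by simp
      qed (use ij True in auto)
      moreover have r: "?r \<in> words V" using w by (simp add: words_iff)
      ultimately obtain u where u: "u \<in> words V" "ev u = ev ?r" "length u < length ?r"
        using cancels_shorten by blast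
      let ?A = "take (i mod ?k) w" and ?B = "drop (i mod ?k) w"
      have AB: "?A \<in> words V" "?B \<in> words V" using w words_take words_drop by auto
      have "ev ?r = ev ?B \<otimes> ev ?A" using AB by (simp add: rotate_drop_take ev_append)
      moreover have "ev w = ev ?A \<otimes> ev ?B" using ev_append[OF AB] by simp
      ultimately have "y = (h \<otimes> ev ?A) \<otimes> ev u \<otimes> inv (h \<otimes> ev ?A)"
        using h AB u(2) by (simp add: inv_mult_group m_assoc)
      moreover have "h \<otimes> ev ?A \<in> carrier G" using h AB by simp
      ultimately have "?P u" using u(1) by blast
      then show False using min[of u] u(3) by simp
    qed
  qed
  then show ?thesis using that w h by blast
qed

definition skewers :: "'a \<Rightarrow> 'i \<Rightarrow> bool"
  where "skewers y a \<longleftrightarrow> (\<exists>E\<in>halfspaces a. translate y E \<subset> E)"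

lemma translate_psubset:
  assumes "g \<in> carrier G" "E \<subset> F" "F \<subseteq> carrier G"
  shows "translate g E \<subset> translate g F"
proof -
  have "translate (inv g) (translate g F) = F" "translate (inv g) (translate g E) = E"
    using translate_tr[of "inv g" g] translate_one[of E] translate_one[of F] assms by simp_all
  then show ?thesis using translate_mono[of E F g] assms by force
qed

lemma skewers_conj:
  assumes "g \<in> carrier G" "h \<in> carrier G" "skewers g a"
  shows "skewers (h \<otimes> g \<otimes> inv h) a"
proof -
  obtain E where E: "E \<in> halfspaces a" "translate g E \<subset> E" using assms(3) by (auto simp: skewers_def)
  have "translate (h \<otimes> g \<otimes> inv h) (translate h E) = translate h (translate g E)"
    using assms(1,2) by (simp add: translate_tr m_assoc)
  also have "\<dots> \<subset> translate h E" by (rule translate_psubset[OF assms(2) E(2) halfspaces_subset[OF E(1)]])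
  finally show ?thesis unfolding skewers_def using translate_halfspaces[OF E(1) assms(2)] by blast
qed

text \<open>Along \<open>w @ w\<close> the hyperplane of the letter at \<open>i\<close> is crossed
  only at \<open>i\<close> and its translate by \<open>ev w\<close> only at
  \<open>i + length w\<close>, so the translate is nested deeper.\<close>

lemma cyclic_skewers:
  assumes w: "w \<in> words V" "nocancel (w @ w)" and i: "i < length w"
  shows "skewers (ev w) (fst (w ! i))"
proof -
  let ?W = "w @ w" and ?k = "length w" and ?g = "ev w" and ?a = "fst (w ! i)"
  let ?E = "far (pt \<one> ?W i) (?W ! i)"
  have W: "?W \<in> words V" and V: "?a \<in> V" using w i words_nth by auto
  have Wi: "?W ! i = w ! i" and Wk: "?W ! (i + ?k) = w ! i" using i by (simp_all add: nth_append)
  have E: "?E \<in> halfspaces ?a" using far_halfspaces[of "pt \<one> ?W i" "?W ! i"] V W Wi by simp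
  have shift: "pt \<one> ?W (m + ?k) = ?g \<otimes> pt \<one> ?W m" if "m \<le> ?k" for m
    using w that by (simp add: pt_def ev_append words_take)
  have s1: "m \<le> i \<Longrightarrow> pt \<one> ?W m \<notin> ?E" and s2: "i < m \<Longrightarrow> m \<le> 2 * ?k \<Longrightarrow> pt \<one> ?W m \<in> ?E" for m
    using separates[OF W one_closed w(2), of i m] i by simp_all
  have tE: "translate ?g ?E \<in> halfspaces ?a" using translate_halfspaces[OF E] w by simp
  have "pt \<one> ?W (i + ?k) \<notin> translate ?g ?E" "pt \<one> ?W (Suc i + ?k) \<in> translate ?g ?E"
    using shift[of i] shift[of "Suc i"] s1[of i] s2[of "Suc i"] i w W
    by (simp_all add: translate_mem del: add_Suc)
  moreover have "pt \<one> ?W (Suc i + ?k) = pt \<one> ?W (i + ?k) \<otimes> val (?W ! (i + ?k))"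
    using pt_Suc[OF one_closed W, of "i + ?k"] i by simp
  \<comment> \<open>The translate is the halfspace that the path enters one period later.\<close>
  ultimately have eq: "translate ?g ?E = far (pt \<one> ?W (i + ?k)) (?W ! (i + ?k))"
    using cross_far_eq[OF tE V] W Wk V by simp
  have "pt \<one> ?W m \<notin> translate ?g ?E" if "m \<le> i + ?k" for m
    unfolding eq using separates(1)[OF W one_closed w(2) _ that] i by simp
  then have t: "pt \<one> ?W i \<notin> translate ?g ?E" "pt \<one> ?W (Suc i) \<notin> translate ?g ?E" using i by auto
  have "?E \<subseteq> translate ?g ?E \<or> translate ?g ?E \<subseteq> ?E"
  proof (rule nested[OF E V tE V adj_irrefl])
    show "pt \<one> ?W (Suc i + ?k) \<in> translate ?g ?E" by fact
  qed (use s1[of i] s2[of "Suc i + ?k"] t i W in auto)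
  then have "translate ?g ?E \<subset> ?E" using t(2) s2[of "Suc i"] i by auto
  then show ?thesis using E by (auto simp: skewers_def)
qed

lemma conj_skewers_all_labels:
  assumes y: "y \<in> carrier G"
  obtains w h where "w \<in> words V" "h \<in> carrier G" "y = h \<otimes> ev w \<otimes> inv h"
    "\<And>i. i < length w \<Longrightarrow> skewers y (fst (w ! i))"
  using cyclic_word[OF y] cyclic_skewers skewers_conj ev_in by metis

text \<open>A path from \<open>p\<close> to \<open>q\<close> has to cross every such boundary, and
  each of its finitely many edges fixes a halfspace up to complement.
  \<open>commuting_skewer\<close> and \<open>common_point\<close> draw their finiteness from
  this.\<close>

lemma finite_separating:
  assumes "a \<in> V" "p \<in> carrier G" "q \<in> carrier G"
  shows "finite {F \<in> halfspaces a. p \<notin> F \<and> q \<in> F}"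
proof -
  let ?w = "word_of (inv p \<otimes> q)"
  let ?f = "\<lambda>i. far (pt p ?w i) (?w ! i)"
  have w: "?w \<in> words V" "ev ?w = inv p \<otimes> q" using word_of assms by simp_all
  have "{F \<in> halfspaces a. p \<notin> F \<and> q \<in> F} \<subseteq> ?f ` {..<length ?w} \<union> (\<lambda>i. carrier G - ?f i) ` {..<length ?w}"
  proof
    fix F assume "F \<in> {F \<in> halfspaces a. p \<notin> F \<and> q \<in> F}"
    then have F: "F \<in> halfspaces a" "p \<notin> F" "q \<in> F" by auto
    then have "(p \<in> F) \<noteq> (p \<otimes> ev ?w \<in> F)" using w assms by simp
    then obtain i where i: "i < length ?w" "crosses_at F p ?w i" using path_cross[OF assms(2) w(1)] by blast
    then have "F = ?f i \<or> F = carrier G - ?f i"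
      using cross_label(2)[OF F(1) assms(1), of "pt p ?w i" "?w ! i"] w words_nth assms(2)
      by (auto simp: crosses_at_def)
    then show "F \<in> ?f ` {..<length ?w} \<union> (\<lambda>i. carrier G - ?f i) ` {..<length ?w}" using i by blast
  qed
  then show ?thesis by (rule finite_subset) simp
qed

lemma int_pow_commute:
  assumes "y \<in> carrier G" "z \<in> carrier G" "y \<otimes> z = z \<otimes> y"
  shows "y [^] (i::int) \<otimes> z [^] (j::int) = z [^] j \<otimes> y [^] i"
proof -
  have *: "a [^] (i::int) \<otimes> b = b \<otimes> a [^] i"
    if "a \<in> carrier G" "b \<in> carrier G" "a \<otimes> b = b \<otimes> a" for a b i
  proof -
    have n: "a [^] (k::nat) \<otimes> b = b \<otimes> a [^] k" for k
    proof (induction k)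
      case (Suc k)
      have "a [^] k \<otimes> (a \<otimes> b) = (a [^] k \<otimes> b) \<otimes> a" using that by (simp add: m_assoc)
      then show ?case using Suc that by (simp add: m_assoc)
    qed (use that in simp)
    show ?thesis
      using n comm_inv_left[OF _ that(2) n] that by (cases i rule: int_cases2) (simp_all add: int_pow_int int_pow_neg_int)
  qed
  have "y [^] i \<otimes> z = z \<otimes> y [^] i" using *[OF assms] .
  then show ?thesis using *[of z "y [^] i" j] assms by simp
qed

text \<open>An element commuting with \<open>y\<close> permutes the halfspaces comparable with all translates of \<open>E\<close>
  under powers of \<open>y\<close>; modulo powers of \<open>y\<close> there are only finitely many of them.\<close>

lemma commuting_skewer:
  assumes a: "a \<in> V" and y: "y \<in> carrier G" "skewers y a" and z: "z \<in> carrier G" "y \<otimes> z = z \<otimes> y"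
  obtains p q :: int where "q \<noteq> 0" "\<And>b. b \<in> V \<Longrightarrow> \<not> adj a b \<Longrightarrow> p * deg b y + q * deg b z = 0"
proof -
  obtain E where E: "E \<in> halfspaces a" "translate y E \<subset> E" using y(2) by (auto simp: skewers_def)
  have EG: "E \<subseteq> carrier G" by (rule halfspaces_subset[OF E(1)])
  define Y where "Y r = translate (y [^] r) E" for r :: int
  define Z where "Z j = translate (z [^] j) E" for j :: int
  note c [simp] = y(1) z(1)
  have YHS: "Y r \<in> halfspaces a" and ZHS: "Z j \<in> halfspaces a" for r j
    unfolding Y_def Z_def using translate_halfspaces[OF E(1)] by simp_all
  have Y0: "Y 0 = E" unfolding Y_def using translate_one[OF EG] by simp
  have Ystep: "Y (r + 1) \<subset> Y r" for r
    using translate_psubset[of "y [^] r", OF _ E(2) EG] translate_tr[of "y [^] r" y E] int_pow_mult[of y r 1]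
    by (simp add: Y_def)
  have Yless: "Y s \<subset> Y r" if "r < s" for r s
    using that
  proof (induction s rule: int_gr_induct)
    case (step i)
    then show ?case using Ystep[of i] by blast
  qed (use Ystep in simp)
  have Yle: "Y s \<subseteq> Y r" if "r \<le> s" for r s
    using Yless[of r s] that by (cases "r = s") auto
  have inj: "inj Y" using Yless by (metis injI linorder_neqE psubsetE order_refl)
  have nfin: "\<not> finite (Y ` A)" if "\<not> finite A" for A
    using that finite_imageD[OF _ inj_on_subset[OF inj]] by blast
  obtain e where e: "e \<in> E" using halfspaces_ne[OF E(1) a] by blast
  obtain e' where e': "e' \<in> carrier G" "e' \<notin> E" using halfspaces_ne[OF E(1) a] EG by blast
  have eG: "e \<in> carrier G" using e EG by blast
  \<comment> \<open>Otherwise the infinitely many \<open>Y r\<close> with r \<le> 0 would all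
    separate \<open>u\<close> from \<open>e\<close>.\<close>
  have Yun: "\<exists>r. u \<in> Y r" if u: "u \<in> carrier G" for u
  proof (rule ccontr)
    assume n: "\<nexists>r. u \<in> Y r"
    have "Y ` {..0} \<subseteq> {F \<in> halfspaces a. u \<notin> F \<and> e \<in> F}" using n YHS Yle[of _ 0] e Y0 by auto
    then show False using finite_subset[OF _ finite_separating[OF a u eG]] nfin[of "{..0}"] by (simp add: infinite_Iic)
  qed
  have Yin: "\<exists>r. u \<notin> Y r" if u: "u \<in> carrier G" for u
  proof (rule ccontr)
    assume n: "\<nexists>r. u \<notin> Y r"
    have "Y ` {0..} \<subseteq> {F \<in> halfspaces a. e' \<notin> F \<and> u \<in> F}" using n YHS Yle[of 0] e' Y0 by auto
    then show False using finite_subset[OF _ finite_separating[OF a e'(1) u]] nfin[of "{0..}"] by (simp add: infinite_Ici)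
  qed
  have pc: "y [^] (i::int) \<otimes> z [^] (j::int) = z [^] j \<otimes> y [^] i" for i j
    by (rule int_pow_commute[OF y(1) z])
  have memY: "y [^] m \<otimes> u \<in> Y r \<longleftrightarrow> u \<in> Y (r - m)" if u: "u \<in> carrier G" for m r u
  proof -
    have "inv (y [^] r) \<otimes> y [^] m = inv (y [^] (r - m))"
      by (simp flip: int_pow_mult int_pow_neg)
    then have "inv (y [^] r) \<otimes> (y [^] m \<otimes> u) = inv (y [^] (r - m)) \<otimes> u"
      using u by (simp flip: m_assoc)
    then show ?thesis using u by (simp add: Y_def translate_def)
  qed
  have memZ: "y [^] m \<otimes> u \<in> Z j \<longleftrightarrow> inv (z [^] j) \<otimes> u \<in> Y (- m)" if u: "u \<in> carrier G" for m j u
  proof -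
    have "inv (z [^] j) \<otimes> (y [^] m \<otimes> u) = inv (y [^] (- m)) \<otimes> (inv (z [^] j) \<otimes> u)"
      using u pc[of m "- j"] by (simp add: int_pow_neg flip: m_assoc)
    then show ?thesis using u by (simp add: Y_def Z_def translate_def)
  qed
  \<comment> \<open>A high power of \<open>y\<close> moves \<open>e\<close> into both halfspaces, a
    low one moves \<open>e'\<close> outside both; two halfspaces of equal label in this position are
    nested.\<close>
  have comp: "Y r \<subseteq> Z j \<or> Z j \<subseteq> Y r" for r j
  proof -
    obtain r2 where r2: "inv (z [^] j) \<otimes> e \<in> Y r2" using Yun[of "inv (z [^] j) \<otimes> e"] eG by auto
    define m where "m = max r (- r2)"
    have "r - m \<le> 0" "- m \<le> r2" by (auto simp: m_def)
    then have "y [^] m \<otimes> e \<in> Y r" "y [^] m \<otimes> e \<in> Z j"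
      using memY[OF eG] memZ[OF eG] r2 e Y0 Yle[of "r - m" 0] Yle[of "- m" r2] by auto
    moreover
    obtain r3 where r3: "inv (z [^] j) \<otimes> e' \<notin> Y r3" using Yin[of "inv (z [^] j) \<otimes> e'"] e' by auto
    define m' where "m' = min r (- r3)"
    have "0 \<le> r - m'" "r3 \<le> - m'" by (auto simp: m'_def)
    then have "y [^] m' \<otimes> e' \<notin> Y r" "y [^] m' \<otimes> e' \<notin> Z j"
      using memY[OF e'(1)] memZ[OF e'(1)] r3 e' Y0 Yle[of 0 "r - m'"] Yle[of r3 "- m'"]
      by auto
    moreover have "y [^] m' \<otimes> e' \<in> carrier G" using e' by simp
    ultimately show ?thesis using nested[OF YHS a ZHS a adj_irrefl] by blast
  qed
  \<comment> \<open>Comparable with the whole chain, \<open>Z j\<close> lies between two consecutive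
    members of it.\<close>
  have "\<exists>r. Z j \<subseteq> Y r \<and> Y (r + 1) \<subseteq> Z j" for j
  proof (rule ccontr)
    assume n: "\<nexists>r. Z j \<subseteq> Y r \<and> Y (r + 1) \<subseteq> Z j"
    then have up: "Z j \<subseteq> Y r \<Longrightarrow> Z j \<subseteq> Y (r + 1)" for r using comp by blast
    obtain r0 where r0: "Z j \<subseteq> Y r0"
    proof -
      have "Z j \<noteq> carrier G" "Z j \<subseteq> carrier G" using halfspaces_ne[OF ZHS a] halfspaces_subset[OF ZHS] by auto
      then obtain u where "u \<in> carrier G" "u \<notin> Z j" by blast
      then show ?thesis using that comp Yun by blast
    qed
    obtain u where u: "u \<in> Z j" "u \<in> carrier G" using halfspaces_ne[OF ZHS a] halfspaces_subset[OF ZHS] by blast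
    obtain r1 where r1: "u \<notin> Y r1" using Yin u by blast
    have "Z j \<subseteq> Y s" if "r0 \<le> s" for s
      using that by (induction s rule: int_ge_induct) (use r0 up in auto)
    then have "Z j \<subseteq> Y (max r0 r1)" by simp
    then show False using u r1 Yle[of r1 "max r0 r1"] by auto
  qed
  then obtain R where R: "\<And>j. Z j \<subseteq> Y (R j)" "\<And>j. Y (R j + 1) \<subseteq> Z j" by metis
  \<comment> \<open>Shifted back by the power \<open>R j\<close> of \<open>y\<close>, each
    \<open>Z j\<close> lies between \<open>Y 1\<close> and \<open>E\<close>, where only finitely
    many halfspaces fit; so two of the shifts coincide.\<close>
  define f where "f j = translate (y [^] (- R j)) (Z j)" for j
  have trY: "translate (y [^] (- m)) (Y r) = Y (r - m)" for m r
    using translate_tr[of "y [^] (- m)" "y [^] r"] int_pow_mult[of y "- m" r] by (simp add: Y_def)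
  have f1: "Y 1 \<subseteq> f j" and f2: "f j \<subseteq> E" for j
    using translate_mono[OF R(1)[of j], of "y [^] (- R j)"] translate_mono[OF R(2)[of j], of "y [^] (- R j)"] trY Y0
    by (simp_all add: f_def)
  obtain s where s: "s \<in> Y 1" "s \<in> carrier G" using halfspaces_ne[OF YHS a] halfspaces_subset[OF YHS] by blast
  have "range f \<subseteq> {F \<in> halfspaces a. e' \<notin> F \<and> s \<in> F}"
  proof
    fix F assume "F \<in> range f"
    then obtain j where "F = f j" by blast
    moreover have "f j \<in> halfspaces a" unfolding f_def using translate_halfspaces[OF ZHS] by simp
    ultimately show "F \<in> {F \<in> halfspaces a. e' \<notin> F \<and> s \<in> F}" using f1[of j] f2[of j] s e' by auto
  qed
  then have "finite (range f)" using finite_subset finite_separating[OF a e'(1) s(2)] by blast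
  then have "\<not> inj f" using finite_imageD infinite_UNIV_int by blast
  then obtain j j' where jj: "j \<noteq> j'" "f j = f j'" by (auto simp: inj_def)
  define u where "u k = y [^] (- R k) \<otimes> z [^] k" for k
  have uG: "u k \<in> carrier G" for k by (simp add: u_def)
  have fu: "f k = translate (u k) E" for k unfolding f_def Z_def u_def by (simp add: translate_tr)
  \<comment> \<open>The coincidence yields a stabiliser of \<open>E\<close>; its degrees vanish by
    \<open>stab_deg\<close>, which is the relation with \<open>q = j - j'\<close>.\<close>
  have "translate (inv (u j') \<otimes> u j) E = translate (inv (u j')) (translate (u j') E)"
    using jj(2) uG by (simp add: fu flip: translate_tr)
  then have "translate (inv (u j') \<otimes> u j) E = E" using translate_tr uG translate_one[OF EG] by simp
  then have *: "deg b (inv (u j') \<otimes> u j) = 0" if "b \<in> V" "\<not> adj a b" for b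
    using stab_deg[OF E(1) a _ _ that] uG by simp
  have du: "deg b (u k) = - R k * deg b y + k * deg b z" for b k
    by (simp add: u_def deg_mult deg_pow)
  then have "(R j' - R j) * deg b y + (j - j') * deg b z = 0" if "b \<in> V" "\<not> adj a b" for b
  proof -
    have "deg b (u j) = deg b (u j')" using *[OF that] uG by (simp add: deg_mult deg_inv)
    then show ?thesis unfolding du by (simp add: left_diff_distrib)
  qed
  then show ?thesis using that[of "j - j'" "R j' - R j"] jj by simp
qed

end

section \<open>Automorphisms of rigid right-angled Artin groups\<close>

text \<open>If some \<open>k\<close> in \<open>K1\<close> were outside \<open>span s\<close>, then
  \<open>insert k s\<close> would be an independent family larger than the spanning set
  \<open>insert b K1\<close>. So \<open>span s\<close> contains \<open>K1\<close>, and likewise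
  \<open>K2\<close>.\<close>

lemma (in vector_space) card_common_span:
  assumes s: "independent s" "finite s"
    and K: "finite K1" "finite K2" "independent (K1 \<union> K2)" "card K1 < card s" "card K2 < card s"
    and sp: "s \<subseteq> span (insert b K1)" "s \<subseteq> span (insert b K2)"
  shows "card (K1 \<union> K2) \<le> card s"
proof -
  have "K \<subseteq> span s" if "finite K" "card K < card s" "s \<subseteq> span (insert b K)" for K
  proof
    fix k assume k: "k \<in> K"
    show "k \<in> span s"
    proof (rule ccontr)
      assume nk: "k \<notin> span s"
      then have "independent (insert k s)" using independent_insertI s by blast
      moreover have "insert k s \<subseteq> span (insert b K)" using that k by (simp add: span_base)
      ultimately have "card (insert k s) \<le> card (insert b K)"
        using independent_span_bound[of "insert b K" "insert k s"] that(1) by simp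
      moreover have "k \<notin> s" using nk span_base by blast
      ultimately show False using s(2) that(1,2) card_insert_le_m1[of "Suc (card K)" K b]
        by (simp add: card_insert_if split: if_splits)
    qed
  qed
  then have "K1 \<union> K2 \<subseteq> span s" using K sp by simp
  then show ?thesis using independent_span_bound[OF s(2) K(3)] by simp
qed

text \<open>The abelianisation is taken with rational coefficients because
  \<open>commuting_skewer\<close> gives relations with an arbitrary nonzero factor \<open>q\<close>,
  by which one has to divide.\<close>

interpretation fv: vector_space "\<lambda>(r::rat) (f::'i \<Rightarrow> rat) i. r * f i"
  by unfold_locales (auto simp: fun_eq_iff algebra_simps)

lemma dual_independent:
  fixes f :: "'j \<Rightarrow> 'i \<Rightarrow> rat" and L :: "'j \<Rightarrow> ('i \<Rightarrow> rat) \<Rightarrow> rat"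
  assumes add: "\<And>v g h. L v (g + h) = L v g + L v h" and sc: "\<And>v r g. L v (\<lambda>i. r * g i) = r * L v g"
    and dual: "\<And>u v. u \<in> A \<Longrightarrow> v \<in> A \<Longrightarrow> L v (f u) = (if u = v then 1 else 0)"
  shows "fv.independent (f ` A)" and "inj_on f A"
proof -
  show inj: "inj_on f A"
    by (rule inj_onI) (metis dual zero_neq_one)
  have L0: "L v 0 = 0" for v using sc[of v 0 0] by (simp add: zero_fun_def)
  show "fv.independent (f ` A)"
    unfolding fv.dependent_def
  proof (intro notI, elim bexE)
    fix g assume g: "g \<in> f ` A" "g \<in> fv.span (f ` A - {g})"
    then obtain v where v: "v \<in> A" "g = f v" by blast
    have "fv.subspace {g. L v g = 0}"
      unfolding fv.subspace_def using add sc L0 by simp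
    moreover have "f ` A - {g} \<subseteq> {g. L v g = 0}" using dual v by auto
    ultimately have "L v g = 0" using fv.span_minimal g(2) by blast
    then show False using dual v by simp
  qed
qed

context raag
begin

text \<open>Call a halfspace of label \<open>a\<close> major if it contains all cosets
  \<open>P v\<close> with \<open>v\<close> outside \<open>st a\<close>. A point missing the fewest
  major halfspaces misses none, and then no hyperplane can separate it from any of the
  cosets.\<close>

lemma common_point:
  assumes h: "\<And>v. v \<in> V \<Longrightarrow> h v \<in> carrier G"
    and meet: "\<And>u v. u \<in> V \<Longrightarrow> v \<in> V \<Longrightarrow> adj u v \<Longrightarrow> (h u <# sub (st u)) \<inter> (h v <# sub (st v)) \<noteq> {}"
    and conn: "\<And>a u v. a \<in> V \<Longrightarrow> u \<in> V - st a \<Longrightarrow> v \<in> V - st a \<Longrightarrow>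
      (u, v) \<in> {(u, v). u \<in> V - st a \<and> v \<in> V - st a \<and> adj u v}\<^sup>*"
    and avoid: "\<And>a b. a \<in> V \<Longrightarrow> b \<in> V \<Longrightarrow> \<exists>v\<in>V. v \<notin> st a \<and> v \<notin> st b"
  obtains g where "g \<in> carrier G" "\<And>v. v \<in> V \<Longrightarrow> g \<in> h v <# sub (st v)"
proof -
  define P where "P v = h v <# sub (st v)" for v
  have PG: "P v \<subseteq> carrier G" if "v \<in> V" for v
    using h[OF that] sub_subset[OF st_subset[OF that]] by (auto simp: P_def l_coset_def)
  have hP: "h v \<in> P v" if "v \<in> V" for v
    using subgroup.one_closed[OF sub_subgroup[OF st_subset[OF that]]] h[OF that]
    by (auto simp: P_def l_coset_def intro!: bexI[of _ \<one>])
  \<comment> \<open>A walk inside the coset uses labels from \<open>st v\<close>, and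
    \<open>a\<close> is not among them.\<close>
  have unsplit: "P v \<subseteq> E \<or> P v \<inter> E = {}" if "E \<in> halfspaces a" "a \<in> V" "v \<in> V" "v \<notin> st a" for E a v
  proof -
    have "a \<notin> st v" using that adj_sym by (auto simp: st_def lk_def)
    then have "h v \<otimes> k \<in> E \<longleftrightarrow> h v \<in> E" if "k \<in> sub (st v)" for k
      using side_right_sub[OF \<open>E \<in> halfspaces a\<close> \<open>a \<in> V\<close> _ st_subset[OF \<open>v \<in> V\<close>] h[OF \<open>v \<in> V\<close>] that] by blast
    then show ?thesis by (auto simp: P_def l_coset_def)
  qed
  define major where "major a E \<longleftrightarrow> E \<in> halfspaces a \<and> (\<forall>v\<in>V. v \<notin> st a \<longrightarrow> P v \<subseteq> E)" for a E
  \<comment> \<open>Cosets of adjacent generators meet, so the side passes along paths in the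
    complement of \<open>st a\<close>.\<close>
  have propagate: "major a E" if E: "E \<in> halfspaces a" "a \<in> V" and v0: "v0 \<in> V - st a" "P v0 \<subseteq> E" for a E v0
  proof -
    have "P v \<subseteq> E" if "v \<in> V - st a" for v
      using conn[OF E(2) v0(1) that]
    proof (induction rule: rtrancl_induct)
      case (step u w)
      then have uw: "u \<in> V" "w \<in> V" "w \<notin> st a" "adj u w" by auto
      have "P u \<inter> P w \<noteq> {}" unfolding P_def using meet uw by blast
      then have "P w \<inter> E \<noteq> {}" using step.IH by blast
      then show ?case using unsplit[OF E uw(2,3)] by blast
    qed (rule v0(2))
    then show ?thesis using E by (auto simp: major_def)
  qed
  have dichotomy: "major a E \<or> major a (carrier G - E)" if E: "E \<in> halfspaces a" "a \<in> V" for a E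
  proof -
    obtain v0 where v0: "v0 \<in> V - st a" using avoid[OF E(2) E(2)] by blast
    then have "P v0 \<subseteq> E \<or> P v0 \<subseteq> carrier G - E" using unsplit[OF E, of v0] PG[of v0] by blast
    then show ?thesis using propagate[OF E v0] propagate[OF halfspaces_compl[OF E(1)] E(2) v0] by blast
  qed
  \<comment> \<open>A vertex outside both stars has its coset in both halfspaces.\<close>
  have intersect: "E \<inter> F \<noteq> {}" if "major a E" "major b F" "a \<in> V" "b \<in> V" for a b E F
  proof -
    obtain v where "v \<in> V" "v \<notin> st a" "v \<notin> st b" using avoid \<open>a \<in> V\<close> \<open>b \<in> V\<close> by blast
    then have "h v \<in> E" "h v \<in> F" using that hP[of v] by (auto simp: major_def)
    then show ?thesis by blast
  qed
  define Bad where "Bad g = {E. \<exists>a\<in>V. major a E \<and> g \<notin> E}" for g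
  have finBad: "finite (Bad g)" if g: "g \<in> carrier G" for g
  proof -
    have "finite {E. major a E \<and> g \<notin> E}" if a: "a \<in> V" for a
    proof -
      obtain v where v: "v \<in> V" "v \<notin> st a" using avoid[OF a a] by blast
      have "{E. major a E \<and> g \<notin> E} \<subseteq> {F \<in> halfspaces a. g \<notin> F \<and> h v \<in> F}"
        using v hP[OF v(1)] by (auto simp: major_def)
      then show ?thesis using finite_separating[OF a g h[OF v(1)]] by (rule finite_subset)
    qed
    moreover have "Bad g = (\<Union>a\<in>V. {E. major a E \<and> g \<notin> E})" by (auto simp: Bad_def)
    ultimately show ?thesis using finite_V by simp
  qed
  obtain g where g: "g \<in> carrier G" and gmin: "\<And>k. k \<in> carrier G \<Longrightarrow> card (Bad g) \<le> card (Bad k)"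
    using ex_has_least_nat[of "\<lambda>k. k \<in> carrier G" \<one> "\<lambda>k. card (Bad k)"] by auto
  have "Bad g = {}"
  proof (rule ccontr)
    assume "Bad g \<noteq> {}"
    \<comment> \<open>A shortest such word leads from \<open>g\<close> into some major halfspace
      missing \<open>g\<close> and enters it only with its last letter.\<close>
    let ?Q = "\<lambda>w. w \<in> words V \<and> (\<exists>E\<in>Bad g. g \<otimes> ev w \<in> E)"
    have "\<exists>w. ?Q w"
    proof -
      obtain E where E: "E \<in> Bad g" using \<open>Bad g \<noteq> {}\<close> by blast
      then obtain a where "E \<in> halfspaces a" "a \<in> V" by (auto simp: Bad_def major_def)
      then obtain s where s: "s \<in> E" "s \<in> carrier G" using halfspaces_ne halfspaces_subset by blast
      then have "word_of (inv g \<otimes> s) \<in> words V" "g \<otimes> ev (word_of (inv g \<otimes> s)) = s"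
        using word_of[of "inv g \<otimes> s"] g by simp_all
      then show ?thesis using E s by metis
    qed
    then obtain w where w: "?Q w" and wmin: "\<And>v. ?Q v \<Longrightarrow> length w \<le> length v"
      using ex_has_least_nat[of ?Q _ length] by blast
    have wV: "w \<in> words V" using w by blast
    obtain E a where E: "E \<in> Bad g" "major a E" "E \<in> halfspaces a" "a \<in> V" "g \<notin> E" "g \<otimes> ev w \<in> E"
      using w by (auto simp: Bad_def major_def)
    have nc: "nocancel w" using w wmin by (intro shortest_nocancel) auto
    have "w \<noteq> []" using E g by auto
    then obtain w1 l2 where w1: "w = w1 @ [l2]" by (metis rev_exhaust)
    have V2: "w1 \<in> words V" "fst l2 \<in> V" using wV w1 by auto
    let ?p1 = "g \<otimes> ev w1"
    have p1: "?p1 \<in> carrier G" "?p1 \<otimes> val l2 \<in> E" using V2 E g w1 by (simp_all add: ev_append m_assoc)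
    have p1E: "?p1 \<notin> E" using wmin[of w1] V2 E(1) w1 by auto
    have l2: "fst l2 = a" "E = far ?p1 l2"
      using cross_far_eq[OF E(3,4) p1(1) V2(2) p1E p1(2)] by simp_all
    show False
    proof (cases w1 rule: rev_cases)
      case Nil
      then have p: "?p1 = g" using g by simp
      let ?k = "g \<otimes> val l2"
      have k: "?k \<in> carrier G" "?k \<in> E" using p p1 V2 g by auto
      \<comment> \<open>The one step into \<open>E\<close> leaves no major halfspace: it could only
        leave the complement of \<open>E\<close>, but major halfspaces intersect.\<close>
      have "Bad ?k \<subseteq> Bad g - {E}"
      proof
        fix F assume "F \<in> Bad ?k"
        then obtain b where F: "b \<in> V" "major b F" "F \<in> halfspaces b" "?k \<notin> F" by (auto simp: Bad_def major_def)
        have "g \<notin> F"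
        proof
          assume gF: "g \<in> F"
          then have c: "cross F g l2" using F by (simp add: cross_def)
          have "F = E \<or> F = carrier G - E" using cross_label(2)[OF F(3,1) g V2(2) c] l2 p by simp
          then have "F = carrier G - E" using F k by blast
          then show False using intersect[OF E(2) F(2) E(4) F(1)] by blast
        qed
        then show "F \<in> Bad g - {E}" using F k by (auto simp: Bad_def)
      qed
      then have "Bad ?k \<subset> Bad g" using E(1) by blast
      then have "card (Bad ?k) < card (Bad g)" by (rule psubset_card_mono[OF finBad[OF g]])
      then show False using gmin[OF k(1)] by simp
    next
      case (snoc w0 l1)
      have V1: "w0 \<in> words V" "fst l1 \<in> V" using V2 snoc by auto
      let ?p0 = "g \<otimes> ev w0"
      have p0: "?p0 \<in> carrier G" and e1: "?p1 = ?p0 \<otimes> val l1" using V1 g snoc by (simp_all add: ev_append m_assoc)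
      have p0E: "?p0 \<notin> E" using wmin[of w0] V1 E(1) w1 snoc by auto
      show False
      proof (cases "adj (fst l1) a")
        case True
        have a1: "a \<notin> {fst l1}" using True adj_irrefl by auto
        \<comment> \<open>Swapping the last two commuting steps would enter \<open>E\<close> one
          step earlier.\<close>
        have "?p0 \<otimes> val l2 \<otimes> val l1 = ?p1 \<otimes> val l2"
          using val_comm[OF V1(2) V2(2)] True l2 V1 V2 p0 e1 by (simp add: m_assoc)
        then have "?p0 \<otimes> val l2 \<in> E"
          using side_right_sub[OF E(3,4) a1, of "?p0 \<otimes> val l2" "val l1"] val_in_sub[of l1 "{fst l1}"]
            p1(2) p0 V1 V2 by simp
        then have "?Q (w0 @ [l2])" using E(1) V1 V2 g by (auto simp: ev_append m_assoc)
        then show False using wmin[of "w0 @ [l2]"] w1 snoc by simp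
      next
        case False
        \<comment> \<open>The halfspace entered at the step before contains \<open>E\<close>. If it
          is major, it is a bad halfspace reached by a shorter word; otherwise its complement is
          major and disjoint from \<open>E\<close>.\<close>
        let ?D = "far ?p0 l1"
        have D: "?D \<in> halfspaces (fst l1)" using far_halfspaces p0 V1 by blast
        have i: "length w0 < length w" "w ! length w0 = l1" "pt g w (length w0) = ?p0"
          using w1 snoc by (simp_all add: nth_append pt_def)
        have gD: "g \<notin> ?D" using separates(1)[OF wV g nc i(1), of 0] i g by simp
        have "g \<otimes> ev w = ?p1 \<otimes> val l2" using w1 V2 g by (simp add: ev_append m_assoc)
        then have p2D: "?p1 \<otimes> val l2 \<in> ?D"
          using separates(2)[OF wV g nc i(1), of "length w"] i by simp
        have p1D: "?p1 \<in> ?D" and p0D: "?p0 \<notin> ?D" using far_props[OF p0 V1(2)] e1 by simp_all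
        have "?D \<subseteq> E \<or> E \<subseteq> ?D"
          using nested[OF D V1(2) E(3,4) False p0 p0D p0E p2D p1(2)] .
        then have ED: "E \<subseteq> ?D" using p1D p1E by blast
        show False
        proof (cases "major (fst l1) ?D")
          case True
          then have "?D \<in> Bad g" using gD V1 by (auto simp: Bad_def)
          then have "?Q w1" using p1D V2 by blast
          then show False using wmin[of w1] w1 by simp
        next
          case False
          then have "major (fst l1) (carrier G - ?D)" using dichotomy[OF D V1(2)] by blast
          then show False using intersect[OF E(2) _ E(4) V1(2)] ED by blast
        qed
      qed
    qed
  qed
  have "g \<in> h v <# sub (st v)" if v: "v \<in> V" for v
  proof -
    interpret sv: subgroup "sub (st v)" G by (rule sub_subgroup[OF st_subset[OF v]])
    have y: "inv g \<otimes> h v \<in> carrier G" using g h v by simp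
    \<comment> \<open>If \<open>g\<close> were outside the coset, the last edge of a shortest way to
      it would enter a halfspace that contains the coset but not \<open>g\<close>; this halfspace
      would be bad.\<close>
    obtain w k where w: "w \<in> words V" "nocancel w" and k: "k \<in> sub (st v)" "inv g \<otimes> h v = ev w \<otimes> k"
      and fin: "\<And>i. final w i \<Longrightarrow> fst (w ! i) \<notin> st v"
      using minimal_coset_word[OF y st_subset[OF v]] by metis
    have kc: "k \<in> carrier G" using k by simp
    have "g \<otimes> ev w = g \<otimes> (ev w \<otimes> k) \<otimes> inv k" using g w kc by (simp add: m_assoc)
    then have gw: "g \<otimes> ev w = h v \<otimes> inv k" unfolding k(2)[symmetric] using g h[OF v] by simp
    then have gwP: "g \<otimes> ev w \<in> P v" using sv.m_inv_closed[OF k(1)] by (auto simp: P_def l_coset_def)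
    show ?thesis
    proof (cases w rule: rev_cases)
      case Nil
      then show ?thesis using gwP g by (simp add: P_def)
    next
      case (snoc w' l)
      let ?i = "length w'" and ?c = "fst l"
      let ?E = "far (pt g w ?i) (w ! ?i)"
      have i: "?i < length w" "w ! ?i = l" using snoc by simp_all
      have c: "?c \<in> V" using w snoc by simp
      have "final w ?i" using snoc by (auto simp: final_def)
      then have "?c \<notin> st v" using fin snoc by force
      then have vc: "v \<notin> st ?c" using adj_sym c v by (auto simp: st_def lk_def)
      have E: "?E \<in> halfspaces ?c" using far_halfspaces[of "pt g w ?i" l] i c g w by simp
      have gE: "g \<notin> ?E" "g \<otimes> ev w \<in> ?E"
        using separates(1)[OF w(1) g w(2) i(1), of 0] separates(2)[OF w(1) g w(2) i(1), of "length w"] g i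
        by simp_all
      then have "P v \<subseteq> ?E" using unsplit[OF E c v vc] gwP by blast
      then have "\<not> major ?c (carrier G - ?E)" using v vc hP[OF v] by (auto simp: major_def)
      then have "major ?c ?E" using dichotomy[OF E c] by blast
      then have "?E \<in> Bad g" using gE c by (auto simp: Bad_def)
      then show ?thesis using \<open>Bad g = {}\<close> by simp
    qed
  qed
  then show ?thesis using that g by blast
qed

text \<open>The numbers \<open>deg b (f (x c))\<close> form the matrix of the map induced on the
  abelianisation.\<close>

lemma deg_hom:
  assumes f: "f \<in> hom G G" and g: "g \<in> carrier G"
  shows "deg b (f g) = (\<Sum>c\<in>V. deg c g * deg b (f (x c)))"
proof -
  interpret f: group_hom G G f by unfold_locales (rule f)
  show ?thesis
    using g
  proof (induction rule: letters_induct)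
    case one
    then show ?case by simp
  next
    case (step h l)
    have "deg b (f (val l)) = (\<Sum>c\<in>V. deg c (val l) * deg b (f (x c)))"
      using step(2) finite_V
      by (auto simp: val_def deg_inv deg_x f.hom_inv if_distrib[of "\<lambda>t. t * _"] if_distrib[of uminus] sum.delta cong: if_cong)
    then show ?case using step by (simp add: deg_mult distrib_right sum.distrib)
  qed
qed

lemma single_letter_power:
  assumes "a \<in> V" "w \<in> words {a}"
  shows "\<exists>m::int. ev w = x a [^] m"
  using assms(2)
proof (induction w)
  case Nil
  show ?case by (rule exI[of _ 0]) simp
next
  case (Cons l w)
  then obtain m :: int where m: "ev w = x a [^] m" by auto
  have "val l = x a [^] (if snd l then 1 else -1 :: int)"
    using Cons.prems assms(1) by (simp add: val_def int_pow_neg)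
  then show ?case using m assms(1) by (metis ev_Cons int_pow_mult x_in)
qed

lemma sum_fun_apply: "(\<Sum>i\<in>A. f i) z = (\<Sum>i\<in>A. f i z)" for f :: "'x \<Rightarrow> 'y \<Rightarrow> 'z::comm_monoid_add"
  by (induction A rule: infinite_finite_induct) simp_all

end

text \<open>The first two conditions rule out transvections, the third one rules out partial conjugations
  that are not inner.\<close>

locale rigid_raag = raag G x V adj
  for G (structure) and x :: "'i \<Rightarrow> 'a" and V and adj +
  assumes regular: "a \<in> V \<Longrightarrow> b \<in> V \<Longrightarrow> card (lk a) = card (lk b)"
    and spread: "a \<in> V \<Longrightarrow> b \<in> V \<Longrightarrow> a \<noteq> b \<Longrightarrow> card (lk a) + 2 \<le> card (lk a \<union> lk b)"
    and star_complement_connected: "a \<in> V \<Longrightarrow> u \<in> V - st a \<Longrightarrow> v \<in> V - st a \<Longrightarrow>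
      (u, v) \<in> {(u, v). u \<in> V - st a \<and> v \<in> V - st a \<and> adj u v}\<^sup>*"
    and stars_avoidable: "a \<in> V \<Longrightarrow> b \<in> V \<Longrightarrow> \<exists>v\<in>V. v \<notin> st a \<and> v \<notin> st b"
begin

lemma finite_lk: "finite (lk a)"
  using finite_subset[OF lk_subset finite_V] .

text \<open>If two labels were skewered, the independent images of the star of \<open>v\<close>
  would lie in the span of the image of \<open>v\<close> with the coordinates in
  \<open>lk a\<close>, and the same for \<open>lk b\<close>; \<open>card_common_span\<close> then
  contradicts \<open>spread\<close>. With a single label the image is conjugate to a power of a
  generator, and the left inverse \<open>f'\<close> forces the exponent to be 1 or -1.\<close>

lemma generator_image:
  assumes f: "f \<in> hom G G" and f': "f' \<in> hom G G" and inv: "\<And>g. g \<in> carrier G \<Longrightarrow> f' (f g) = g"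
    and v: "v \<in> V"
  shows "\<exists>a e h. a \<in> V \<and> h \<in> carrier G \<and> f (x v) = h \<otimes> val (a, e) \<otimes> inv h"
proof -
  define y where "y = f (x v)"
  have fc: "f g \<in> carrier G" if "g \<in> carrier G" for g using f that by (auto simp: hom_def)
  have y: "y \<in> carrier G" using v fc by (simp add: y_def)
  have dual: "(\<Sum>c\<in>V. deg c (f (x u)) * deg d (f' (x c))) = (if u = d then 1 else 0)" if "u \<in> V" for u d
    using deg_hom[OF f' fc[OF x_in[OF that]], of d] inv that by (auto simp: deg_x)
  obtain w h where w: "w \<in> words V" "h \<in> carrier G" "y = h \<otimes> ev w \<otimes> inv h"
    and sk: "\<And>i. i < length w \<Longrightarrow> skewers y (fst (w ! i))"
    using conj_skewers_all_labels[OF y] by metis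
  have same: "a = b" if ab: "a \<in> V" "b \<in> V" "skewers y a" "skewers y b" for a b
  proof (rule ccontr)
    assume ne: "a \<noteq> b"
    \<comment> \<open>\<open>col u\<close> is the image of \<open>x u\<close> in the rational
      abelianisation, and \<open>L d\<close> reads coordinate \<open>d\<close> after applying
      \<open>f'\<close>; these are dual families, whence independence.\<close>
    define col :: "'i \<Rightarrow> 'i \<Rightarrow> rat" where "col u = (\<lambda>c. if c \<in> V then of_int (deg c (f (x u))) else 0)" for u
    define unit :: "'i \<Rightarrow> 'i \<Rightarrow> rat" where "unit c = (\<lambda>d. if d = c then 1 else 0)" for c
    define L :: "'i \<Rightarrow> ('i \<Rightarrow> rat) \<Rightarrow> rat" where "L d g = (\<Sum>c\<in>V. g c * of_int (deg d (f' (x c))))" for d g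
    have Lc: "L d (col u) = of_int (\<Sum>c\<in>V. deg c (f (x u)) * deg d (f' (x c)))" for d u
      by (simp add: L_def col_def)
    then have Ld: "L d (col u) = (if u = d then 1 else 0)" if "u \<in> V" for u d
      unfolding Lc dual[OF that] by simp
    have U: "st v \<subseteq> V" using st_subset[OF v] .
    have "fv.independent (col ` st v)" "inj_on col (st v)"
      by (rule dual_independent[where L = L]; use U Ld in \<open>auto simp: L_def distrib_right sum.distrib sum_distrib_left algebra_simps\<close>)+
    note colI = this
    have unitI: "fv.independent (unit ` A)" "inj_on unit A" for A
      by (rule dual_independent[where L = "\<lambda>c g. g c"]; auto simp: unit_def)+
    have cst: "card (st v) = Suc (card (lk v))" using finite_lk adj_irrefl by (simp add: st_def lk_def)
    have fst_v: "finite (st v)" using finite_lk by (simp add: st_def)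
    have span: "col u \<in> fv.span (insert (col v) (unit ` lk c))"
      if c: "c \<in> V" "skewers y c" and u: "u \<in> st v" for c u
    proof (cases "u = v")
      case True
      then show ?thesis by (simp add: fv.span_base)
    next
      case False
      then have uv: "u \<in> V" "adj v u" using u by (auto simp: st_def lk_def)
      have "y \<otimes> f (x u) = f (x u) \<otimes> y"
        unfolding y_def using x_comm[OF v uv] hom_mult[OF f] v uv by (metis x_in)
      then obtain p q :: int where pq: "q \<noteq> 0"
        "\<And>b. b \<in> V \<Longrightarrow> \<not> adj c b \<Longrightarrow> p * deg b y + q * deg b (f (x u)) = 0"
        using commuting_skewer[OF c(1) y c(2) fc[OF x_in[OF uv(1)]]] by metis
      \<comment> \<open>With this multiple of \<open>col v\<close> removed, \<open>col u\<close> is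
        supported on \<open>lk c\<close>.\<close>
      define r :: rat where "r = - of_int p / of_int q"
      define t where "t = (\<lambda>d. col u d - r * col v d)"
      have t0: "t d = 0" if "d \<notin> lk c" for d
      proof (cases "d \<in> V")
        case True
        then have "p * deg d y + q * deg d (f (x u)) = 0" using pq(2) that by (simp add: lk_def)
        then have "of_int p * of_int (deg d y) + of_int q * (of_int (deg d (f (x u))) :: rat) = 0"
          by (metis of_int_0 of_int_add of_int_mult)
        then show ?thesis using True pq(1) by (simp add: t_def col_def r_def y_def field_simps)
      qed (simp add: t_def col_def)
      have "t = (\<Sum>d\<in>lk c. (\<lambda>i. t d * unit d i))"
        using t0 finite_lk[of c] by (auto simp: fun_eq_iff sum_fun_apply unit_def if_distrib[of "\<lambda>z. _ * z"] sum.delta' cong: if_cong)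
      also have "\<dots> \<in> fv.span (insert (col v) (unit ` lk c))"
        by (intro fv.span_sum fv.span_scale fv.span_base) auto
      finally have "t \<in> fv.span (insert (col v) (unit ` lk c))" .
      moreover have "(\<lambda>d. r * col v d) \<in> fv.span (insert (col v) (unit ` lk c))"
        by (intro fv.span_scale fv.span_base) simp
      ultimately have "(\<lambda>d. r * col v d) + t \<in> fv.span (insert (col v) (unit ` lk c))"
        by (rule fv.span_add[rotated])
      moreover have "(\<lambda>d. r * col v d) + t = col u" by (simp add: t_def fun_eq_iff)
      ultimately show ?thesis by simp
    qed
    have "card (unit ` lk a \<union> unit ` lk b) \<le> card (col ` st v)"
    proof (rule fv.card_common_span)
      show "fv.independent (unit ` lk a \<union> unit ` lk b)" using unitI(1)[of "lk a \<union> lk b"] by (simp add: image_Un)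
      have "card (unit ` lk c) < card (col ` st v)" if "c \<in> V" for c
        using card_image[OF colI(2)] card_image[OF unitI(2), of "lk c"] cst regular[OF that v] by simp
      then show "card (unit ` lk a) < card (col ` st v)" "card (unit ` lk b) < card (col ` st v)" using ab by blast+
      show "col ` st v \<subseteq> fv.span (insert (col v) (unit ` lk a))"
        "col ` st v \<subseteq> fv.span (insert (col v) (unit ` lk b))" using span ab by auto
    qed (use colI fst_v finite_lk in auto)
    then have "card (lk a \<union> lk b) \<le> Suc (card (lk v))"
      using card_image[OF colI(2)] card_image[OF unitI(2), of "lk a \<union> lk b"] cst by (simp add: image_Un)
    then show False using spread[OF ab(1,2) ne] regular[OF ab(1) v] by simp
  qed
  have wne: "w \<noteq> []"
  proof
    assume "w = []"
    then have "y = \<one>" using w by simp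
    then show False using dual[OF v, of v] by (simp add: y_def)
  qed
  define a where "a = fst (w ! 0)"
  have aV: "a \<in> V" using words_nth[OF w(1), of 0] wne by (simp add: a_def)
  have "fst (w ! i) = a" if "i < length w" for i
    using same[of "fst (w ! i)" a] sk[OF that] sk[of 0] words_nth[OF w(1) that] aV wne by (simp add: a_def)
  then have "w \<in> words {a}" by (metis in_set_conv_nth singletonI words_iff)
  then obtain m :: int where m: "ev w = x a [^] m" using single_letter_power[OF aV] by blast
  have "deg c y = m * (if c = a then 1 else 0)" for c
    using w m aV by (simp add: deg_conj deg_pow deg_x)
  \<comment> \<open>Only the label \<open>a\<close> contributes to the sum, so \<open>m\<close>
    divides 1.\<close>
  then have "(\<Sum>c\<in>V. m * (if c = a then 1 else 0) * deg v (f' (x c))) = 1"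
    using dual[OF v, of v] by (simp add: y_def)
  then have "m * deg v (f' (x a)) = 1"
    using aV finite_V by (simp add: if_distrib[of "\<lambda>z. z * _"] if_distrib[of "\<lambda>z. _ * z"] sum.delta' cong: if_cong)
  then have "m = 1 \<or> m = -1" using zmult_eq_1_iff by blast
  then have "ev w = val (a, m = 1)" using m aV by (auto simp: val_def int_pow_neg)
  with w have "f (x v) = h \<otimes> val (a, m = 1) \<otimes> inv h" by (simp add: y_def)
  then show ?thesis using aV w(2) by metis
qed

lemma val_conj_comm:
  assumes "fst l \<in> V" "g \<in> carrier G" "val l \<otimes> g = g \<otimes> val l"
  shows "x (fst l) \<otimes> g = g \<otimes> x (fst l)"
  using comm_inv_left[OF _ assms(2,3)] assms by (auto simp: val_def split: if_splits)

theorem automorphism_form: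
  assumes f: "f \<in> hom G G" and f': "f' \<in> hom G G"
    and inv: "\<And>g. g \<in> carrier G \<Longrightarrow> f' (f g) = g"
  obtains \<sigma> e g where "g \<in> carrier G" "bij_betw \<sigma> V V"
    "\<And>u v. u \<in> V \<Longrightarrow> v \<in> V \<Longrightarrow> adj (\<sigma> u) (\<sigma> v) \<longleftrightarrow> adj u v"
    "\<And>v. v \<in> V \<Longrightarrow> f (x v) = g \<otimes> val (\<sigma> v, e v) \<otimes> inv g"
proof -
  obtain \<sigma> e h where s: "\<And>v. v \<in> V \<Longrightarrow> \<sigma> v \<in> V" and h: "\<And>v. v \<in> V \<Longrightarrow> h v \<in> carrier G"
    and fx: "\<And>v. v \<in> V \<Longrightarrow> f (x v) = h v \<otimes> val (\<sigma> v, e v) \<otimes> inv (h v)"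
    using generator_image[OF f f' inv] by metis
  have fc: "f g \<in> carrier G" if "g \<in> carrier G" for g using f that by (auto simp: hom_def)
  define D where "D d a = deg d (f' (x a))" for d a
  have dual: "(if e u then 1 else -1) * D d (\<sigma> u) = (if u = d then 1 else 0)" if u: "u \<in> V" for u d
  proof -
    have dc: "deg c (f (x u)) = (if e u then 1 else -1) * (if c = \<sigma> u then 1 else 0)" for c
      using fx[OF u] h[OF u] s[OF u] by (simp add: deg_conj val_def deg_inv deg_x)
    have "(\<Sum>c\<in>V. deg c (f (x u)) * deg d (f' (x c))) = (if u = d then 1 else 0)"
      using deg_hom[OF f' fc[OF x_in[OF u]], of d] inv u by (auto simp: deg_x)
    then show ?thesis
      unfolding dc using s[OF u] finite_V
      by (simp add: D_def if_distrib[of "\<lambda>z. z * _"] if_distrib[of "\<lambda>z. _ * z"] sum.delta' cong: if_cong)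
  qed
  have inj: "inj_on \<sigma> V"
  proof (rule inj_onI)
    fix u v assume uv: "u \<in> V" "v \<in> V" "\<sigma> u = \<sigma> v"
    then have "D v (\<sigma> v) \<noteq> 0" using dual[OF uv(2), of v] by auto
    then show "u = v" using dual[OF uv(1), of v] uv(3) by (auto split: if_splits)
  qed
  have bij: "bij_betw \<sigma> V V"
    using endo_inj_surj[OF finite_V _ inj] s inj by (auto simp: bij_betw_def)
  \<comment> \<open>Conjugating by \<open>inv (h u)\<close> and discarding the signs brings the
    commuting images into the form required by \<open>commuting_conjugates\<close>.\<close>
  have comm: "x (\<sigma> u) \<otimes> (k \<otimes> x (\<sigma> v) \<otimes> inv k) = (k \<otimes> x (\<sigma> v) \<otimes> inv k) \<otimes> x (\<sigma> u)"
    if uv: "u \<in> V" "v \<in> V" "adj u v" and k: "k = inv (h u) \<otimes> h v" for u v k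
  proof -
    let ?a = "val (\<sigma> u, e u)" and ?b = "val (\<sigma> v, e v)"
    note hu = h[OF uv(1)] and hv = h[OF uv(2)]
    have c: "?a \<in> carrier G" "?b \<in> carrier G" "k \<in> carrier G" "x (\<sigma> v) \<in> carrier G"
      using s uv hu hv by (simp_all add: k)
    have "f (x u) \<otimes> f (x v) = f (x v) \<otimes> f (x u)"
      using x_comm[OF uv] hom_mult[OF f] uv by (metis x_in)
    then have "(h u \<otimes> ?a \<otimes> inv (h u)) \<otimes> (h v \<otimes> ?b \<otimes> inv (h v))
        = (h v \<otimes> ?b \<otimes> inv (h v)) \<otimes> (h u \<otimes> ?a \<otimes> inv (h u))"
      using fx uv by simp
    then have "inv (h u) \<otimes> ((h u \<otimes> ?a \<otimes> inv (h u)) \<otimes> (h v \<otimes> ?b \<otimes> inv (h v))) \<otimes> h u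
        = inv (h u) \<otimes> ((h v \<otimes> ?b \<otimes> inv (h v)) \<otimes> (h u \<otimes> ?a \<otimes> inv (h u))) \<otimes> h u" by simp
    then have ab: "?a \<otimes> (k \<otimes> ?b \<otimes> inv k) = (k \<otimes> ?b \<otimes> inv k) \<otimes> ?a"
      using c hu hv by (simp add: k m_assoc inv_mult_group)
    then have "x (\<sigma> u) \<otimes> (k \<otimes> ?b \<otimes> inv k) = (k \<otimes> ?b \<otimes> inv k) \<otimes> x (\<sigma> u)"
      using val_conj_comm[of "(\<sigma> u, e u)"] s[OF uv(1)] c by simp
    moreover have "inv (k \<otimes> x (\<sigma> v) \<otimes> inv k) = k \<otimes> inv (x (\<sigma> v)) \<otimes> inv k"
      using c by (simp add: inv_mult_group m_assoc)
    ultimately show ?thesis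
      using comm_inv_left[of "k \<otimes> inv (x (\<sigma> v)) \<otimes> inv k" "x (\<sigma> u)"] c s[OF uv(1)]
      by (cases "e v") (auto simp: val_def inv_mult_group m_assoc)
  qed
  have fwd: "adj (\<sigma> u) (\<sigma> v)" if uv: "u \<in> V" "v \<in> V" "adj u v" for u v
  proof -
    define k where "k = inv (h u) \<otimes> h v"
    have k: "k \<in> carrier G" using h uv by (simp add: k_def)
    let ?y = "k \<otimes> x (\<sigma> v) \<otimes> inv k"
    have "?y \<in> sub (st (\<sigma> u))"
      using comm[OF uv k_def] k s uv by (intro centralizer) simp_all
    \<comment> \<open>A nonzero exponent sum forces \<open>\<sigma> v\<close> to be one of the
      labels of \<open>sub (st (\<sigma> u))\<close>.\<close>
    moreover have "deg (\<sigma> v) ?y = 1" using k s[OF uv(2)] by (simp add: deg_conj deg_x)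
    ultimately have "\<sigma> v \<in> st (\<sigma> u)" using deg_sub[OF _ st_subset[OF s[OF uv(1)]]] by fastforce
    moreover have "\<sigma> v \<noteq> \<sigma> u" using inj uv adj_irrefl by (metis inj_onD)
    ultimately show ?thesis by (simp add: st_def lk_def)
  qed
  have adj: "adj (\<sigma> u) (\<sigma> v) \<longleftrightarrow> adj u v" if uv: "u \<in> V" "v \<in> V" for u v
  proof
    assume a: "adj (\<sigma> u) (\<sigma> v)"
    \<comment> \<open>An injection of the finite set of edges into itself is onto, so adjacency is
      also reflected.\<close>
    let ?E = "{(u, v). u \<in> V \<and> v \<in> V \<and> adj u v}"
    have "finite ?E" by (rule finite_subset[of _ "V \<times> V"]) (use finite_V in auto)
    moreover have "map_prod \<sigma> \<sigma> ` ?E \<subseteq> ?E" using fwd s by auto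
    moreover have "inj_on (map_prod \<sigma> \<sigma>) ?E" using inj by (auto simp: inj_on_def)
    ultimately have "map_prod \<sigma> \<sigma> ` ?E = ?E" by (rule endo_inj_surj)
    moreover have "(\<sigma> u, \<sigma> v) \<in> ?E" using a s uv by simp
    ultimately have "(\<sigma> u, \<sigma> v) \<in> map_prod \<sigma> \<sigma> ` ?E" by simp
    then obtain u' v' where "u' \<in> V" "v' \<in> V" "adj u' v'" "\<sigma> u = \<sigma> u'" "\<sigma> v = \<sigma> v'" by auto
    then show "adj u v" using inj uv by (metis inj_onD)
  qed (use fwd uv in blast)
  \<comment> \<open>The cosets in \<open>common_point\<close> are indexed by the label of the image,
    so \<open>h\<close> has to be read through the inverse of \<sigma>.\<close>
  define \<tau> where "\<tau> = inv_into V \<sigma>"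
  have t: "\<tau> a \<in> V" "\<sigma> (\<tau> a) = a" if "a \<in> V" for a
    using bij that unfolding \<tau>_def bij_betw_def by (auto intro: inv_into_into f_inv_into_f)
  have ts: "\<tau> (\<sigma> v) = v" if "v \<in> V" for v using inj that by (simp add: \<tau>_def)
  obtain g where g: "g \<in> carrier G" "\<And>a. a \<in> V \<Longrightarrow> g \<in> h (\<tau> a) <# sub (st a)"
  proof (rule common_point[of "\<lambda>a. h (\<tau> a)"])
    fix a b assume ab: "a \<in> V" "b \<in> V" "adj a b"
    then have uv: "adj (\<tau> a) (\<tau> b)" using adj[of "\<tau> a" "\<tau> b"] t by simp
    let ?k = "inv (h (\<tau> a)) \<otimes> h (\<tau> b)"
    note ha = h[OF t(1)[OF ab(1)]] and hb = h[OF t(1)[OF ab(2)]]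
    obtain p q where p: "p \<in> sub (st a)" and q: "q \<in> sub (st b)" and pq: "?k = p \<otimes> q"
      using commuting_conjugates[OF ab(1,2), of ?k] comm[OF t(1)[OF ab(1)] t(1)[OF ab(2)] uv] t ab ha hb
      by auto
    interpret sb: subgroup "sub (st b)" G by (rule sub_subgroup[OF st_subset[OF ab(2)]])
    have pc: "p \<in> carrier G" and qc: "q \<in> carrier G" using p q sub_subset[OF st_subset] ab by blast+
    have "h (\<tau> b) = h (\<tau> a) \<otimes> ?k" using ha hb by simp
    then have "h (\<tau> a) \<otimes> p = h (\<tau> b) \<otimes> inv q" using pc qc ha by (simp add: pq m_assoc)
    then show "(h (\<tau> a) <# sub (st a)) \<inter> (h (\<tau> b) <# sub (st b)) \<noteq> {}"
      using p sb.m_inv_closed[OF q] by (auto simp: l_coset_def)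
  qed (use h t star_complement_connected stars_avoidable in auto)
  \<comment> \<open>\<open>g\<close> and \<open>h v\<close> differ by an element commuting with
    \<open>x (\<sigma> v)\<close>, hence conjugate it in the same way.\<close>
  have "f (x v) = g \<otimes> val (\<sigma> v, e v) \<otimes> inv g" if v: "v \<in> V" for v
  proof -
    let ?a = "\<sigma> v"
    have a: "?a \<in> V" using s v by blast
    obtain k where k: "k \<in> sub (st ?a)" "g = h v \<otimes> k" using g(2)[OF a] ts[OF v] by (auto simp: l_coset_def)
    have kc: "k \<in> carrier G" using k sub_subset[OF st_subset[OF a]] by blast
    have "x ?a \<otimes> k = k \<otimes> x ?a" using st_comm[OF a k(1)] .
    then have c: "k \<otimes> val (?a, e v) = val (?a, e v) \<otimes> k"
      using comm_inv_left[of "x ?a" k] a kc by (auto simp: val_def)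
    have "g \<otimes> val (?a, e v) \<otimes> inv g = h v \<otimes> (k \<otimes> val (?a, e v)) \<otimes> inv k \<otimes> inv (h v)"
      using k kc h[OF v] a by (simp add: inv_mult_group m_assoc)
    also have "\<dots> = f (x v)" unfolding c fx[OF v] using kc h[OF v] a by (simp add: m_assoc)
    finally show ?thesis ..
  qed
  then show ?thesis using that[OF g(1) bij adj] by blast
qed

end

section \<open>Generators of the pure virtual twin group\<close>

definition pairs :: "nat \<Rightarrow> (nat \<times> nat) set"
  where "pairs n = {(i, j). 1 \<le> i \<and> i < j \<and> j \<le> n}"

lemma pairs_iff: "(i, j) \<in> pairs n \<longleftrightarrow> 1 \<le> i \<and> i < j \<and> j \<le> n"
  by (simp add: pairs_def)

definition disjoint_pairs :: "nat \<times> nat \<Rightarrow> nat \<times> nat \<Rightarrow> bool"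
  where "disjoint_pairs p q \<longleftrightarrow> {fst p, snd p} \<inter> {fst q, snd q} = {}"

definition lamp :: "nat \<Rightarrow> nat \<times> nat \<Rightarrow> vt_gen gword set"
  where "lamp n p = lam n (fst p) (snd p)"

lemma lamp_pair [simp]: "lamp n (i, j) = lam n i j"
  by (simp add: lamp_def)

locale virtual_twin = group G for n :: nat and G :: "vt_gen gword set monoid" (structure) +
  assumes G_eq: "G = VT n"
begin

definition cl :: "vt_gen list \<Rightarrow> vt_gen gword set"
  where "cl xs = word_class (vt_gens n) (vt_rels n) (pos_word xs)"

abbreviation \<rho> :: "nat \<Rightarrow> vt_gen gword set"
  where "\<rho> i \<equiv> cl [Rho i]"

abbreviation \<s> :: "nat \<Rightarrow> vt_gen gword set"
  where "\<s> i \<equiv> cl [S i]"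

abbreviation rw :: "nat list \<Rightarrow> vt_gen gword set"
  where "rw ks \<equiv> cl (map Rho ks)"

abbreviation P :: "vt_gen gword set \<Rightarrow> nat \<Rightarrow> nat"
  where "P \<equiv> vt_perm n"

lemma gens_iff [simp]: "S i \<in> vt_gens n \<longleftrightarrow> i \<in> {1..<n}" "Rho i \<in> vt_gens n \<longleftrightarrow> i \<in> {1..<n}"
  by (auto simp: vt_gens_def)

lemma pos_words [simp]: "pos_word xs \<in> words (vt_gens n) \<longleftrightarrow> set xs \<subseteq> vt_gens n"
  by (induction xs) auto

lemma rho_set [simp]: "Rho ` K \<subseteq> vt_gens n \<longleftrightarrow> K \<subseteq> {1..<n}"
  by (auto simp: vt_gens_def)

lemma cl_in [simp]: "set xs \<subseteq> vt_gens n \<Longrightarrow> cl xs \<in> carrier G"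
  by (simp add: cl_def G_eq VT_def presented_group_carrier)

lemma cl_Nil: "cl [] = \<one>"
  by (simp add: cl_def G_eq VT_def presented_group_one)

lemma cl_append: "set xs \<subseteq> vt_gens n \<Longrightarrow> set ys \<subseteq> vt_gens n \<Longrightarrow> cl (xs @ ys) = cl xs \<otimes> cl ys"
  unfolding cl_def G_eq VT_def map_append by (rule presented_group_mult[symmetric]) simp_all

lemma cl_Cons: "y \<in> vt_gens n \<Longrightarrow> set ys \<subseteq> vt_gens n \<Longrightarrow> cl (y # ys) = cl [y] \<otimes> cl ys"
  using cl_append[of "[y]" ys] by simp

lemma cl_rel:
  assumes "(pos_word xs, pos_word ys) \<in> vt_rels n"
  shows "cl xs = cl ys"
proof -
  have "pos_word xs \<in> words (vt_gens n)" "pos_word ys \<in> words (vt_gens n)"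
    using assms vt_rels_words by blast+
  then show ?thesis
    using word_eq.rel[of "[]" "vt_gens n" "[]", OF _ _ _ _ assms] by (simp add: cl_def word_class_eq_iff)
qed

lemma rho_sq: "i \<in> {1..<n} \<Longrightarrow> \<rho> i \<otimes> \<rho> i = \<one>"
  using cl_rel[of "[Rho i, Rho i]" "[]"] cl_Cons[of "Rho i" "[Rho i]"] cl_Nil by (fastforce simp: vt_rels_def)

lemma s_sq: "i \<in> {1..<n} \<Longrightarrow> \<s> i \<otimes> \<s> i = \<one>"
  using cl_rel[of "[S i, S i]" "[]"] cl_Cons[of "S i" "[S i]"] cl_Nil by (fastforce simp: vt_rels_def)

lemma rho_inv: "i \<in> {1..<n} \<Longrightarrow> inv (\<rho> i) = \<rho> i"
  using rho_sq inv_equality[of "\<rho> i" "\<rho> i"] by simp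

lemma s_inv: "i \<in> {1..<n} \<Longrightarrow> inv (\<s> i) = \<s> i"
  using s_sq inv_equality[of "\<s> i" "\<s> i"] by simp

lemma far_comm:
  assumes "i \<in> {1..<n}" "j \<in> {1..<n}" "i + 2 \<le> j"
  shows "\<rho> i \<otimes> \<rho> j = \<rho> j \<otimes> \<rho> i" "\<s> i \<otimes> \<s> j = \<s> j \<otimes> \<s> i"
    "\<rho> i \<otimes> \<s> j = \<s> j \<otimes> \<rho> i" "\<s> i \<otimes> \<rho> j = \<rho> j \<otimes> \<s> i"
proof -
  have "\<bar>int i - int j\<bar> \<ge> 2" "\<bar>int j - int i\<bar> \<ge> 2" using assms by linarith+
  then have "cl [Rho i, Rho j] = cl [Rho j, Rho i]" "cl [S i, S j] = cl [S j, S i]"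
    "cl [Rho i, S j] = cl [S j, Rho i]" "cl [Rho j, S i] = cl [S i, Rho j]"
    using assms(1,2) by (intro cl_rel; fastforce simp: vt_rels_def)+
  then show "\<rho> i \<otimes> \<rho> j = \<rho> j \<otimes> \<rho> i" "\<s> i \<otimes> \<s> j = \<s> j \<otimes> \<s> i"
    "\<rho> i \<otimes> \<s> j = \<s> j \<otimes> \<rho> i" "\<s> i \<otimes> \<rho> j = \<rho> j \<otimes> \<s> i"
    using assms cl_Cons[of "Rho i" "[Rho j]"] cl_Cons[of "Rho j" "[Rho i]"] cl_Cons[of "S i" "[S j]"]
      cl_Cons[of "S j" "[S i]"] cl_Cons[of "Rho i" "[S j]"] cl_Cons[of "S j" "[Rho i]"]
      cl_Cons[of "Rho j" "[S i]"] cl_Cons[of "S i" "[Rho j]"] by simp_all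
qed

lemma braid:
  assumes "1 \<le> i" "Suc i < n"
  shows "\<rho> i \<otimes> (\<rho> (Suc i) \<otimes> \<rho> i) = \<rho> (Suc i) \<otimes> (\<rho> i \<otimes> \<rho> (Suc i))"
    and "\<rho> i \<otimes> (\<rho> (Suc i) \<otimes> \<s> i) = \<s> (Suc i) \<otimes> (\<rho> i \<otimes> \<rho> (Suc i))"
proof -
  have "cl [Rho i, Rho (i + 1), Rho i] = cl [Rho (i + 1), Rho i, Rho (i + 1)]"
    "cl [Rho i, Rho (i + 1), S i] = cl [S (i + 1), Rho i, Rho (i + 1)]"
    by (rule cl_rel; use assms in \<open>auto simp: vt_rels_def\<close>)+
  then show "\<rho> i \<otimes> (\<rho> (Suc i) \<otimes> \<rho> i) = \<rho> (Suc i) \<otimes> (\<rho> i \<otimes> \<rho> (Suc i))"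
    "\<rho> i \<otimes> (\<rho> (Suc i) \<otimes> \<s> i) = \<s> (Suc i) \<otimes> (\<rho> i \<otimes> \<rho> (Suc i))"
    using assms by (simp_all add: cl_Cons[of _ "[_]"] cl_Cons[of _ "[_, _]"])
qed

lemma P_hom: "group_hom G (sym_group n) P"
  using group_hom_vt_perm G_eq by simp

lemma P_mult: "g \<in> carrier G \<Longrightarrow> h \<in> carrier G \<Longrightarrow> P (g \<otimes> h) = P g \<circ> P h"
  using group_hom.hom_mult[OF P_hom] by (simp add: sym_group_mult)

lemma P_one: "P \<one> = id"
  using group_hom.hom_one[OF P_hom] by (simp add: sym_group_one)

lemma P_permutes: "g \<in> carrier G \<Longrightarrow> P g permutes {1..n}"
  using group_hom.hom_closed[OF P_hom] by (simp add: sym_group_carrier)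

lemma P_rho: "i \<in> {1..<n} \<Longrightarrow> P (\<rho> i) = transpose i (Suc i)"
  using vt_perm_class[of "pos_word [Rho i]" n] by (simp add: cl_def word_eval_def sym_group_mult sym_group_one)

section \<open>Words in the \<rho>-generators: completeness of the Coxeter relations\<close>

lemma rw_append: "set xs \<subseteq> {1..<n} \<Longrightarrow> set ys \<subseteq> {1..<n} \<Longrightarrow> rw (xs @ ys) = rw xs \<otimes> rw ys"
  using cl_append[of "map Rho xs" "map Rho ys"] by simp

lemma rw_Cons: "y \<in> {1..<n} \<Longrightarrow> set ys \<subseteq> {1..<n} \<Longrightarrow> rw (y # ys) = \<rho> y \<otimes> rw ys"
  using cl_Cons[of "Rho y" "map Rho ys"] by simp

lemma rw_in [simp]: "set ks \<subseteq> {1..<n} \<Longrightarrow> rw ks \<in> carrier G"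
  by simp

lemma rw_rev: "set ks \<subseteq> {1..<n} \<Longrightarrow> rw (rev ks) = inv (rw ks)"
proof (induction ks)
  case (Cons k ks)
  then have "rw (rev (k # ks)) = rw (rev ks) \<otimes> \<rho> k" using rw_append[of "rev ks" "[k]"] by simp
  then show ?case using Cons rw_Cons[of k ks] by (simp add: inv_mult_group rho_inv)
qed (simp add: cl_Nil)

lemma P_rw_Cons: "y \<in> {1..<n} \<Longrightarrow> set ys \<subseteq> {1..<n} \<Longrightarrow> P (rw (y # ys)) = transpose y (Suc y) \<circ> P (rw ys)"
  using rw_Cons P_mult P_rho by simp

lemma P_fix: "set ks \<subseteq> {1..<n} \<Longrightarrow> (\<And>k. k \<in> set ks \<Longrightarrow> i < k) \<Longrightarrow> P (rw ks) i = i"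
proof (induction ks)
  case (Cons k ks)
  then have "P (rw (k # ks)) i = transpose k (Suc k) i" using P_rw_Cons[of k ks] by simp
  then show ?case using Cons.prems(2)[of k] by (simp add: transpose_def)
qed (simp add: cl_Nil P_one)

text \<open>The descending product from index \<open>k - 1\<close> to \<open>p\<close>; as a
  permutation it moves \<open>p\<close> to \<open>k\<close>, so these products represent the cosets
  of the stabiliser of \<open>p\<close>.\<close>

abbreviation cw :: "nat \<Rightarrow> nat \<Rightarrow> vt_gen gword set"
  where "cw p k \<equiv> rw (rev [p..<k])"

lemma cw_Suc: "1 \<le> p \<Longrightarrow> p \<le> k \<Longrightarrow> k < n \<Longrightarrow> cw p (Suc k) = \<rho> k \<otimes> cw p k"
  using rw_Cons[of k "rev [p..<k]"] by force

lemma cw_in: "1 \<le> p \<Longrightarrow> k \<le> n \<Longrightarrow> cw p k \<in> carrier G"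
  by (intro rw_in) auto

lemma P_cw:
  assumes "1 \<le> p" "p \<le> k" "k \<le> n"
  shows "P (cw p k) p = k"
  using assms(2,3)
proof (induction k rule: dec_induct)
  case (step k)
  then show ?case using assms(1) cw_Suc[of p k] P_mult[of "\<rho> k" "cw p k"] cw_in[of p k] P_rho[of k] by simp
qed (simp add: cl_Nil P_one)

lemma rho_cw_above:
  assumes "1 \<le> p" "p \<le> k" "k < j" "j < n"
  shows "\<rho> j \<otimes> cw p k = cw p k \<otimes> \<rho> j"
  using assms(2,3)
proof (induction k rule: dec_induct)
  case base
  then show ?case using assms by (simp add: cl_Nil)
next
  case (step k)
  have c: "cw p k \<in> carrier G" "\<rho> j \<in> carrier G" "\<rho> k \<in> carrier G"
    using assms step cw_in[of p k] by auto
  have e: "\<rho> j \<otimes> \<rho> k = \<rho> k \<otimes> \<rho> j" using far_comm(1)[of k j] assms step by simp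
  have "\<rho> j \<otimes> (\<rho> k \<otimes> cw p k) = \<rho> k \<otimes> (\<rho> j \<otimes> cw p k)" using c e by (simp flip: m_assoc)
  then show ?case using step assms c cw_Suc[of p k] by (simp add: m_assoc)
qed

lemma rho_cw_below:
  assumes "1 \<le> p" "p \<le> j" "j + 2 \<le> k" "k \<le> n"
  shows "\<rho> j \<otimes> cw p k = cw p k \<otimes> \<rho> (Suc j)"
  using assms(3,4)
proof (induction k rule: dec_induct)
  case base
  have c: "cw p j \<in> carrier G" "\<rho> j \<in> carrier G" "\<rho> (Suc j) \<in> carrier G"
    using assms cw_in[of p j] by auto
  have e: "cw p (j + 2) = \<rho> (Suc j) \<otimes> (\<rho> j \<otimes> cw p j)"
    using cw_Suc[of p "Suc j"] cw_Suc[of p j] assms by simp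
  have "\<rho> j \<otimes> (\<rho> (Suc j) \<otimes> (\<rho> j \<otimes> cw p j)) = (\<rho> j \<otimes> (\<rho> (Suc j) \<otimes> \<rho> j)) \<otimes> cw p j"
    using c by (simp add: m_assoc)
  also have "\<dots> = \<rho> (Suc j) \<otimes> (\<rho> j \<otimes> (\<rho> (Suc j) \<otimes> cw p j))"
    using c braid(1)[of j] assms by (simp add: m_assoc)
  also have "\<rho> (Suc j) \<otimes> cw p j = cw p j \<otimes> \<rho> (Suc j)"
    using rho_cw_above[of p j "Suc j"] assms by simp
  finally show ?case unfolding e using c by (simp add: m_assoc)
next
  case (step k)
  have c: "cw p k \<in> carrier G" "\<rho> j \<in> carrier G" "\<rho> k \<in> carrier G" "\<rho> (Suc j) \<in> carrier G"
    using assms step cw_in[of p k] by auto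
  have e: "\<rho> j \<otimes> \<rho> k = \<rho> k \<otimes> \<rho> j" using far_comm(1)[of j k] assms step by simp
  have "\<rho> j \<otimes> (\<rho> k \<otimes> cw p k) = \<rho> k \<otimes> (\<rho> j \<otimes> cw p k)" using c e by (simp flip: m_assoc)
  then show ?case using step assms c cw_Suc[of p k] by (simp add: m_assoc)
qed

text \<open>A further letter \<open>j\<close> on the left of \<open>cw p k\<close> commutes past it
  if \<open>j > k\<close>, lengthens it if \<open>j = k\<close>, shortens it if
  \<open>k = j + 1\<close>, and otherwise passes through with its index raised by one, by the braid
  relation.\<close>

lemma coset_form:
  assumes "1 \<le> p" "p \<le> n" "set ks \<subseteq> {p..<n}"
  shows "\<exists>k ls. p \<le> k \<and> k \<le> n \<and> set ls \<subseteq> {Suc p..<n} \<and> rw ks = cw p k \<otimes> rw ls"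
  using assms(3)
proof (induction ks)
  case Nil
  have "rw [] = cw p p \<otimes> rw []" by (simp add: cl_Nil)
  then show ?case using assms by (intro exI[of _ p] exI[of _ "[]"]) simp
next
  case (Cons j ks)
  then obtain k ls where k: "p \<le> k" "k \<le> n" and ls: "set ls \<subseteq> {Suc p..<n}" and e: "rw ks = cw p k \<otimes> rw ls"
    by auto
  have j: "p \<le> j" "j < n" using Cons.prems by auto
  have ls1: "set ls \<subseteq> {1..<n}" and ks1: "set ks \<subseteq> {1..<n}" using ls Cons.prems assms by auto
  have c: "cw p k \<in> carrier G" "\<rho> j \<in> carrier G" "rw ls \<in> carrier G"
    using assms k j ls1 cw_in[of p k] by auto
  have e': "rw (j # ks) = \<rho> j \<otimes> cw p k \<otimes> rw ls"
    using rw_Cons[of j ks] ks1 j assms c by (simp add: e m_assoc)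
  consider "k < j" | "j = k" | "k = Suc j" | "j + 2 \<le> k" by linarith
  then show ?case
  proof cases
    case 1
    then have "rw (j # ks) = cw p k \<otimes> (\<rho> j \<otimes> rw ls)"
      using e' rho_cw_above[of p k j] assms k j c by (simp add: m_assoc)
    also have "\<rho> j \<otimes> rw ls = rw (j # ls)" using rw_Cons[of j ls] ls1 j assms by simp
    finally show ?thesis using k ls 1 j by (intro exI[of _ k] exI[of _ "j # ls"]) auto
  next
    case 2
    then have "rw (j # ks) = cw p (Suc k) \<otimes> rw ls" using e' cw_Suc[of p k] assms k j by simp
    then show ?thesis using k ls 2 j by (intro exI[of _ "Suc k"] exI[of _ ls]) auto
  next
    case 3
    have cj: "cw p j \<in> carrier G" using assms j cw_in[of p j] by simp
    have "\<rho> j \<otimes> (\<rho> j \<otimes> cw p j) = cw p j" using rho_sq[of j] j assms cj by (simp flip: m_assoc)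
    then have "rw (j # ks) = cw p j \<otimes> rw ls" using e' cw_Suc[of p j] assms 3 j by simp
    then show ?thesis using k ls 3 j by (intro exI[of _ j] exI[of _ ls]) auto
  next
    case 4
    have cj: "\<rho> (Suc j) \<in> carrier G" using 4 k by simp
    have "rw (j # ks) = cw p k \<otimes> (\<rho> (Suc j) \<otimes> rw ls)"
      using e' rho_cw_below[of p j k] assms k j c cj 4 by (simp add: m_assoc)
    also have "\<rho> (Suc j) \<otimes> rw ls = rw (Suc j # ls)" using rw_Cons[of "Suc j" ls] ls1 4 k by simp
    finally show ?thesis using k ls 4 j by (intro exI[of _ k] exI[of _ "Suc j # ls"]) auto
  qed
qed

lemma stabilizer_word:
  assumes "1 \<le> p" "p \<le> n" "set ks \<subseteq> {p..<n}" "P (rw ks) p = p"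
  shows "\<exists>ls. set ls \<subseteq> {Suc p..<n} \<and> rw ks = rw ls"
proof -
  obtain k ls where k: "p \<le> k" "k \<le> n" and ls: "set ls \<subseteq> {Suc p..<n}" and e: "rw ks = cw p k \<otimes> rw ls"
    using coset_form[OF assms(1-3)] by blast
  have ls1: "set ls \<subseteq> {1..<n}" using ls by auto
  have "P (rw ls) p = p" using ls by (intro P_fix[OF ls1]) auto
  then have "P (rw ks) p = k"
    unfolding e using P_mult[of "cw p k" "rw ls"] cw_in[of p k] ls1 assms k P_cw[of p k] by simp
  then have "rw ks = rw ls" using assms(4) e ls1 by (simp add: cl_Nil)
  then show ?thesis using ls by blast
qed

text \<open>The points 1, 2, ... are fixed in turn, and \<open>stabilizer_word\<close> removes one
  generator index each time; at \<open>p = n\<close> no letter is left.\<close>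

lemma rho_word_trivial:
  assumes "set ks \<subseteq> {1..<n}" "P (rw ks) = id"
  shows "rw ks = \<one>"
proof (cases "n = 0")
  case True
  then have "ks = []" using assms by simp
  then show ?thesis using cl_Nil by simp
next
  case False
  have "\<exists>ls. set ls \<subseteq> {p..<n} \<and> rw ks = rw ls" if "1 \<le> p" "p \<le> n" for p
    using that
  proof (induction p rule: dec_induct)
    case (step p)
    then obtain ls where "set ls \<subseteq> {p..<n}" "rw ks = rw ls" by auto
    then show ?case using stabilizer_word[of p ls] assms(2) step by simp
  qed (use assms in auto)
  from this[of n] False show ?thesis by (auto simp: cl_Nil)
qed

section \<open>The generators as conjugates of \<kappa>\<close>

abbreviation \<kappa> :: "vt_gen gword set"
  where "\<kappa> \<equiv> \<s> 1 \<otimes> \<rho> 1"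

definition cj :: "nat list \<Rightarrow> vt_gen gword set"
  where "cj ks = rw ks \<otimes> \<kappa> \<otimes> inv (rw ks)"

text \<open>Conjugation by \<open>\<rho>\<^sub>i\<close> turns \<open>s\<^sub>i \<rho>\<^sub>i\<close> into \<open>\<rho>\<^sub>i s\<^sub>i\<close>, its inverse; hence the sign when the indices
  are in decreasing order.\<close>

definition Lam :: "nat \<Rightarrow> nat \<Rightarrow> vt_gen gword set"
  where "Lam i j = (if i < j then lam n i j else inv (lam n j i))"

lemma comm_list:
  assumes "g \<in> carrier G" "set ys \<subseteq> vt_gens n" "\<And>y. y \<in> set ys \<Longrightarrow> g \<otimes> cl [y] = cl [y] \<otimes> g"
  shows "g \<otimes> cl ys = cl ys \<otimes> g"
  using assms(2,3)
proof (induction ys)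
  case Nil
  then show ?case using assms by (simp add: cl_Nil)
next
  case (Cons y ys)
  have e: "g \<otimes> cl [y] = cl [y] \<otimes> g" using Cons.prems by simp
  have "g \<otimes> (cl [y] \<otimes> cl ys) = cl [y] \<otimes> (g \<otimes> cl ys)"
    using Cons.prems assms e by (simp flip: m_assoc)
  then show ?case using Cons assms cl_Cons[of y ys] by (simp add: m_assoc)
qed

lemma \<kappa>_in: "2 \<le> n \<Longrightarrow> \<kappa> \<in> carrier G"
  by simp

lemma \<kappa>_comm:
  assumes "2 \<le> n" "set ys \<subseteq> S ` {3..<n} \<union> Rho ` {3..<n}"
  shows "\<kappa> \<otimes> cl ys = cl ys \<otimes> \<kappa>"
proof (rule comm_list[OF \<kappa>_in[OF assms(1)]])
  show "set ys \<subseteq> vt_gens n" using assms by (auto simp: vt_gens_def)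
  fix y assume "y \<in> set ys"
  then obtain k where k: "3 \<le> k" "k < n" and y: "y = S k \<or> y = Rho k" using assms by auto
  have c: "\<s> 1 \<in> carrier G" "\<rho> 1 \<in> carrier G" "cl [y] \<in> carrier G" using k y by auto
  have "\<rho> 1 \<otimes> cl [y] = cl [y] \<otimes> \<rho> 1" "\<s> 1 \<otimes> cl [y] = cl [y] \<otimes> \<s> 1"
    using far_comm[of 1 k] k y by auto
  then show "\<kappa> \<otimes> cl [y] = cl [y] \<otimes> \<kappa>" using c by (metis m_assoc)
qed

lemma P_rev:
  assumes "set ks \<subseteq> {1..<n}" shows "P (rw (rev ks)) (P (rw ks) i) = i"
proof -
  have "P (rw (rev ks)) \<circ> P (rw ks) = id"
    using P_mult[of "rw (rev ks)" "rw ks"] assms by (simp add: rw_rev P_one)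
  then show ?thesis by (metis comp_apply id_apply)
qed

text \<open>The quotient of the two \<rho>-words fixes 1 and 2, so it can be rewritten in letters of
  index at least 3, and these commute with \<kappa>.\<close>

lemma cj_eq:
  assumes n: "2 \<le> n" and k: "set ks \<subseteq> {1..<n}" "set ls \<subseteq> {1..<n}"
    and P: "P (rw ks) 1 = P (rw ls) 1" "P (rw ks) 2 = P (rw ls) 2"
  shows "cj ks = cj ls"
proof -
  let ?m = "rev ks @ ls"
  have m: "set ?m \<subseteq> {1..<n}" using k by simp
  have e: "rw ?m = inv (rw ks) \<otimes> rw ls" using k by (simp add: rw_append rw_rev del: map_append rev_map)
  have "P (rw ?m) = P (rw (rev ks)) \<circ> P (rw ls)"
    using P_mult[of "rw (rev ks)" "rw ls"] rw_append[of "rev ks" ls] k by simp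
  then have "P (rw ?m) 1 = 1" "P (rw ?m) 2 = 2"
    using P_rev[OF k(1), of 1] P_rev[OF k(1), of 2] P by simp_all
  then obtain m2 where m2: "set m2 \<subseteq> {Suc 1..<n}" "rw ?m = rw m2"
    using stabilizer_word[of 1 ?m] m n by auto
  then obtain m3 where m3: "set m3 \<subseteq> {Suc 2..<n}" "rw m2 = rw m3"
    using stabilizer_word[of 2 m2] n \<open>P (rw ?m) 2 = 2\<close> by (auto simp: numeral_2_eq_2)
  have "Rho ` set m3 \<subseteq> S ` {3..<n} \<union> Rho ` {3..<n}" using m3(1) by (auto simp: numeral_3_eq_3)
  then have c: "\<kappa> \<otimes> rw ?m = rw ?m \<otimes> \<kappa>"
    using \<kappa>_comm[OF n, of "map Rho m3"] m2 m3 by simp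
  have cc: "rw ks \<in> carrier G" "rw ls \<in> carrier G" "\<kappa> \<in> carrier G" "rw ?m \<in> carrier G"
    using k \<kappa>_in[OF n] m rw_in[OF m] by simp_all
  have ls: "rw ls = rw ks \<otimes> rw ?m" unfolding e using cc by (simp add: inv_cancel)
  have "cj ls = rw ks \<otimes> (rw ?m \<otimes> \<kappa>) \<otimes> inv (rw ?m) \<otimes> inv (rw ks)"
    unfolding cj_def ls using cc by (simp only: inv_mult_group m_assoc m_closed inv_closed)
  also have "\<dots> = cj ks" unfolding c[symmetric] cj_def using cc by (simp only: m_assoc m_closed inv_closed r_inv r_one)
  finally show ?thesis ..
qed

text \<open>By the braid and the mixed relation, conjugation by
  \<open>\<rho> i \<otimes> \<rho> (Suc i)\<close> carries \<open>\<s> i \<otimes> \<rho> i\<close>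
  to the same product with index \<open>Suc i\<close>.\<close>

lemma s_rho_cj:
  assumes "1 \<le> i" "i < n"
  shows "\<exists>ks. set ks \<subseteq> {1..<n} \<and> P (rw ks) 1 = i \<and> P (rw ks) 2 = Suc i \<and> \<s> i \<otimes> \<rho> i = cj ks"
  using assms
proof (induction i rule: dec_induct)
  case base
  then show ?case by (intro exI[of _ "[]"]) (simp add: cl_Nil P_one cj_def)
next
  case (step i)
  then obtain ks where ks: "set ks \<subseteq> {1..<n}" "P (rw ks) 1 = i" "P (rw ks) 2 = Suc i"
    and e: "\<s> i \<otimes> \<rho> i = cj ks" by auto
  have i: "1 \<le> i" "Suc i < n" using step by auto
  let ?t = "\<rho> i \<otimes> \<rho> (Suc i)"
  have c: "\<rho> i \<in> carrier G" "\<rho> (Suc i) \<in> carrier G" "\<s> i \<in> carrier G" "\<s> (Suc i) \<in> carrier G"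
    "rw ks \<in> carrier G" "\<kappa> \<in> carrier G"
    using i ks \<kappa>_in by simp_all
  have b: "\<rho> (Suc i) \<otimes> ?t = ?t \<otimes> \<rho> i" "\<s> (Suc i) \<otimes> ?t = ?t \<otimes> \<s> i"
    using braid[OF i] c by (simp_all add: m_assoc)
  have "\<s> (Suc i) \<otimes> \<rho> (Suc i) \<otimes> ?t = \<s> (Suc i) \<otimes> (?t \<otimes> \<rho> i)" using b(1) c by (simp only: m_assoc m_closed)
  also have "\<dots> = (\<s> (Suc i) \<otimes> ?t) \<otimes> \<rho> i" using c by (simp only: m_assoc m_closed)
  also have "\<dots> = ?t \<otimes> (\<s> i \<otimes> \<rho> i)" unfolding b(2) using c by (simp only: m_assoc m_closed)
  finally have "\<s> (Suc i) \<otimes> \<rho> (Suc i) = ?t \<otimes> (\<s> i \<otimes> \<rho> i) \<otimes> inv ?t"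
    using c by (intro inv_solve_right[THEN iffD2]) auto
  also have "\<dots> = (?t \<otimes> rw ks) \<otimes> \<kappa> \<otimes> inv (?t \<otimes> rw ks)"
    unfolding e cj_def using c by (simp only: inv_mult_group m_assoc m_closed inv_closed)
  also have "?t \<otimes> rw ks = rw (i # Suc i # ks)"
    using rw_Cons[of i "Suc i # ks"] rw_Cons[of "Suc i" ks] ks i c by (simp add: m_assoc)
  finally have "\<s> (Suc i) \<otimes> \<rho> (Suc i) = cj (i # Suc i # ks)" by (simp only: cj_def)
  moreover have "P (rw (i # Suc i # ks)) = transpose i (Suc i) \<circ> (transpose (Suc i) (Suc (Suc i)) \<circ> P (rw ks))"
    using P_rw_Cons[of i "Suc i # ks"] P_rw_Cons[of "Suc i" ks] ks i by simp
  then have "P (rw (i # Suc i # ks)) 1 = Suc i" "P (rw (i # Suc i # ks)) 2 = Suc (Suc i)"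
    using ks by (simp_all add: transpose_def)
  ultimately show ?case using ks i by (intro exI[of _ "i # Suc i # ks"]) simp
qed

lemma lam_conj:
  assumes "1 \<le> i" "i < j" "j \<le> n"
  shows "lam n i j = cw (Suc i) j \<otimes> (\<s> i \<otimes> \<rho> i) \<otimes> inv (cw (Suc i) j)"
proof -
  let ?u = "[i + 1..<j]"
  have u: "set ?u \<subseteq> {1..<n}" using assms by auto
  have "lam n i j = cl (map Rho (rev ?u) @ [S i, Rho i] @ map Rho ?u)" by (simp add: lam_def cl_def)
  also have "\<dots> = rw (rev ?u) \<otimes> (cl [S i, Rho i] \<otimes> rw ?u)"
  proof -
    have g: "set (map Rho (rev ?u)) \<subseteq> vt_gens n" "set [S i, Rho i] \<subseteq> vt_gens n" "set (map Rho ?u) \<subseteq> vt_gens n"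
      using u assms by (simp_all del: upt_Suc)
    then have "set ([S i, Rho i] @ map Rho ?u) \<subseteq> vt_gens n" by simp
    then show ?thesis using cl_append[OF g(1)] cl_append[OF g(2,3)] by simp
  qed
  also have "cl [S i, Rho i] = \<s> i \<otimes> \<rho> i" using cl_Cons[of "S i" "[Rho i]"] assms by simp
  also have "rw ?u = inv (rw (rev ?u))" using rw_rev[of "rev ?u"] u by (simp del: rev_map)
  finally show ?thesis using assms u by (simp add: m_assoc rw_rev)
qed

lemma lam_cj:
  assumes "1 \<le> i" "i < j" "j \<le> n"
  shows "\<exists>ks. set ks \<subseteq> {1..<n} \<and> P (rw ks) 1 = i \<and> P (rw ks) 2 = j \<and> lam n i j = cj ks"
proof -
  obtain ks where ks: "set ks \<subseteq> {1..<n}" "P (rw ks) 1 = i" "P (rw ks) 2 = Suc i"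
    and e: "\<s> i \<otimes> \<rho> i = cj ks" using s_rho_cj[of i] assms by auto
  let ?u = "rev [Suc i..<j]"
  have u: "set ?u \<subseteq> {1..<n}" using assms by auto
  have c: "rw ?u \<in> carrier G" "rw ks \<in> carrier G" "\<kappa> \<in> carrier G" using rw_in[OF u] ks \<kappa>_in assms by simp_all
  have uk: "rw (?u @ ks) = rw ?u \<otimes> rw ks" using rw_append[OF u ks(1)] .
  have "lam n i j = cj (?u @ ks)"
    unfolding lam_conj[OF assms] e cj_def uk using c by (simp only: inv_mult_group m_assoc m_closed inv_closed)
  moreover have "P (rw ?u) i = i" using P_fix[OF u, of i] by auto
  moreover have "P (rw ?u) (Suc i) = j" using P_cw[of "Suc i" j] assms by simp
  ultimately show ?thesis
    using ks u P_mult[OF c(1,2)] uk by (intro exI[of _ "?u @ ks"]) simp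
qed

lemma P_inj: "set ks \<subseteq> {1..<n} \<Longrightarrow> P (rw ks) i = P (rw ks) j \<longleftrightarrow> i = j"
  by (metis P_rev)

lemma P_range: "set ks \<subseteq> {1..<n} \<Longrightarrow> i \<in> {1..n} \<Longrightarrow> P (rw ks) i \<in> {1..n}"
  using permutes_in_image[OF P_permutes[OF rw_in]] by blast

lemma lam_in [simp]:
  assumes "1 \<le> i" "i < j" "j \<le> n" shows "lam n i j \<in> carrier G"
  using lam_cj[OF assms] \<kappa>_in assms unfolding cj_def by auto

lemma cj_Lam:
  assumes n: "2 \<le> n" and ks: "set ks \<subseteq> {1..<n}"
  shows "cj ks = Lam (P (rw ks) 1) (P (rw ks) 2)"
proof -
  let ?i = "P (rw ks) 1" and ?j = "P (rw ks) 2"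
  have r: "?i \<in> {1..n}" "?j \<in> {1..n}" "?i \<noteq> ?j" using P_range[OF ks] P_inj[OF ks] n by auto
  show ?thesis
  proof (cases "?i < ?j")
    case True
    obtain ls where ls: "set ls \<subseteq> {1..<n}" "P (rw ls) 1 = ?i" "P (rw ls) 2 = ?j" "lam n ?i ?j = cj ls"
      using lam_cj[of ?i ?j] r True by auto
    then show ?thesis using cj_eq[OF n ks ls(1)] True by (simp add: Lam_def)
  next
    case False
    then have lt: "?j < ?i" using r by simp
    obtain ls where ls: "set ls \<subseteq> {1..<n}" "P (rw ls) 1 = ?j" "P (rw ls) 2 = ?i" and e: "lam n ?j ?i = cj ls"
      using lam_cj[of ?j ?i] r lt by auto
    have c: "rw ls \<in> carrier G" "\<s> 1 \<in> carrier G" "\<rho> 1 \<in> carrier G" using ls n by simp_all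
    \<comment> \<open>The additional letter swaps the images of 1 and 2, and it conjugates \<kappa>
      to its inverse.\<close>
    have l1: "set (ls @ [1]) \<subseteq> {1..<n}" "rw (ls @ [1]) = rw ls \<otimes> \<rho> 1" using ls n rw_append[of ls "[1]"] by simp_all
    have "P (rw (ls @ [1])) = P (rw ls) \<circ> transpose 1 2"
      unfolding l1(2) using P_mult[OF c(1,3)] P_rho[of 1] n by (simp add: numeral_2_eq_2)
    then have "P (rw (ls @ [1])) 1 = ?i" "P (rw (ls @ [1])) 2 = ?j" using ls by simp_all
    then have "cj ks = cj (ls @ [1])" using cj_eq[OF n ks l1(1)] by simp
    also have "\<dots> = rw ls \<otimes> \<rho> 1 \<otimes> (\<s> 1 \<otimes> \<rho> 1) \<otimes> (\<rho> 1 \<otimes> inv (rw ls))"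
      unfolding cj_def l1(2) using c rho_inv[of 1] n by (simp only: inv_mult_group) simp
    also have "\<dots> = rw ls \<otimes> (\<rho> 1 \<otimes> \<s> 1) \<otimes> (\<rho> 1 \<otimes> \<rho> 1) \<otimes> inv (rw ls)"
      using c by (simp only: m_assoc m_closed inv_closed)
    also have "\<dots> = inv (cj ls)"
      unfolding cj_def using c rho_inv[of 1] s_inv[of 1] rho_sq[of 1] n
      by (simp add: inv_mult_group m_assoc)
    finally show ?thesis using False e by (simp add: Lam_def)
  qed
qed

text \<open>Prefixing a \<rho>-word to the conjugator of \<kappa> composes the permutations, and
  \<open>cj\<close> depends only on the images of 1 and 2.\<close>

lemma rw_conj_lam:
  assumes ks: "set ks \<subseteq> {1..<n}" and ij: "1 \<le> i" "i < j" "j \<le> n"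
  shows "rw ks \<otimes> lam n i j \<otimes> inv (rw ks) = Lam (P (rw ks) i) (P (rw ks) j)"
proof -
  obtain ls where ls: "set ls \<subseteq> {1..<n}" "P (rw ls) 1 = i" "P (rw ls) 2 = j" and e: "lam n i j = cj ls"
    using lam_cj[OF ij] by auto
  have n: "2 \<le> n" using ij by simp
  have c: "rw ks \<in> carrier G" "rw ls \<in> carrier G" "\<kappa> \<in> carrier G" using ks ls \<kappa>_in[OF n] by simp_all
  have a: "rw (ks @ ls) = rw ks \<otimes> rw ls" using rw_append[OF ks ls(1)] .
  have "rw ks \<otimes> lam n i j \<otimes> inv (rw ks) = cj (ks @ ls)"
    unfolding e cj_def a using c by (simp only: inv_mult_group m_assoc m_closed inv_closed)
  also have "\<dots> = Lam (P (rw (ks @ ls)) 1) (P (rw (ks @ ls)) 2)" using cj_Lam[OF n] ks ls by simp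
  also have "P (rw (ks @ ls)) = P (rw ks) \<circ> P (rw ls)" unfolding a using P_mult c by simp
  finally show ?thesis using ls by simp
qed

lemma \<kappa>_lam_comm:
  assumes "3 \<le> a" "a < b" "b \<le> n"
  shows "\<kappa> \<otimes> lam n a b = lam n a b \<otimes> \<kappa>"
proof -
  have "lam n a b = cl (map Rho (rev [a + 1..<b]) @ [S a, Rho a] @ map Rho [a + 1..<b])" by (simp add: lam_def cl_def)
  then show ?thesis using \<kappa>_comm[of "map Rho (rev [a + 1..<b]) @ [S a, Rho a] @ map Rho [a + 1..<b]"] assms
    by fastforce
qed

text \<open>A \<rho>-word moves the first pair to (1, 2), where its generator is \<kappa>. The
  second pair then has both indices at least 3, and so do all letters of its generator.\<close>

lemma lam_comm:
  assumes ij: "1 \<le> i" "i < j" "j \<le> n" and kl: "1 \<le> k" "k < l" "l \<le> n" and d: "{i, j} \<inter> {k, l} = {}"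
  shows "lam n i j \<otimes> lam n k l = lam n k l \<otimes> lam n i j"
proof -
  obtain ls where ls: "set ls \<subseteq> {1..<n}" "P (rw ls) 1 = i" "P (rw ls) 2 = j" and e: "lam n i j = cj ls"
    using lam_cj[OF ij] by auto
  let ?r = "rev ls"
  let ?k = "P (rw ?r) k" and ?l = "P (rw ?r) l"
  have r: "set ?r \<subseteq> {1..<n}" using ls by simp
  have "P (rw ls) ?k = k" "P (rw ls) ?l = l" using P_rev[OF r, of k] P_rev[OF r, of l] by simp_all
  then have "?k \<noteq> 1" "?k \<noteq> 2" "?l \<noteq> 1" "?l \<noteq> 2" using d ls by auto
  moreover have "?k \<in> {1..n}" "?l \<in> {1..n}" "?k \<noteq> ?l"
    using P_range[OF r, of k] P_range[OF r, of l] kl P_inj[OF r] by auto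
  ultimately have kl': "3 \<le> ?k" "3 \<le> ?l" "?k \<le> n" "?l \<le> n" "?k \<noteq> ?l" by auto
  have c: "rw ls \<in> carrier G" "\<kappa> \<in> carrier G" "lam n k l \<in> carrier G"
    using ls \<kappa>_in kl by simp_all
  have "\<kappa> \<otimes> Lam ?k ?l = Lam ?k ?l \<otimes> \<kappa>"
  proof (cases "?k < ?l")
    case True
    then show ?thesis using \<kappa>_lam_comm[of ?k ?l] kl' by (simp add: Lam_def)
  next
    case False
    then have "\<kappa> \<otimes> lam n ?l ?k = lam n ?l ?k \<otimes> \<kappa>" "lam n ?l ?k \<in> carrier G"
      using \<kappa>_lam_comm[of ?l ?k] kl' by simp_all
    then show ?thesis using comm_inv_left[of "lam n ?l ?k" \<kappa>] False c by (simp add: Lam_def)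
  qed
  moreover have "Lam ?k ?l = inv (rw ls) \<otimes> lam n k l \<otimes> rw ls"
    using rw_conj_lam[OF r kl] rw_rev[OF ls(1)] c by simp
  ultimately have "rw ls \<otimes> (\<kappa> \<otimes> (inv (rw ls) \<otimes> lam n k l \<otimes> rw ls)) \<otimes> inv (rw ls)
      = rw ls \<otimes> ((inv (rw ls) \<otimes> lam n k l \<otimes> rw ls) \<otimes> \<kappa>) \<otimes> inv (rw ls)" by simp
  then show ?thesis unfolding e cj_def using c by (simp add: m_assoc inv_cancel)
qed

section \<open>Factorisation of \<open>VT n\<close> into a pure part and a \<rho>-word\<close>

abbreviation evl :: "(nat \<times> nat) gword \<Rightarrow> vt_gen gword set"
  where "evl \<equiv> word_eval G (lamp n)"

lemma lamp_closed: "lamp n \<in> pairs n \<rightarrow> carrier G"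
  by (auto simp: lamp_def pairs_def)

lemma evl_in: "w \<in> words (pairs n) \<Longrightarrow> evl w \<in> carrier G"
  by (rule word_eval_closed[OF lamp_closed])

lemma evl_append: "v \<in> words (pairs n) \<Longrightarrow> w \<in> words (pairs n) \<Longrightarrow> evl (v @ w) = evl v \<otimes> evl w"
  by (rule word_eval_append[OF lamp_closed])

lemma evl_Cons: "evl (l # w) = (if snd l then lamp n (fst l) else inv (lamp n (fst l))) \<otimes> evl w"
  by (cases l) (simp add: word_eval_def)

lemma Lam_word:
  assumes "i \<in> {1..n}" "j \<in> {1..n}" "i \<noteq> j"
  shows "\<exists>w\<in>words (pairs n). evl w = Lam i j" "\<exists>w\<in>words (pairs n). evl w = inv (Lam i j)"
proof -
  have *: "\<exists>w\<in>words (pairs n). evl w = Lam i j" if "i \<in> {1..n}" "j \<in> {1..n}" "i \<noteq> j" for i j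
    using that by (intro bexI[of _ "[if i < j then ((i, j), True) else ((j, i), False)]"])
      (auto simp: word_eval_def lamp_def Lam_def pairs_def)
  have "inv (Lam i j) = Lam j i" using assms by (auto simp: Lam_def)
  then show "\<exists>w\<in>words (pairs n). evl w = Lam i j" "\<exists>w\<in>words (pairs n). evl w = inv (Lam i j)"
    using *[OF assms] *[of j i] assms by auto
qed

lemma rho_conj_word:
  assumes k: "k \<in> {1..<n}" and w: "w \<in> words (pairs n)"
  shows "\<exists>v\<in>words (pairs n). evl v = \<rho> k \<otimes> evl w \<otimes> \<rho> k"
  using w
proof (induction w)
  case Nil
  then show ?case using rho_sq[OF k] k by (intro bexI[of _ "[]"]) (simp_all add: word_eval_def)
next
  case (Cons l w)
  obtain i j e where l: "l = ((i, j), e)" by (metis prod.exhaust)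
  have ij: "1 \<le> i" "i < j" "j \<le> n" and w: "w \<in> words (pairs n)" using Cons.prems l by (auto simp: pairs_def)
  obtain v where v: "v \<in> words (pairs n)" "evl v = \<rho> k \<otimes> evl w \<otimes> \<rho> k" using Cons w by auto
  let ?a = "P (\<rho> k) i" and ?b = "P (\<rho> k) j"
  have k1: "set [k] \<subseteq> {1..<n}" using k by simp
  have ab: "?a \<in> {1..n}" "?b \<in> {1..n}" "?a \<noteq> ?b"
    using P_range[OF k1, of i] P_range[OF k1, of j] P_inj[OF k1, of i j] ij by auto
  have c: "\<rho> k \<in> carrier G" "lam n i j \<in> carrier G" "evl w \<in> carrier G" using k ij w evl_in by simp_all
  have r: "\<rho> k \<otimes> lam n i j \<otimes> \<rho> k = Lam ?a ?b" using rw_conj_lam[OF k1 ij] rho_inv[OF k] by simp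
  then have ri: "\<rho> k \<otimes> inv (lam n i j) \<otimes> \<rho> k = inv (Lam ?a ?b)"
    using c rho_inv[OF k] by (simp add: inv_mult_group m_assoc flip: r)
  obtain u where u: "u \<in> words (pairs n)"
    "evl u = \<rho> k \<otimes> (if e then lam n i j else inv (lam n i j)) \<otimes> \<rho> k"
    using Lam_word[OF ab] r ri by (cases e) auto
  have "evl (u @ v) = (\<rho> k \<otimes> (if e then lam n i j else inv (lam n i j)) \<otimes> \<rho> k) \<otimes> (\<rho> k \<otimes> evl w \<otimes> \<rho> k)"
    using evl_append u v by simp
  also have "\<dots> = \<rho> k \<otimes> (if e then lam n i j else inv (lam n i j)) \<otimes> (\<rho> k \<otimes> \<rho> k) \<otimes> evl w \<otimes> \<rho> k"
    using c by (simp add: m_assoc)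
  also have "\<dots> = \<rho> k \<otimes> evl (l # w) \<otimes> \<rho> k"
    using c rho_sq[OF k] by (simp add: m_assoc l evl_Cons)
  finally show ?case using u(1) v(1) by (intro bexI[of _ "u @ v"]) simp_all
qed

text \<open>Each \<open>\<s> k\<close> is \<open>lam n k (Suc k) \<otimes> \<rho> k\<close>, and a
  \<rho> standing on the left moves to the right of the pure part by
  \<open>rho_conj_word\<close>.\<close>

lemma semidirect_form:
  assumes "w \<in> words (vt_gens n)"
  shows "\<exists>v ks. v \<in> words (pairs n) \<and> set ks \<subseteq> {1..<n} \<and>
    word_class (vt_gens n) (vt_rels n) w = evl v \<otimes> rw ks"
  using assms
proof (induction w)
  case Nil
  then show ?case using cl_Nil by (intro exI[of _ "[]"]) (simp add: word_eval_def cl_def)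
next
  case (Cons l w)
  let ?W = "word_class (vt_gens n) (vt_rels n)"
  obtain y e where l: "l = (y, e)" by fastforce
  have y: "y \<in> vt_gens n" and w: "w \<in> words (vt_gens n)" using Cons.prems l by auto
  obtain v ks where v: "v \<in> words (pairs n)" and ks: "set ks \<subseteq> {1..<n}" and e: "?W w = evl v \<otimes> rw ks"
    using Cons w by auto
  have wc: "?W w \<in> carrier G" using w by (simp add: G_eq VT_def presented_group_carrier)
  obtain k where k: "k \<in> {1..<n}" and yk: "y = S k \<or> y = Rho k" using y by (auto simp: vt_gens_def)
  have yc: "cl [y] \<in> carrier G" using y by simp
  have inv_y: "inv (cl [y]) = cl [y]" using yk rho_inv[OF k] s_inv[OF k] by auto
  \<comment> \<open>All generators are involutions, so a formal inverse letter has the class of the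
    letter itself.\<close>
  have neg: "?W [(y, False)] = cl [y]"
  proof -
    have "?W [(y, False)] \<otimes> cl [y] = ?W ([(y, False)] @ pos_word [y])"
      unfolding cl_def G_eq VT_def by (rule presented_group_mult) (use y in auto)
    also have "\<dots> = cl []"
      using word_eq.cancel[of "[]" "vt_gens n" "[]" y "vt_rels n" False] y
      unfolding cl_def by (subst word_class_eq_iff) simp_all
    finally have "?W [(y, False)] \<otimes> cl [y] = \<one>" by (simp add: cl_Nil)
    moreover have "?W [(y, False)] \<in> carrier G" using y by (auto simp: G_eq VT_def presented_group_carrier)
    ultimately show ?thesis using inv_equality[of "?W [(y, False)]" "cl [y]"] yc inv_y by simp
  qed
  have "?W (l # w) = ?W [l] \<otimes> ?W w"
    using presented_group_mult[of "[l]" "vt_gens n" w "vt_rels n"] y w l by (simp add: G_eq VT_def)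
  moreover have "?W [l] = cl [y]" using neg l by (cases e) (auto simp: cl_def)
  ultimately have lw: "?W (l # w) = cl [y] \<otimes> (evl v \<otimes> rw ks)" by (simp add: e)
  have c: "\<rho> k \<in> carrier G" "\<s> k \<in> carrier G" "evl v \<in> carrier G" "rw ks \<in> carrier G" using k v ks evl_in by simp_all
  obtain v' where v': "v' \<in> words (pairs n)" "evl v' = \<rho> k \<otimes> evl v \<otimes> \<rho> k" using rho_conj_word[OF k v] by blast
  have rk: "rw (k # ks) = \<rho> k \<otimes> rw ks" using rw_Cons[OF k ks] .
  have rr: "\<rho> k \<otimes> (\<rho> k \<otimes> z) = z" if "z \<in> carrier G" for z
    using that rho_sq[OF k] c by (simp flip: m_assoc)
  show ?case
    using yk
  proof
    assume "y = Rho k"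
    then have "?W (l # w) = evl v' \<otimes> rw (k # ks)"
      unfolding lw v' rk using c rr by (simp add: m_assoc)
    then show ?thesis using v' ks k by (intro exI[of _ v'] exI[of _ "k # ks"]) simp
  next
    assume yS: "y = S k"
    have lk: "lam n k (Suc k) = \<s> k \<otimes> \<rho> k" using lam_conj[of k "Suc k"] k c by (simp add: cl_Nil)
    have kk: "(k, Suc k) \<in> pairs n" using k by (simp add: pairs_def)
    have "evl (((k, Suc k), True) # v') = (\<s> k \<otimes> \<rho> k) \<otimes> evl v'"
      by (simp add: evl_Cons lk)
    then have "?W (l # w) = evl (((k, Suc k), True) # v') \<otimes> rw (k # ks)"
      unfolding lw yS rk using c rr v' by (simp add: m_assoc)
    then show ?thesis using v' ks k kk by (intro exI[of _ "((k, Suc k), True) # v'"] exI[of _ "k # ks"]) simp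
  qed
qed

lemma P_lam: "1 \<le> i \<Longrightarrow> i < j \<Longrightarrow> j \<le> n \<Longrightarrow> P (lam n i j) = id"
  using lams_subset_PVT[of n] by (auto simp: lams_def PVT_def kernel_def sym_group_one)

lemma P_evl: "w \<in> words (pairs n) \<Longrightarrow> P (evl w) = id"
proof (induction w)
  case Nil
  then show ?case by (simp add: word_eval_def P_one)
next
  case (Cons l w)
  obtain i j e where l: "l = ((i, j), e)" by (metis prod.exhaust)
  have ij: "1 \<le> i" "i < j" "j \<le> n" and w: "w \<in> words (pairs n)" using Cons.prems l by (auto simp: pairs_def)
  have "P (lam n i j) = id" using P_lam[OF ij] .
  moreover have "P (inv (lam n i j)) = id"
    using P_mult[of "inv (lam n i j)" "lam n i j"] ij \<open>P (lam n i j) = id\<close> by (simp add: P_one)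
  ultimately have "P (if e then lam n i j else inv (lam n i j)) = id" by simp
  then show ?case
    using Cons w P_mult[of "if e then lam n i j else inv (lam n i j)" "evl w"] ij evl_in[OF w]
    by (cases e) (simp_all add: l evl_Cons)
qed

text \<open>In the factorisation of \<open>semidirect_form\<close> the \<rho>-word carries the whole
  permutation; if that is trivial, \<open>rho_word_trivial\<close> removes the word.\<close>

lemma pure_generated:
  assumes "g \<in> carrier G" "P g = id"
  shows "\<exists>w\<in>words (pairs n). evl w = g"
proof -
  obtain u where u: "u \<in> words (vt_gens n)" "g = word_class (vt_gens n) (vt_rels n) u"
    using assms(1) by (auto simp: G_eq VT_def presented_group_carrier)
  obtain v ks where v: "v \<in> words (pairs n)" and ks: "set ks \<subseteq> {1..<n}" and e: "g = evl v \<otimes> rw ks"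
    using semidirect_form[OF u(1)] u(2) by auto
  have "P (rw ks) = id" using P_mult[of "evl v" "rw ks"] P_evl[OF v] evl_in[OF v] ks assms(2) e by simp
  then have "rw ks = \<one>" using rho_word_trivial[OF ks] by blast
  then show ?thesis using e v evl_in[OF v] by (intro bexI[of _ v]) simp_all
qed

end

section \<open>Faithfulness of the right-angled presentation\<close>

text \<open>\<open>A\<close> is the abstract right-angled group, which is not yet known to be
  \<open>PVT n\<close>.\<close>

locale signed_pairs = group A for n :: nat and A :: "(nat \<times> nat) gword set monoid" (structure) +
  assumes A_eq: "A = presented_group (pairs n) (comm_rels (pairs n) disjoint_pairs)"
begin

abbreviation pcl :: "(nat \<times> nat) gword \<Rightarrow> (nat \<times> nat) gword set"
  where "pcl \<equiv> word_class (pairs n) (comm_rels (pairs n) disjoint_pairs)"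

abbreviation \<gamma> :: "nat \<times> nat \<Rightarrow> (nat \<times> nat) gword set"
  where "\<gamma> p \<equiv> pcl [(p, True)]"

text \<open>Same sign convention as \<open>Lam\<close>, so that every permutation of the indices
  acts on these elements.\<close>

definition gen :: "nat \<Rightarrow> nat \<Rightarrow> (nat \<times> nat) gword set"
  where "gen i j = (if i < j then \<gamma> (i, j) else inv (\<gamma> (j, i)))"

text \<open>Models conjugation by a \<rho>-word with permutation \<pi>, compare
  \<open>rw_conj_lam\<close>.\<close>

definition T :: "(nat \<Rightarrow> nat) \<Rightarrow> (nat \<times> nat) gword set \<Rightarrow> (nat \<times> nat) gword set"
  where "T \<pi> = presented_lift A (\<lambda>(i, j). gen (\<pi> i) (\<pi> j))"

lemma pcl_in [simp]: "w \<in> words (pairs n) \<Longrightarrow> pcl w \<in> carrier A"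
  by (simp add: A_eq presented_group_carrier)

lemma pcl_append: "u \<in> words (pairs n) \<Longrightarrow> v \<in> words (pairs n) \<Longrightarrow> pcl (u @ v) = pcl u \<otimes> pcl v"
  unfolding A_eq by (rule presented_group_mult[symmetric])

lemma pcl_Nil: "pcl [] = \<one>"
  by (simp add: A_eq presented_group_one)

lemma pcl_Cons: "fst l \<in> pairs n \<Longrightarrow> w \<in> words (pairs n) \<Longrightarrow> pcl (l # w) = pcl [l] \<otimes> pcl w"
  using pcl_append[of "[l]" w] by simp

lemma pcl_neg: assumes "p \<in> pairs n" shows "pcl [(p, False)] = inv (\<gamma> p)"
proof -
  have "pcl [(p, False)] \<otimes> \<gamma> p = pcl ([(p, False), (p, True)])"
    using pcl_append[of "[(p, False)]" "[(p, True)]"] assms by simp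
  also have "\<dots> = pcl []"
    using word_eq.cancel[of "[]" "pairs n" "[]" p _ False] assms by (subst word_class_eq_iff) simp_all
  finally show ?thesis using inv_equality[of "pcl [(p, False)]" "\<gamma> p"] assms by (simp add: pcl_Nil)
qed

lemma gen_in: "i \<in> {1..n} \<Longrightarrow> j \<in> {1..n} \<Longrightarrow> i \<noteq> j \<Longrightarrow> gen i j \<in> carrier A"
  by (auto simp: gen_def pairs_iff)

lemma inv_gen: "i \<in> {1..n} \<Longrightarrow> j \<in> {1..n} \<Longrightarrow> i \<noteq> j \<Longrightarrow> inv (gen i j) = gen j i"
  by (auto simp: gen_def pairs_iff)

lemma gen_comm_pos:
  assumes "p \<in> pairs n" "q \<in> pairs n" "disjoint_pairs p q"
  shows "\<gamma> p \<otimes> \<gamma> q = \<gamma> q \<otimes> \<gamma> p"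
proof -
  have "(pos_word [p, q], pos_word [q, p]) \<in> comm_rels (pairs n) disjoint_pairs"
    using assms unfolding comm_rels_def by blast
  then have "pcl (pos_word [p, q]) = pcl (pos_word [q, p])"
    using word_eq.rel[of "[]" "pairs n" "[]" "pos_word [p, q]" "pos_word [q, p]"] assms
    by (subst word_class_eq_iff) simp_all
  then show ?thesis using assms pcl_Cons[of "(p, True)" "[(q, True)]"] pcl_Cons[of "(q, True)" "[(p, True)]"] by simp
qed

lemma gen_comm:
  assumes "i \<in> {1..n}" "j \<in> {1..n}" "i \<noteq> j" "k \<in> {1..n}" "l \<in> {1..n}" "k \<noteq> l" "{i, j} \<inter> {k, l} = {}"
  shows "gen i j \<otimes> gen k l = gen k l \<otimes> gen i j"
proof -
  define p where "p = (if i < j then (i, j) else (j, i))"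
  define q where "q = (if k < l then (k, l) else (l, k))"
  have pq: "p \<in> pairs n" "q \<in> pairs n" "disjoint_pairs p q" using assms by (auto simp: p_def q_def pairs_iff disjoint_pairs_def)
  have c: "\<gamma> p \<in> carrier A" "\<gamma> q \<in> carrier A" using pq by simp_all
  note e = gen_comm_pos[OF pq]
  note e1 = comm_inv_left[OF c e] and e2 = comm_inv_left[OF c(2,1) e[symmetric]]
  have e3: "inv (\<gamma> p) \<otimes> inv (\<gamma> q) = inv (\<gamma> q) \<otimes> inv (\<gamma> p)"
    using comm_inv_left[OF c(1) inv_closed[OF c(2)] e2[symmetric]] .
  have "gen i j = \<gamma> p \<or> gen i j = inv (\<gamma> p)" "gen k l = \<gamma> q \<or> gen k l = inv (\<gamma> q)"
    by (simp_all add: gen_def p_def q_def)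
  then show ?thesis using e e1 e2 e3 by metis
qed

lemma T_gens:
  assumes "\<pi> permutes {1..n}"
  shows "(\<lambda>(i, j). gen (\<pi> i) (\<pi> j)) \<in> pairs n \<rightarrow> carrier A"
proof
  fix p assume "p \<in> pairs n"
  then obtain i j where p: "p = (i, j)" "i \<in> {1..n}" "j \<in> {1..n}" "i \<noteq> j" by (auto simp: pairs_def)
  moreover have "\<pi> i \<noteq> \<pi> j" using p permutes_inj[OF assms] by (meson injD)
  ultimately show "(case p of (i, j) \<Rightarrow> gen (\<pi> i) (\<pi> j)) \<in> carrier A"
    using permutes_in_image[OF assms] gen_in by auto
qed

lemma T_rels:
  assumes "\<pi> permutes {1..n}" "(l, r) \<in> comm_rels (pairs n) disjoint_pairs"
  shows "word_eval A (\<lambda>(i, j). gen (\<pi> i) (\<pi> j)) l = word_eval A (\<lambda>(i, j). gen (\<pi> i) (\<pi> j)) r"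
proof -
  obtain i j i' j' where p: "(i, j) \<in> pairs n" "(i', j') \<in> pairs n" "disjoint_pairs (i, j) (i', j')"
    and lr: "l = pos_word [(i, j), (i', j')]" "r = pos_word [(i', j'), (i, j)]"
    using assms(2) by (auto simp: comm_rels_def)
  have i: "\<pi> a = \<pi> b \<longleftrightarrow> a = b" for a b using permutes_inj[OF assms(1)] by (meson injD)
  have "gen (\<pi> i) (\<pi> j) \<otimes> gen (\<pi> i') (\<pi> j') = gen (\<pi> i') (\<pi> j') \<otimes> gen (\<pi> i) (\<pi> j)"
    using p i permutes_in_image[OF assms(1)] by (intro gen_comm) (auto simp: pairs_iff disjoint_pairs_def)
  moreover have "gen (\<pi> i) (\<pi> j) \<in> carrier A" "gen (\<pi> i') (\<pi> j') \<in> carrier A"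
    using funcset_mem[OF T_gens[OF assms(1)]] p by force+
  ultimately show ?thesis by (simp add: lr word_eval_def)
qed

lemma T_hom: "\<pi> permutes {1..n} \<Longrightarrow> T \<pi> \<in> hom A A"
  unfolding T_def by (subst (1) A_eq, rule presented_lift_hom[OF T_gens T_rels])

lemma T_in: "\<pi> permutes {1..n} \<Longrightarrow> g \<in> carrier A \<Longrightarrow> T \<pi> g \<in> carrier A"
  using T_hom by (auto simp: hom_def)

lemma T_mult: "\<pi> permutes {1..n} \<Longrightarrow> g \<in> carrier A \<Longrightarrow> h \<in> carrier A \<Longrightarrow> T \<pi> (g \<otimes> h) = T \<pi> g \<otimes> T \<pi> h"
  using T_hom by (auto simp: hom_def)

lemma T_one: "\<pi> permutes {1..n} \<Longrightarrow> T \<pi> \<one> = \<one>"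
  using hom_one[OF T_hom] is_group by blast

lemma T_inv: "\<pi> permutes {1..n} \<Longrightarrow> g \<in> carrier A \<Longrightarrow> T \<pi> (inv g) = inv (T \<pi> g)"
  using group_hom.hom_inv[of A A "T \<pi>"] T_hom is_group by (simp add: group_hom_def group_hom_axioms_def)

lemma T_gen:
  assumes p: "\<pi> permutes {1..n}" and "i \<in> {1..n}" "j \<in> {1..n}" "i \<noteq> j"
  shows "T \<pi> (gen i j) = gen (\<pi> i) (\<pi> j)"
proof -
  have pos: "T \<pi> (\<gamma> (i, j)) = gen (\<pi> i) (\<pi> j)" if "(i, j) \<in> pairs n" for i j
  proof -
    have "T \<pi> (\<gamma> (i, j)) = word_eval A (\<lambda>(i, j). gen (\<pi> i) (\<pi> j)) [((i, j), True)]"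
      unfolding T_def using that by (intro presented_lift_class[OF T_gens[OF p] T_rels[OF p]]) simp_all
    moreover have "gen (\<pi> i) (\<pi> j) \<in> carrier A" using funcset_mem[OF T_gens[OF p]] that by force
    ultimately show ?thesis by (simp add: word_eval_def)
  qed
  have "\<pi> i \<in> {1..n}" "\<pi> j \<in> {1..n}" "\<pi> i \<noteq> \<pi> j"
    using assms permutes_in_image[OF p] permutes_inj[OF p] by (auto dest: injD)
  then show ?thesis
    using pos[of i j] pos[of j i] assms T_inv[OF p, of "\<gamma> (j, i)"] inv_gen[of "\<pi> j" "\<pi> i"]
    by (auto simp: gen_def[of i j] pairs_iff)
qed

lemma hom_ext:
  assumes "f \<in> hom A A" "f' \<in> hom A A" "\<And>p. p \<in> pairs n \<Longrightarrow> f (\<gamma> p) = f' (\<gamma> p)" "g \<in> carrier A"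
  shows "f g = f' g"
proof -
  interpret f: group_hom A A f by unfold_locales (rule assms)
  interpret f': group_hom A A f' by unfold_locales (rule assms)
  have "f (pcl w) = f' (pcl w)" if "w \<in> words (pairs n)" for w
    using that
  proof (induction w)
    case (Cons l w)
    obtain p e where l: "l = (p, e)" by fastforce
    have p: "p \<in> pairs n" using Cons.prems l by simp
    have "f (pcl [l]) = f' (pcl [l])"
      using assms(3)[OF p] pcl_neg[OF p] p by (cases e) (simp_all add: l)
    moreover have "pcl [l] \<in> carrier A" using p by (simp add: l)
    ultimately show ?case using Cons pcl_Cons[of l w] by simp
  qed (simp add: pcl_Nil)
  then show ?thesis using assms(4) by (auto simp: A_eq presented_group_carrier)
qed

lemma T_comp:
  assumes p: "\<pi> permutes {1..n}" "\<tau> permutes {1..n}" and g: "g \<in> carrier A"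
  shows "T \<pi> (T \<tau> g) = T (\<pi> \<circ> \<tau>) g"
proof -
  note pt = permutes_compose[OF p(2,1)]
  have "(T \<pi> \<circ> T \<tau>) g = T (\<pi> \<circ> \<tau>) g"
  proof (rule hom_ext[OF _ T_hom[OF pt] _ g])
    show "T \<pi> \<circ> T \<tau> \<in> hom A A" using T_hom[OF p(2)] T_hom[OF p(1)] by (simp add: hom_def Pi_iff)
    fix q assume q: "q \<in> pairs n"
    then obtain i j where ij: "q = (i, j)" "i \<in> {1..n}" "j \<in> {1..n}" "i \<noteq> j" "i < j" by (auto simp: pairs_def)
    have "\<gamma> q = gen i j" using ij by (simp add: gen_def)
    moreover have "\<tau> i \<in> {1..n}" "\<tau> j \<in> {1..n}" "\<tau> i \<noteq> \<tau> j"
      using ij permutes_in_image[OF p(2)] permutes_inj[OF p(2)] by (auto dest: injD)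
    ultimately show "(T \<pi> \<circ> T \<tau>) (\<gamma> q) = T (\<pi> \<circ> \<tau>) (\<gamma> q)"
      using T_gen[OF p(2)] T_gen[OF p(1)] T_gen[OF pt] ij by simp
  qed
  then show ?thesis by simp
qed

lemma T_id: assumes g: "g \<in> carrier A" shows "T id g = g"
proof -
  have p: "id permutes {1..n}" by (rule permutes_id)
  have "T id g = id g"
  proof (rule hom_ext[OF T_hom[OF p] _ _ g])
    show "id \<in> hom A A" by (auto simp: hom_def)
    fix q assume q: "q \<in> pairs n"
    then obtain i j where ij: "q = (i, j)" "i \<in> {1..n}" "j \<in> {1..n}" "i \<noteq> j" "i < j" by (auto simp: pairs_def)
    have "\<gamma> q = gen i j" using ij by (simp add: gen_def)
    then show "T id (\<gamma> q) = id (\<gamma> q)" using T_gen[OF p] ij by simp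
  qed
  then show ?thesis by simp
qed

text \<open>The virtual twin group acts on \<open>A\<close> by affine bijections: \<open>\<rho>\<^sub>i\<close> permutes the indices and
  \<open>s\<^sub>i\<close> composes this with left translation by the generator \<open>(i, i + 1)\<close>.\<close>

definition aff :: "(nat \<times> nat) gword set \<Rightarrow> (nat \<Rightarrow> nat) \<Rightarrow> (nat \<times> nat) gword set \<Rightarrow> (nat \<times> nat) gword set"
  where "aff g \<pi> = (\<lambda>y\<in>carrier A. g \<otimes> T \<pi> y)"

abbreviation B where "B \<equiv> BijGroup (carrier A)"

text \<open>This is multiplication in the semidirect product of \<open>A\<close> with the symmetric
  group.\<close>

lemma aff_compose:
  assumes "g \<in> carrier A" "h \<in> carrier A" "\<pi> permutes {1..n}" "\<tau> permutes {1..n}"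
  shows "compose (carrier A) (aff g \<pi>) (aff h \<tau>) = aff (g \<otimes> T \<pi> h) (\<pi> \<circ> \<tau>)"
  using assms permutes_compose[OF assms(4,3)]
  by (simp add: compose_def aff_def fun_eq_iff T_in T_mult T_comp m_assoc)

lemma aff_one: "aff \<one> id = (\<lambda>y\<in>carrier A. y)"
  by (auto simp: aff_def fun_eq_iff T_id)

lemmas aff_one' = aff_one[unfolded id_def]

lemma aff_in:
  assumes g: "g \<in> carrier A" and p: "\<pi> permutes {1..n}"
  shows "aff g \<pi> \<in> carrier B"
proof -
  let ?q = "inv_into UNIV \<pi>"
  let ?h = "T ?q (inv g)"
  have q: "?q permutes {1..n}" by (rule permutes_inv[OF p])
  have pq: "\<pi> \<circ> ?q = id" "?q \<circ> \<pi> = id" using permutes_inv_o[OF p] by simp_all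
  have h: "?h \<in> carrier A" using T_in[OF q] g by simp
  have "T \<pi> ?h = inv g" using T_comp[OF p q] T_id g by (simp add: pq)
  then have 1: "compose (carrier A) (aff g \<pi>) (aff ?h ?q) = (\<lambda>y\<in>carrier A. y)"
    using aff_compose[OF g h p q] g by (simp add: pq aff_one)
  have "?h \<otimes> T ?q g = T ?q (inv g \<otimes> g)" using T_mult[OF q, of "inv g" g] g by simp
  then have 2: "compose (carrier A) (aff ?h ?q) (aff g \<pi>) = (\<lambda>y\<in>carrier A. y)"
    using aff_compose[OF h g q p] g T_one[OF q] by (simp add: pq aff_one)
  have c: "aff g \<pi> y \<in> carrier A" "aff ?h ?q y \<in> carrier A" if "y \<in> carrier A" for y
    using that g h T_in[OF p] T_in[OF q] by (simp_all add: aff_def)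
  have "aff g \<pi> (aff ?h ?q y) = y" "aff ?h ?q (aff g \<pi> y) = y" if "y \<in> carrier A" for y
    using fun_cong[OF 1, of y] fun_cong[OF 2, of y] that by (simp_all add: compose_def)
  then have "bij_betw (aff g \<pi>) (carrier A) (carrier A)"
    using c by (intro bij_betw_byWitness[where f' = "aff ?h ?q"]) auto
  then show ?thesis by (simp add: BijGroup_def Bij_def aff_def)
qed

lemma B_group: "group B"
  by (rule group_BijGroup)

lemma aff_mult:
  assumes "g \<in> carrier A" "h \<in> carrier A" "\<pi> permutes {1..n}" "\<tau> permutes {1..n}"
  shows "aff g \<pi> \<otimes>\<^bsub>B\<^esub> aff h \<tau> = aff (g \<otimes> T \<pi> h) (\<pi> \<circ> \<tau>)"
  using aff_in[OF assms(1,3)] aff_in[OF assms(2,4)] aff_compose[OF assms]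
  by (simp add: BijGroup_def)

lemma one_B: "\<one>\<^bsub>B\<^esub> = aff \<one> id"
  by (simp add: BijGroup_def aff_one aff_one')

fun translation :: "vt_gen \<Rightarrow> (nat \<times> nat) gword set"
  where
    "translation (S i) = gen i (i + 1)"
  | "translation (Rho i) = \<one>"

definition act :: "vt_gen \<Rightarrow> (nat \<times> nat) gword set \<Rightarrow> (nat \<times> nat) gword set"
  where "act y = aff (translation y) (vt_transp y)"

text \<open>\<open>wp\<close> and \<open>wg\<close> are the permutation part and the translation
  part of the affine map of a word, see \<open>act_word\<close>. They reduce the relations of
  \<open>VT n\<close> to computations in the two factors.\<close>

definition wp :: "vt_gen list \<Rightarrow> nat \<Rightarrow> nat"
  where "wp ys = foldr (\<lambda>y f. vt_transp y \<circ> f) ys id"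

lemma wp_Nil: "wp [] = id"
  and wp_Cons: "wp (y # ys) = vt_transp y \<circ> wp ys"
  by (simp_all add: wp_def)

primrec wg :: "vt_gen list \<Rightarrow> (nat \<times> nat) gword set"
  where
    "wg [] = \<one>"
  | "wg (y # ys) = translation y \<otimes> T (vt_transp y) (wg ys)"

lemma vt_transp_permutes: "y \<in> vt_gens n \<Longrightarrow> vt_transp y permutes {1..n}"
  using vt_transp_in_sym_group[of n] by (auto simp: sym_group_carrier)

lemma wp_permutes: "set ys \<subseteq> vt_gens n \<Longrightarrow> wp ys permutes {1..n}"
proof (induction ys)
  case (Cons y ys)
  then have "wp ys permutes {1..n}" "vt_transp y permutes {1..n}" using vt_transp_permutes by auto
  then show ?case unfolding wp_Cons by (rule permutes_compose)
qed (unfold wp_Nil, rule permutes_id)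

lemma translation_in: "y \<in> vt_gens n \<Longrightarrow> translation y \<in> carrier A"
  by (auto simp: vt_gens_def intro!: gen_in)

lemma wg_in: "set ys \<subseteq> vt_gens n \<Longrightarrow> wg ys \<in> carrier A"
proof (induction ys)
  case (Cons y ys)
  then show ?case using T_in[OF vt_transp_permutes[of y], of "wg ys"] translation_in[of y] by simp
qed simp

lemma act_in: "act \<in> vt_gens n \<rightarrow> carrier B"
  unfolding act_def using aff_in translation_in vt_transp_permutes by blast

lemma act_word: "set ys \<subseteq> vt_gens n \<Longrightarrow> word_eval B act (pos_word ys) = aff (wg ys) (wp ys)"
proof (induction ys)
  case Nil
  have "word_eval B act (pos_word []) = \<one>\<^bsub>B\<^esub>" by (simp add: word_eval_def)
  then show ?case unfolding one_B wp_Nil id_def by simp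
next
  case (Cons y ys)
  have "word_eval B act (pos_word (y # ys)) = act y \<otimes>\<^bsub>B\<^esub> word_eval B act (pos_word ys)"
    by (simp add: word_eval_def)
  then show ?case
    using Cons aff_mult[OF translation_in[of y] wg_in[of ys] vt_transp_permutes[of y] wp_permutes[of ys]]
    unfolding wp_Cons act_def o_def by simp
qed

lemma T_transp_gen:
  assumes "i \<in> {1..<n}" "a \<in> {1..n}" "b \<in> {1..n}" "a \<noteq> b"
  shows "T (transpose i (Suc i)) (gen a b) = gen (transpose i (Suc i) a) (transpose i (Suc i) b)"
  using T_gen[OF vt_transp_permutes[of "Rho i"] assms(2-4)] assms(1) by (simp add: vt_gens_def)

lemma T_transp_one: "i \<in> {1..<n} \<Longrightarrow> T (transpose i (Suc i)) \<one> = \<one>"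
  using T_one[OF vt_transp_permutes[of "Rho i"]] by (simp add: vt_gens_def)

lemma act_rels:
  assumes "(l, r) \<in> vt_rels n"
  shows "word_eval B act l = word_eval B act r"
proof -
  have *: "word_eval B act (pos_word xs) = word_eval B act (pos_word ys)"
    if "set xs \<subseteq> vt_gens n" "set ys \<subseteq> vt_gens n" "wp xs = wp ys" "wg xs = wg ys" for xs ys
    using act_word that by simp
  let ?e = "\<lambda>xs. word_eval B act (pos_word xs)"
  have ss: "?e [S i, S i] = word_eval B act []" if i: "i \<in> {1..<n}" for i
  proof -
    \<comment> \<open>The sign convention of \<open>gen\<close> is what makes the image of
      \<open>S i\<close> an involution.\<close>
    have "gen i (Suc i) \<otimes> gen (Suc i) i = \<one>"
      using i gen_in[of i "Suc i"] by (simp flip: inv_gen[of i "Suc i"])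
    then have "?e [S i, S i] = ?e []"
      using i gen_in[of i "Suc i"] by (intro *) (simp_all add: vt_gens_def wp_Nil wp_Cons T_transp_one T_transp_gen)
    then show ?thesis by simp
  qed
  have rr: "?e [Rho i, Rho i] = word_eval B act []" if "i \<in> {1..<n}" for i
  proof -
    have "?e [Rho i, Rho i] = ?e []"
      using that by (intro *) (simp_all add: vt_gens_def wp_Nil wp_Cons T_transp_one)
    then show ?thesis by simp
  qed
  have sc: "?e [S i, S j] = ?e [S j, S i]"
    if ij: "i \<in> {1..<n}" "j \<in> {1..<n}" "\<bar>int i - int j\<bar> \<ge> 2" for i j
  proof -
    have ne: "i \<noteq> j" "i \<noteq> Suc j" "Suc i \<noteq> j" using ij(3) by auto
    then have "gen i (Suc i) \<otimes> gen j (Suc j) = gen j (Suc j) \<otimes> gen i (Suc i)" using ij by (intro gen_comm) auto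
    then show ?thesis
      using ij ne gen_in[of i "Suc i"] gen_in[of j "Suc j"]
      by (intro *) (simp_all add: vt_gens_def wp_Nil wp_Cons T_transp_one T_transp_gen transpose_def fun_eq_iff)
  qed
  have rc: "?e [Rho i, Rho j] = ?e [Rho j, Rho i]"
    if ij: "i \<in> {1..<n}" "j \<in> {1..<n}" "\<bar>int i - int j\<bar> \<ge> 2" for i j
  proof -
    have ne: "i \<noteq> j" "i \<noteq> Suc j" "Suc i \<noteq> j" using ij(3) by auto
    then show ?thesis
      using ij by (intro *) (simp_all add: vt_gens_def wp_Nil wp_Cons T_transp_one transpose_def fun_eq_iff)
  qed
  have rs: "?e [Rho i, S j] = ?e [S j, Rho i]"
    if ij: "i \<in> {1..<n}" "j \<in> {1..<n}" "\<bar>int i - int j\<bar> \<ge> 2" for i j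
  proof -
    have ne: "i \<noteq> j" "i \<noteq> Suc j" "Suc i \<noteq> j" using ij(3) by auto
    then show ?thesis
      using ij gen_in[of j "Suc j"]
      by (intro *) (simp_all add: vt_gens_def wp_Nil wp_Cons T_transp_one T_transp_gen transpose_def fun_eq_iff)
  qed
  have br: "?e [Rho i, Rho (i + 1), Rho i] = ?e [Rho (i + 1), Rho i, Rho (i + 1)]"
    if "1 \<le> i" "i + 1 < n" for i
    using that by (intro *) (simp_all add: vt_gens_def wp_Nil wp_Cons T_transp_one transpose_def fun_eq_iff)
  \<comment> \<open>Both sides have translation part \<open>gen (i + 1) (i + 2)\<close>.\<close>
  have mx: "?e [Rho i, Rho (i + 1), S i] = ?e [S (i + 1), Rho i, Rho (i + 1)]"
    if "1 \<le> i" "i + 1 < n" for i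
    using that gen_in[of i "Suc i"] gen_in[of "Suc i" "Suc (Suc i)"] gen_in[of i "Suc (Suc i)"]
    by (intro *) (simp_all add: vt_gens_def wp_Nil wp_Cons T_transp_one T_transp_gen transpose_def fun_eq_iff)
  show ?thesis
    using assms unfolding vt_rels_def
    by (elim UnE CollectE exE conjE Pair_inject) (hypsubst, (rule ss rr sc rc rs br mx; assumption))+
qed

definition \<Theta> :: "vt_gen gword set \<Rightarrow> (nat \<times> nat) gword set \<Rightarrow> (nat \<times> nat) gword set"
  where "\<Theta> = presented_lift B act"

lemma \<Theta>_hom: "\<Theta> \<in> hom (VT n) B"
  unfolding \<Theta>_def VT_def by (rule group.presented_lift_hom[OF B_group act_in act_rels])

lemma \<Theta>_class:
  "w \<in> words (vt_gens n) \<Longrightarrow> \<Theta> (word_class (vt_gens n) (vt_rels n) w) = word_eval B act w"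
  unfolding \<Theta>_def using group.presented_lift_class[OF B_group act_in] act_rels by blast

lemma wg_rho_append:
  assumes "set ks \<subseteq> {1..<n}" "set ys \<subseteq> vt_gens n"
  shows "wg (map Rho ks @ ys) = T (wp (map Rho ks)) (wg ys)"
  using assms(1)
proof (induction ks)
  case Nil
  show ?case using T_id[OF wg_in[OF assms(2)]] unfolding list.map append_Nil wp_Nil id_def by simp
next
  case (Cons k ks)
  have k: "vt_transp (Rho k) permutes {1..n}" using Cons.prems by (intro vt_transp_permutes) (auto simp: vt_gens_def)
  have ks: "wp (map Rho ks) permutes {1..n}" using Cons.prems by (intro wp_permutes) (auto simp: vt_gens_def)
  show ?case
    using Cons T_comp[OF k ks wg_in[OF assms(2)]] T_in[OF k T_in[OF ks wg_in[OF assms(2)]]]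
    unfolding list.map wp_Cons o_def by simp
qed

lemma wg_rho: "set ks \<subseteq> {1..<n} \<Longrightarrow> wg (map Rho ks) = \<one>"
  using wg_rho_append[of ks "[]"] T_one[OF wp_permutes, of "map Rho ks"] by (force simp: vt_gens_def)

lemma wp_fix: "(\<And>k. k \<in> set ks \<Longrightarrow> i < k) \<Longrightarrow> wp (map Rho ks) i = i"
proof (induction ks)
  case (Cons k ks)
  have "i < k" using Cons.prems by simp
  moreover have "wp (map Rho ks) i = i" using Cons by simp
  ultimately show ?case unfolding list.map wp_Cons by (simp add: transpose_def)
qed (simp add: wp_Nil)

lemma wp_descending: "p \<le> k \<Longrightarrow> wp (map Rho (rev [p..<k])) p = k"
proof (induction k rule: dec_induct)
  case (step k)
  then have "wp (map Rho (k # rev [p..<k])) p = Suc k" unfolding list.map wp_Cons by simp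
  then show ?case using step by simp
qed (simp add: wp_Nil)

text \<open>The left \<rho>-letters carry \<open>gen i (i + 1)\<close> to \<open>gen i j\<close>,
  and the right ones undo their permutation without adding a translation.\<close>

lemma \<Theta>_lam:
  assumes ij: "1 \<le> i" "i < j" "j \<le> n"
  shows "\<Theta> (lam n i j) = aff (\<gamma> (i, j)) id"
proof -
  let ?u = "[i + 1..<j]"
  let ?w = "map Rho (rev ?u) @ [S i, Rho i] @ map Rho ?u"
  have u: "set ?u \<subseteq> {1..<n}" using ij by auto
  have w: "set ?w \<subseteq> vt_gens n" using ij by (auto simp: vt_gens_def)
  have tp: "vt_transp (Rho i) permutes {1..n}" using ij by (intro vt_transp_permutes) (auto simp: vt_gens_def)
  have "wg ([S i, Rho i] @ map Rho ?u) = gen i (i + 1)"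
    using wg_rho[OF u] T_one[OF tp] gen_in[of i "i + 1"] ij by simp
  then have "wg ?w = T (wp (map Rho (rev ?u))) (gen i (i + 1))"
    using wg_rho_append[of "rev ?u" "[S i, Rho i] @ map Rho ?u"] u w by simp
  also have "\<dots> = gen (wp (map Rho (rev ?u)) i) (wp (map Rho (rev ?u)) (i + 1))"
    using ij u by (intro T_gen wp_permutes) (auto simp: vt_gens_def)
  also have "wp (map Rho (rev ?u)) i = i" by (rule wp_fix) auto
  also have "wp (map Rho (rev ?u)) (i + 1) = j" using wp_descending[of "i + 1" j] ij by simp
  finally have g: "wg ?w = \<gamma> (i, j)" using ij by (simp add: gen_def)
  have ev: "word_eval (sym_group n) vt_transp (pos_word ys) = wp ys" for ys
  proof (induction ys)
    case (Cons y ys)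
    then show ?case unfolding wp_Cons by (simp add: word_eval_def sym_group_mult)
  qed (simp add: word_eval_def sym_group_one wp_Nil)
  have "wp ?w = id" using word_eval_conj_rho[of n ?u i] ev[of ?w] by (simp only: )
  moreover have "pos_word ?w \<in> words (vt_gens n)" using w by (auto simp: words_iff)
  then have "\<Theta> (lam n i j) = word_eval B act (pos_word ?w)"
    unfolding lam_def by (rule \<Theta>_class)
  ultimately show ?thesis using act_word[OF w] g by simp
qed

lemma \<Theta>_word:
  assumes "w \<in> words (pairs n)"
  shows "\<Theta> (word_eval (VT n) (lamp n) w) = aff (pcl w) id"
proof -
  interpret vt: virtual_twin n "VT n"
    unfolding virtual_twin_def virtual_twin_axioms_def using group_VT by simp
  interpret h: group_hom "VT n" B \<Theta>
    unfolding group_hom_def group_hom_axioms_def using group_VT B_group \<Theta>_hom by blast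
  note i = permutes_id
  show ?thesis
    using assms
  proof (induction w)
    case Nil
    have "word_eval (VT n) (lamp n) [] = \<one>\<^bsub>VT n\<^esub>" by (simp add: word_eval_def)
    then show ?case using h.hom_one by (simp only: one_B pcl_Nil)
  next
    case (Cons l w)
    obtain a b e where l: "l = ((a, b), e)" by (metis prod.exhaust)
    have ab: "1 \<le> a" "a < b" "b \<le> n" "(a, b) \<in> pairs n" and w: "w \<in> words (pairs n)"
      using Cons.prems l by (auto simp: pairs_iff)
    have g: "\<gamma> (a, b) \<in> carrier A" "pcl w \<in> carrier A" using ab w by simp_all
    have L: "lam n a b \<in> carrier (VT n)" using ab by simp
    have inv_aff: "inv\<^bsub>B\<^esub> (aff (\<gamma> (a, b)) id) = aff (inv (\<gamma> (a, b))) id"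
      using aff_mult[of "inv (\<gamma> (a, b))" "\<gamma> (a, b)" id id] g aff_in i
      by (intro group.inv_equality[OF B_group]) (simp_all add: T_id one_B)
    have "\<Theta> (if e then lam n a b else inv\<^bsub>VT n\<^esub> lam n a b) = aff (pcl [l]) id"
      using \<Theta>_lam[OF ab(1-3)] inv_aff pcl_neg[OF ab(4)] L by (cases e) (simp_all add: l)
    moreover have "(if e then lam n a b else inv\<^bsub>VT n\<^esub> lam n a b) \<in> carrier (VT n)" using L by simp
    moreover have "vt.evl (l # w) = (if e then lam n a b else inv\<^bsub>VT n\<^esub> lam n a b) \<otimes>\<^bsub>VT n\<^esub> vt.evl w"
      by (simp add: vt.evl_Cons l)
    ultimately have "\<Theta> (vt.evl (l # w)) = aff (pcl [l]) id \<otimes>\<^bsub>B\<^esub> aff (pcl w) id"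
      using vt.evl_in[OF w] h.hom_mult unfolding Cons.IH[OF w, symmetric] by simp
    also have "\<dots> = aff (pcl (l # w)) id"
      using aff_mult[of "pcl [l]" "pcl w" id id] pcl_Cons[of l w] ab w l i by (simp add: T_id)
    finally show ?case .
  qed
qed

text \<open>The map \<open>aff (pcl w) id\<close> sends \<one> to \<open>pcl w\<close>, so the
  action determines the class of the word.\<close>

lemma pure_faithful:
  assumes "w \<in> words (pairs n)" "word_eval (VT n) (lamp n) w = \<one>\<^bsub>VT n\<^esub>"
  shows "word_eq (pairs n) (comm_rels (pairs n) disjoint_pairs) w []"
proof -
  interpret h: group_hom "VT n" B \<Theta>
    unfolding group_hom_def group_hom_axioms_def using group_VT B_group \<Theta>_hom by blast
  have "aff (pcl w) id = aff \<one> id" using \<Theta>_word[OF assms(1)] assms(2) h.hom_one one_B by simp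
  from fun_cong[OF this, of \<one>] have "pcl w = pcl []"
    using assms(1) T_id pcl_Nil by (simp add: aff_def)
  then show ?thesis using assms(1) by (subst (asm) word_class_eq_iff) simp_all
qed

end

context raag
begin

section \<open>Automorphisms with prescribed values on the generators\<close>

lemma hom_extend:
  assumes f: "f \<in> V \<rightarrow> carrier G"
    and c: "\<And>a b. a \<in> V \<Longrightarrow> b \<in> V \<Longrightarrow> adj a b \<Longrightarrow> f a \<otimes> f b = f b \<otimes> f a"
  obtains F where "F \<in> hom G G" "\<And>v. v \<in> V \<Longrightarrow> F (x v) = f v"
proof -
  let ?F = "\<lambda>g. word_eval G f (word_of g)"
  have R: "word_eval G f l = word_eval G f r" if "(l, r) \<in> comm_rels V adj" for l r
    using that c funcset_mem[OF f] by (auto simp: comm_rels_def word_eval_def)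
  have F: "?F (ev w) = word_eval G f w" if w: "w \<in> words V" for w
  proof -
    have "word_eq V (comm_rels V adj) (word_of (ev w)) w"
      using word_eq_iff[of "word_of (ev w)" w] word_of[of "ev w"] w by simp
    then show ?thesis using word_eval_word_eq[OF f, of "comm_rels V adj"] R by blast
  qed
  have "?F \<in> hom G G"
  proof (rule homI)
    fix g h assume gh: "g \<in> carrier G" "h \<in> carrier G"
    show "?F g \<in> carrier G" using word_eval_closed[OF f] word_of gh by blast
    have "?F (g \<otimes> h) = ?F (ev (word_of g @ word_of h))"
      using word_of[OF gh(1)] word_of[OF gh(2)] by (simp add: ev_append)
    also have "\<dots> = word_eval G f (word_of g @ word_of h)"
      using word_of[OF gh(1)] word_of[OF gh(2)] by (intro F) simp
    also have "\<dots> = ?F g \<otimes> ?F h"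
      using word_of[OF gh(1)] word_of[OF gh(2)] by (intro word_eval_append[OF f]) simp_all
    finally show "?F (g \<otimes> h) = ?F g \<otimes> ?F h" .
  qed
  moreover have "?F (x v) = f v" if "v \<in> V" for v
    using F[of "[(v, True)]"] that funcset_mem[OF f that] by (simp add: val_def word_eval_def)
  ultimately show ?thesis using that by blast
qed

lemma hom_agree:
  assumes "F \<in> hom G G" "F' \<in> hom G G" "\<And>v. v \<in> V \<Longrightarrow> F (x v) = F' (x v)" "g \<in> carrier G"
  shows "F g = F' g"
proof -
  interpret F: group_hom G G F by unfold_locales (rule assms)
  interpret F': group_hom G G F' by unfold_locales (rule assms)
  show ?thesis
    using assms(4)
  proof (induction rule: letters_induct)
    case (step h l)
    then show ?case using assms(3)[OF step(2)] by (simp add: val_def)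
  qed simp
qed

lemma hom_val: "F \<in> hom G G \<Longrightarrow> v \<in> V \<Longrightarrow> F (val (v, e)) = (if e then F (x v) else inv (F (x v)))"
  using group_hom.hom_inv[of G G F "x v"] is_group by (simp add: val_def group_hom_def group_hom_axioms_def)

lemma auto_hom: "F \<in> auto G \<Longrightarrow> F \<in> hom G G"
  by (simp add: auto_def)

lemma auto_eqI:
  assumes "F \<in> auto G" "F' \<in> auto G" "\<And>v. v \<in> V \<Longrightarrow> F (x v) = F' (x v)"
  shows "F = F'"
proof
  fix g
  show "F g = F' g"
  proof (cases "g \<in> carrier G")
    case True
    then show ?thesis using hom_agree[OF auto_hom auto_hom] assms by blast
  next
    case False
    then show ?thesis using assms by (auto simp: auto_def Bij_def extensional_def)
  qed
qed

lemma signed_permutation_auto: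
  assumes s: "bij_betw \<sigma> V V" and adj: "\<And>u v. u \<in> V \<Longrightarrow> v \<in> V \<Longrightarrow> adj (\<sigma> u) (\<sigma> v) \<longleftrightarrow> adj u v"
  obtains F where "F \<in> auto G" "\<And>v. v \<in> V \<Longrightarrow> F (x v) = val (\<sigma> v, e v)"
proof -
  have ext: "\<exists>F. F \<in> hom G G \<and> (\<forall>v\<in>V. F (x v) = val (\<sigma> v, e v))"
    if s: "bij_betw \<sigma> V V" and adj: "\<And>u v. u \<in> V \<Longrightarrow> v \<in> V \<Longrightarrow> adj (\<sigma> u) (\<sigma> v) \<longleftrightarrow> adj u v" for \<sigma> e
  proof -
    have sV: "\<sigma> v \<in> V" if "v \<in> V" for v using s that by (rule bij_betwE[THEN bspec])
    have "(\<lambda>v. val (\<sigma> v, e v)) \<in> V \<rightarrow> carrier G" using sV by simp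
    then show ?thesis by (rule hom_extend) (use sV adj in \<open>auto intro!: val_comm\<close>)
  qed
  let ?t = "inv_into V \<sigma>"
  have t: "bij_betw ?t V V" using bij_betw_inv_into[OF s] .
  have sV: "\<sigma> v \<in> V" "?t v \<in> V" "?t (\<sigma> v) = v" "\<sigma> (?t v) = v" if "v \<in> V" for v
    using that s bij_betwE[OF s] bij_betwE[OF t] bij_betw_inv_into_left[OF s] bij_betw_inv_into_right[OF s] by blast+
  have tadj: "adj (?t u) (?t v) \<longleftrightarrow> adj u v" if "u \<in> V" "v \<in> V" for u v
    using adj[of "?t u" "?t v"] sV that by simp
  obtain F where F: "F \<in> hom G G" "\<And>v. v \<in> V \<Longrightarrow> F (x v) = val (\<sigma> v, e v)" using ext[OF s adj] by blast
  \<comment> \<open>The inverse uses the inverse permutation, with the sign taken at the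
    preimage.\<close>
  obtain F' where F': "F' \<in> hom G G" "\<And>v. v \<in> V \<Longrightarrow> F' (x v) = val (?t v, e (?t v))"
    using ext[OF t tadj, of "\<lambda>v. e (?t v)"] by blast
  have comp: "H \<circ> H' \<in> hom G G" if "H \<in> hom G G" "H' \<in> hom G G" for H H'
    using that by (simp add: hom_def Pi_iff)
  have id: "id \<in> hom G G" by (simp add: hom_def)
  have FF: "(F' \<circ> F) (x v) = id (x v)" "(F \<circ> F') (x v) = id (x v)" if v: "v \<in> V" for v
    using F(2) F'(2) hom_val[OF F(1)] hom_val[OF F'(1)] sV[OF v] v by (auto simp: val_def)
  have 1: "F' (F g) = g" "F (F' g) = g" if "g \<in> carrier G" for g
    using hom_agree[OF comp[OF F'(1) F(1)] id FF(1) that] hom_agree[OF comp[OF F(1) F'(1)] id FF(2) that] by simp_all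
  have Fc: "F g \<in> carrier G" "F' g \<in> carrier G" if "g \<in> carrier G" for g
    using F(1) F'(1) that by (auto simp: hom_def)
  have bij: "bij_betw F (carrier G) (carrier G)"
    using 1 Fc by (intro bij_betw_byWitness[where f' = F']) auto
  \<comment> \<open>Members of \<open>auto\<close> are extensional, so the values off the carrier
    are reset.\<close>
  let ?R = "restrict F (carrier G)"
  have "?R \<in> hom G G" using F(1) by (simp add: hom_def Pi_iff)
  moreover have "bij_betw ?R (carrier G) (carrier G)" by (rule bij_betw_cong[THEN iffD1, OF _ bij]) simp
  ultimately have "?R \<in> auto G" by (simp add: auto_def Bij_def)
  moreover have "?R (x v) = val (\<sigma> v, e v)" if "v \<in> V" for v using F(2)[OF that] that by simp
  ultimately show ?thesis using that by blast
qed

lemma inner_auto: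
  assumes g: "g \<in> carrier G"
  shows "(\<lambda>y\<in>carrier G. g \<otimes> y \<otimes> inv g) \<in> auto G"
proof -
  have "bij_betw (\<lambda>y\<in>carrier G. g \<otimes> y \<otimes> inv g) (carrier G) (carrier G)"
    using g by (intro bij_betw_byWitness[where f' = "\<lambda>y. inv g \<otimes> y \<otimes> g"]) (auto simp: m_assoc)
  moreover have "(\<lambda>y\<in>carrier G. g \<otimes> y \<otimes> inv g) \<in> hom G G"
    using g by (auto simp: hom_def m_assoc)
  ultimately show ?thesis by (simp add: auto_def Bij_def)
qed

end

context rigid_raag
begin

definition graph_autos :: "('a \<Rightarrow> 'a) set"
  where "graph_autos = {F \<in> auto G. \<exists>\<sigma>. bij_betw \<sigma> V V \<and>
    (\<forall>u\<in>V. \<forall>v\<in>V. adj (\<sigma> u) (\<sigma> v) \<longleftrightarrow> adj u v) \<and> (\<forall>v\<in>V. F (x v) = x (\<sigma> v))}"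

definition inversions :: "('a \<Rightarrow> 'a) set"
  where "inversions = {F \<in> auto G. \<exists>u\<in>V. F (x u) = inv (x u) \<and> (\<forall>v\<in>V - {u}. F (x v) = x v)}"

lemma AutoGroup_mult:
  assumes "f \<in> auto G" "h \<in> auto G"
  shows "f \<otimes>\<^bsub>AutoGroup G\<^esub> h \<in> auto G" "y \<in> carrier G \<Longrightarrow> (f \<otimes>\<^bsub>AutoGroup G\<^esub> h) y = f (h y)"
  using group.is_monoid[OF AutoGroup, THEN monoid.m_closed, of f h] assms
  by (simp_all add: AutoGroup_def BijGroup_def auto_def compose_def)

lemma inversions_generate:
  assumes "finite U" "U \<subseteq> V"
  shows "\<exists>F\<in>generate (AutoGroup G) inversions. \<forall>v\<in>V. F (x v) = val (v, v \<notin> U)"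
  using assms
proof (induction U rule: finite_induct)
  case empty
  have "\<one>\<^bsub>AutoGroup G\<^esub> (x v) = val (v, True)" if "v \<in> V" for v
    using that by (simp add: AutoGroup_def BijGroup_def val_def)
  then show ?case using generate.one[of "AutoGroup G" inversions] by (intro bexI) auto
next
  case (insert u U)
  then obtain F where F: "F \<in> generate (AutoGroup G) inversions" "\<And>v. v \<in> V \<Longrightarrow> F (x v) = val (v, v \<notin> U)"
    by auto
  have u: "u \<in> V" using insert.prems by simp
  obtain K where K: "K \<in> auto G" "\<And>v. v \<in> V \<Longrightarrow> K (x v) = val (id v, v \<noteq> u)"
    using signed_permutation_auto[of id "\<lambda>v. v \<noteq> u"] by (metis bij_betw_id id_apply)
  have "K \<in> inversions" unfolding inversions_def using K u by (auto simp: val_def)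
  then have "K \<otimes>\<^bsub>AutoGroup G\<^esub> F \<in> generate (AutoGroup G) inversions"
    using F(1) by (intro generate.eng[OF generate.incl])
  moreover have "(K \<otimes>\<^bsub>AutoGroup G\<^esub> F) (x v) = val (v, v \<notin> insert u U)" if v: "v \<in> V" for v
  proof -
    have "generate (AutoGroup G) inversions \<subseteq> carrier (AutoGroup G)"
      by (rule group.generate_incl[OF AutoGroup]) (auto simp: inversions_def AutoGroup_def)
    then have "F \<in> auto G" using F(1) by (auto simp: AutoGroup_def)
    then have "(K \<otimes>\<^bsub>AutoGroup G\<^esub> F) (x v) = K (val (v, v \<notin> U))"
      using AutoGroup_mult(2)[OF K(1)] F(2)[OF v] v by simp
    also have "\<dots> = (if v \<notin> U then K (x v) else inv (K (x v)))" by (rule hom_val[OF auto_hom[OF K(1)] v])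
    also have "\<dots> = val (v, v \<notin> insert u U)"
      using K(2)[OF v] insert.hyps x_in[OF v] by (cases "v = u"; cases "v \<in> U") (simp_all add: val_def)
    finally show ?thesis .
  qed
  ultimately show ?case by blast
qed

theorem auto_generated: "auto G \<subseteq> generate (AutoGroup G) (graph_autos \<union> inversions \<union> Inn G)"
proof
  interpret A: group "AutoGroup G" by (rule AutoGroup)
  have cA: "carrier (AutoGroup G) = auto G" by (simp add: AutoGroup_def)
  fix F assume F: "F \<in> auto G"
  let ?F' = "inv\<^bsub>AutoGroup G\<^esub> F"
  have F': "?F' \<in> auto G" using A.inv_closed[of F] F cA by simp
  have "?F' (F y) = y" if "y \<in> carrier G" for y
    using AutoGroup_mult(2)[OF F' F that] A.l_inv[of F] F cA that
    by (simp add: AutoGroup_def BijGroup_def)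
  then obtain \<sigma> e g where g: "g \<in> carrier G" and s: "bij_betw \<sigma> V V"
    and adj: "\<And>u v. u \<in> V \<Longrightarrow> v \<in> V \<Longrightarrow> adj (\<sigma> u) (\<sigma> v) \<longleftrightarrow> adj u v"
    and form: "\<And>v. v \<in> V \<Longrightarrow> F (x v) = g \<otimes> val (\<sigma> v, e v) \<otimes> inv g"
    using automorphism_form[OF auto_hom[OF F] auto_hom[OF F']] by metis
  have sV: "\<sigma> v \<in> V" if "v \<in> V" for v using bij_betwE[OF s] that by blast
  obtain \<alpha> where a: "\<alpha> \<in> auto G" "\<And>v. v \<in> V \<Longrightarrow> \<alpha> (x v) = val (\<sigma> v, True)"
    using signed_permutation_auto[OF s adj, of "\<lambda>_. True"] by metis
  have ax: "\<alpha> (x v) = x (\<sigma> v)" if "v \<in> V" for v using a(2)[OF that] by (simp add: val_def)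
  have aG: "\<alpha> \<in> graph_autos" unfolding graph_autos_def using a(1) s adj ax by blast
  \<comment> \<open>The inversions act before the graph automorphism, so the sign \<open>e v\<close>
    belongs to \<open>v\<close> and not to \<open>\<sigma> v\<close>.\<close>
  obtain \<iota> where i: "\<iota> \<in> generate (AutoGroup G) inversions" "\<And>v. v \<in> V \<Longrightarrow> \<iota> (x v) = val (v, e v)"
    using inversions_generate[of "{v \<in> V. \<not> e v}"] finite_V by auto
  let ?S = "graph_autos \<union> inversions \<union> Inn G"
  have SA: "?S \<subseteq> carrier (AutoGroup G)"
    unfolding cA using inner_auto by (auto simp: graph_autos_def inversions_def Inn_def)
  have iS: "\<iota> \<in> generate (AutoGroup G) ?S" using i(1) A.mono_generate[of inversions ?S] by blast
  then have i': "\<iota> \<in> auto G" using A.generate_incl[OF SA] cA by blast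
  define \<beta> where "\<beta> = (\<lambda>y\<in>carrier G. g \<otimes> y \<otimes> inv g)"
  have b: "\<beta> \<in> Inn G" "\<beta> \<in> auto G" unfolding \<beta>_def Inn_def using g inner_auto[OF g] by auto
  note ai = AutoGroup_mult(1)[OF a(1) i']
  have "F = \<beta> \<otimes>\<^bsub>AutoGroup G\<^esub> (\<alpha> \<otimes>\<^bsub>AutoGroup G\<^esub> \<iota>)"
  proof (rule auto_eqI[OF F AutoGroup_mult(1)[OF b(2) ai]])
    fix v assume v: "v \<in> V"
    have "(\<alpha> \<otimes>\<^bsub>AutoGroup G\<^esub> \<iota>) (x v) = \<alpha> (val (v, e v))" using AutoGroup_mult(2)[OF a(1) i'] i(2)[OF v] v by simp
    also have "\<dots> = (if e v then \<alpha> (x v) else inv (\<alpha> (x v)))" by (rule hom_val[OF auto_hom[OF a(1)] v])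
    also have "\<dots> = val (\<sigma> v, e v)" using ax[OF v] by (simp add: val_def)
    finally show "F (x v) = (\<beta> \<otimes>\<^bsub>AutoGroup G\<^esub> (\<alpha> \<otimes>\<^bsub>AutoGroup G\<^esub> \<iota>)) (x v)"
      using AutoGroup_mult(2)[OF b(2) ai] v form[OF v] sV[OF v] by (simp add: \<beta>_def)
  qed
  moreover have "\<beta> \<in> generate (AutoGroup G) ?S" "\<alpha> \<in> generate (AutoGroup G) ?S"
    using aG b(1) by (auto intro: generate.incl)
  ultimately show "F \<in> generate (AutoGroup G) ?S" using iS by (auto intro: generate.eng)
qed

end

section \<open>Disjointness of pairs\<close>

abbreviation supp :: "nat \<times> nat \<Rightarrow> nat set"
  where "supp p \<equiv> {fst p, snd p}"

definition mk :: "nat \<Rightarrow> nat \<Rightarrow> nat \<times> nat"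
  where "mk i j = (min i j, max i j)"

lemma supp_mk [simp]: "supp (mk i j) = {i, j}"
  by (auto simp: mk_def min_def max_def)

lemma mk_pairs: "i \<in> {1..n} \<Longrightarrow> j \<in> {1..n} \<Longrightarrow> i \<noteq> j \<Longrightarrow> mk i j \<in> pairs n"
  by (auto simp: mk_def pairs_iff min_def max_def)

lemma supp_pairs: "p \<in> pairs n \<Longrightarrow> supp p \<subseteq> {1..n}" "p \<in> pairs n \<Longrightarrow> fst p \<noteq> snd p"
  by (auto simp: pairs_def)

lemma supp_inj: "p \<in> pairs n \<Longrightarrow> q \<in> pairs n \<Longrightarrow> supp p = supp q \<Longrightarrow> p = q"
  by (cases p; cases q) (auto simp: pairs_iff doubleton_eq_iff)

lemma disjoint_pairs_supp: "disjoint_pairs p q \<longleftrightarrow> supp p \<inter> supp q = {}"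
  by (simp add: disjoint_pairs_def)

lemma finite_pairs: "finite (pairs n)"
  by (rule finite_subset[of _ "{1..n} \<times> {1..n}"]) (auto simp: pairs_def)

text \<open>A pair is determined by its support, here any 2-subset of the remaining
  \<open>n - 2\<close> indices.\<close>

lemma card_disj:
  assumes "p \<in> pairs n"
  shows "card {q \<in> pairs n. disjoint_pairs p q} = (n - 2) choose 2"
proof -
  let ?A = "{1..n} - supp p"
  have "bij_betw supp {q \<in> pairs n. disjoint_pairs p q} {B. B \<subseteq> ?A \<and> card B = 2}"
  proof (rule bij_betw_imageI)
    show "inj_on supp {q \<in> pairs n. disjoint_pairs p q}" using supp_inj by (auto intro!: inj_onI)
    have "B \<in> supp ` {q \<in> pairs n. disjoint_pairs p q}" if B: "B \<subseteq> ?A" "card B = 2" for B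
    proof -
      obtain i j where ij: "B = {i, j}" "i \<noteq> j" using B(2) by (auto simp: card_2_iff)
      have "mk i j \<in> pairs n" using ij B(1) by (intro mk_pairs) auto
      moreover have "disjoint_pairs p (mk i j)" unfolding disjoint_pairs_supp supp_mk using ij B(1) by blast
      moreover have "B = supp (mk i j)" unfolding supp_mk by (rule ij(1))
      ultimately show ?thesis by blast
    qed
    moreover have "supp q \<subseteq> ?A \<and> card (supp q) = 2" if "q \<in> pairs n" "disjoint_pairs p q" for q
      using supp_pairs[OF that(1)] that(2) unfolding disjoint_pairs_supp by auto
    ultimately show "supp ` {q \<in> pairs n. disjoint_pairs p q} = {B. B \<subseteq> ?A \<and> card B = 2}" by blast
  qed
  then have "card {q \<in> pairs n. disjoint_pairs p q} = card {B. B \<subseteq> ?A \<and> card B = 2}" by (rule bij_betw_same_card)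
  also have "\<dots> = card ?A choose 2" by (rule n_subsets) simp
  also have "card ?A = n - 2"
    using supp_pairs[OF assms] by (subst card_Diff_subset) auto
  finally show ?thesis .
qed

lemma fresh_index:
  assumes "finite F" "card F < n"
  obtains e where "e \<in> {1..n}" "e \<notin> F"
proof -
  have "\<not> {1..n} \<subseteq> F" using card_mono[OF assms(1), of "{1..n}"] assms(2) by auto
  then show ?thesis using that by blast
qed

lemma fresh_list:
  assumes "length xs < n"
  obtains e where "e \<in> {1..n}" "e \<notin> set xs"
  using fresh_index[of "set xs" n] card_length[of xs] assms by (metis List.finite_set le_less_trans)

text \<open>Let \<open>d\<close> belong to \<open>a\<close> but not to \<open>b\<close>. A pair of
  \<open>d\<close> with an index outside \<open>b\<close> and different from \<open>d\<close> is
  disjoint from \<open>b\<close> and meets \<open>a\<close>; five indices leave two choices for the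
  second one.\<close>

lemma kneser_spread:
  assumes n: "5 \<le> n" and a: "a \<in> pairs n" and b: "b \<in> pairs n" and ne: "a \<noteq> b"
  shows "card {q \<in> pairs n. disjoint_pairs a q} + 2 \<le> card ({q \<in> pairs n. disjoint_pairs a q} \<union> {q \<in> pairs n. disjoint_pairs b q})"
proof -
  let ?N = "\<lambda>p. {q \<in> pairs n. disjoint_pairs p q}"
  obtain d where d: "d \<in> supp a" "d \<notin> supp b"
  proof -
    have "\<not> supp a \<subseteq> supp b"
    proof
      assume "supp a \<subseteq> supp b"
      then have "supp a = supp b" using supp_pairs(2)[OF a] by auto
      then show False using supp_inj[OF a b] ne by blast
    qed
    then show ?thesis using that by blast
  qed
  obtain e1 where e1: "e1 \<in> {1..n}" "e1 \<notin> set [fst b, snd b, d]" by (rule fresh_list[of "[fst b, snd b, d]" n]) (use n in auto)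
  obtain e2 where e2: "e2 \<in> {1..n}" "e2 \<notin> set [fst b, snd b, d, e1]" by (rule fresh_list[of "[fst b, snd b, d, e1]" n]) (use n in auto)
  have dn: "d \<in> {1..n}" using d(1) supp_pairs(1)[OF a] by blast
  have m: "mk d e \<in> ?N b - ?N a" if "e \<in> {1..n}" "e \<notin> {fst b, snd b, d}" for e
  proof -
    have "mk d e \<in> pairs n" using that dn by (intro mk_pairs) auto
    moreover have "disjoint_pairs b (mk d e)" unfolding disjoint_pairs_supp supp_mk using that d by auto
    moreover have "\<not> disjoint_pairs a (mk d e)" unfolding disjoint_pairs_supp supp_mk using d by blast
    ultimately show ?thesis by blast
  qed
  have m12: "mk d e1 \<in> ?N b - ?N a" "mk d e2 \<in> ?N b - ?N a" using m[of e1] m[of e2] e1 e2 by simp_all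
  have "supp (mk d e1) \<noteq> supp (mk d e2)" unfolding supp_mk using e1 e2 by (auto simp: doubleton_eq_iff)
  then have ne12: "mk d e1 \<noteq> mk d e2" by metis
  have fin: "finite (?N a)" "finite (?N b)" using finite_pairs by simp_all
  have "card (?N a) + 2 = card (?N a \<union> {mk d e1, mk d e2})"
    using m12 ne12 fin by (subst card_Un_disjoint) auto
  also have "\<dots> \<le> card (?N a \<union> ?N b)" using m12 fin by (intro card_mono) auto
  finally show ?thesis .
qed

text \<open>Disjoint pairs are both met by a pair with one index from each; otherwise a common index
  is joined to a new one, which exists because at most four are excluded.\<close>

lemma kneser_avoid:
  assumes n: "5 \<le> n" and a: "a \<in> pairs n" and b: "b \<in> pairs n"
  shows "\<exists>v\<in>pairs n. v \<noteq> a \<and> v \<noteq> b \<and> \<not> disjoint_pairs a v \<and> \<not> disjoint_pairs b v"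
proof (cases "disjoint_pairs a b")
  case True
  let ?v = "mk (fst a) (fst b)"
  have d: "supp a \<inter> supp b = {}" using True disjoint_pairs_supp by blast
  have "?v \<in> pairs n" using supp_pairs[OF a] supp_pairs[OF b] d by (intro mk_pairs) auto
  moreover have "supp ?v \<noteq> supp a" "supp ?v \<noteq> supp b" unfolding supp_mk using d by blast+
  moreover have "\<not> disjoint_pairs a ?v" "\<not> disjoint_pairs b ?v" unfolding disjoint_pairs_supp supp_mk by blast+
  ultimately show ?thesis by metis
next
  case False
  then obtain s where s: "s \<in> supp a" "s \<in> supp b" using disjoint_pairs_supp by blast
  obtain e where e: "e \<in> {1..n}" "e \<notin> set [fst a, snd a, fst b, snd b]"
    by (rule fresh_list[of "[fst a, snd a, fst b, snd b]" n]) (use n in auto)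
  let ?v = "mk s e"
  have e': "e \<notin> supp a" "e \<notin> supp b" using e by simp_all
  have "?v \<in> pairs n" using supp_pairs(1)[OF a] s e e' by (intro mk_pairs) auto
  moreover have "supp ?v \<noteq> supp a" "supp ?v \<noteq> supp b" unfolding supp_mk using e' by blast+
  moreover have "\<not> disjoint_pairs a ?v" "\<not> disjoint_pairs b ?v" unfolding disjoint_pairs_supp supp_mk using s by blast+
  ultimately show ?thesis by metis
qed

text \<open>The vertices outside the star of \<open>a\<close> are the pairs of one index in
  \<open>a\<close> and one of the \<open>n - 2\<close> outside it, adjacent iff both indices differ.
  This is the bipartite double of a complete graph, connected because n - 2 \<ge> 3.\<close>

lemma kneser_connected:
  assumes n: "5 \<le> n" and a: "a \<in> pairs n"
    and u: "u \<in> pairs n" "u \<noteq> a" "\<not> disjoint_pairs a u" and v: "v \<in> pairs n" "v \<noteq> a" "\<not> disjoint_pairs a v"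
  shows "(u, v) \<in> {(u, v). (u \<in> pairs n \<and> u \<noteq> a \<and> \<not> disjoint_pairs a u) \<and> (v \<in> pairs n \<and> v \<noteq> a \<and> \<not> disjoint_pairs a v) \<and> disjoint_pairs u v}\<^sup>*"
    (is "_ \<in> ?E\<^sup>*")
proof -
  have form: "\<exists>y e. y \<in> supp a \<and> e \<in> {1..n} \<and> e \<notin> supp a \<and> w = mk y e"
    if w: "w \<in> pairs n" "w \<noteq> a" "\<not> disjoint_pairs a w" for w
  proof -
    obtain y where y: "y \<in> supp a" "y \<in> supp w" using w(3) disjoint_pairs_supp by blast
    have "\<not> supp w \<subseteq> supp a"
    proof
      assume "supp w \<subseteq> supp a"
      then have "supp w = supp a" using supp_pairs(2)[OF w(1)] by auto
      then show False using supp_inj[OF w(1) a] w(2) by blast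
    qed
    then obtain e where e: "e \<in> supp w" "e \<notin> supp a" by blast
    then have "supp w = {y, e}" using y by auto
    moreover have en: "e \<in> {1..n}" and yn: "y \<in> {1..n}" using e y supp_pairs(1)[OF w(1)] by auto
    moreover have "y \<noteq> e" using y e by blast
    ultimately have "w = mk y e" using supp_inj[OF w(1) mk_pairs[OF yn en]] supp_mk by metis
    then show ?thesis using y e en by blast
  qed
  have node: "mk y e \<in> pairs n \<and> mk y e \<noteq> a \<and> \<not> disjoint_pairs a (mk y e)"
    if "y \<in> supp a" "e \<in> {1..n}" "e \<notin> supp a" for y e
  proof (intro conjI)
    show "mk y e \<in> pairs n" using that supp_pairs(1)[OF a] by (intro mk_pairs) auto
    have "e \<in> supp (mk y e)" unfolding supp_mk by simp
    then show "mk y e \<noteq> a" using that(3) by metis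
    show "\<not> disjoint_pairs a (mk y e)" unfolding disjoint_pairs_supp supp_mk using that(1) by blast
  qed
  have edge: "(mk y e, mk z f) \<in> ?E"
    if "y \<in> supp a" "e \<in> {1..n}" "e \<notin> supp a" "z \<in> supp a" "f \<in> {1..n}" "f \<notin> supp a" "y \<noteq> z" "e \<noteq> f" for y e z f
  proof -
    have "disjoint_pairs (mk y e) (mk z f)" unfolding disjoint_pairs_supp supp_mk using that by auto
    then show ?thesis using node[of y e] node[of z f] that by simp
  qed
  obtain y e where y: "y \<in> supp a" "e \<in> {1..n}" "e \<notin> supp a" "u = mk y e" using form[OF u] by blast
  obtain z f where z: "z \<in> supp a" "f \<in> {1..n}" "f \<notin> supp a" "v = mk z f" using form[OF v] by blast
  have same_index: "(mk y e, mk y f) \<in> ?E\<^sup>*" if y: "y \<in> supp a" "e \<in> {1..n}" "e \<notin> supp a" "f \<in> {1..n}" "f \<notin> supp a" for y e f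
  proof -
    \<comment> \<open>The detour goes through the other index of \<open>a\<close> and a third
      outside index \<open>h\<close>.\<close>
    obtain y' where y': "y' \<in> supp a" "y' \<noteq> y" using supp_pairs(2)[OF a] by auto
    obtain h where h: "h \<in> {1..n}" "h \<notin> set [fst a, snd a, e, f]"
      by (rule fresh_list[of "[fst a, snd a, e, f]" n]) (use n in auto)
    have h': "h \<notin> supp a" "e \<noteq> h" "h \<noteq> f" using h(2) by auto
    have "(mk y e, mk y' h) \<in> ?E" using y y' h(1) h' by (intro edge) simp_all
    moreover have "(mk y' h, mk y f) \<in> ?E" using y y' h(1) h' by (intro edge) simp_all
    ultimately show ?thesis by (rule r_into_rtrancl[THEN rtrancl_trans, OF _ r_into_rtrancl])
  qed
  show ?thesis
  proof (cases "y = z")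
    case True
    then show ?thesis using same_index[OF y(1-3) z(2,3)] y z by simp
  next
    case False
    obtain h where h: "h \<in> {1..n}" "h \<notin> set [fst a, snd a, e, f]"
      by (rule fresh_list[of "[fst a, snd a, e, f]" n]) (use n in auto)
    have h': "h \<notin> supp a" "e \<noteq> h" "h \<noteq> f" using h(2) by auto
    have "(mk y e, mk y h) \<in> ?E\<^sup>*" by (rule same_index[OF y(1-3) h(1) h'(1)])
    moreover have "(mk y h, mk z f) \<in> ?E" using y z False h(1) h' by (intro edge) simp_all
    ultimately show ?thesis unfolding y(4) z(4) by (rule rtrancl_into_rtrancl)
  qed
qed

section \<open>Automorphisms of the pure virtual twin group\<close>

lemma PVT_mult: "mult (PVT n) = mult (VT n)" and PVT_one: "\<one>\<^bsub>PVT n\<^esub> = \<one>\<^bsub>VT n\<^esub>"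
  by (simp_all add: PVT_def)

lemma PVT_carrier: "g \<in> carrier (PVT n) \<longleftrightarrow> g \<in> carrier (VT n) \<and> vt_perm n g = id"
  by (auto simp: PVT_def kernel_def sym_group_one)

lemma PVT_inv: "g \<in> carrier (PVT n) \<Longrightarrow> inv\<^bsub>PVT n\<^esub> g = inv\<^bsub>VT n\<^esub> g"
  unfolding PVT_def
  using group.m_inv_consistent[OF group_VT group_hom.subgroup_kernel[OF group_hom_vt_perm]] by simp

lemma lams_image: "lams n = lamp n ` pairs n"
proof (intro subset_antisym subsetI)
  fix y assume "y \<in> lams n"
  then obtain i j where "1 \<le> i" "i < j" "j \<le> n" "y = lam n i j" by (auto simp: lams_def)
  then show "y \<in> lamp n ` pairs n" by (intro image_eqI[of _ _ "(i, j)"]) (simp_all add: pairs_iff)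
next
  fix y assume "y \<in> lamp n ` pairs n"
  then obtain i j where "(i, j) \<in> pairs n" "y = lam n i j" by force
  then show "y \<in> lams n" unfolding lams_def pairs_iff by blast
qed

lemma word_eval_PVT:
  assumes "w \<in> words (pairs n)"
  shows "word_eval (PVT n) (lamp n) w = word_eval (VT n) (lamp n) w"
  using assms
proof (induction w)
  case (Cons l w)
  obtain p e where l: "l = (p, e)" by fastforce
  have "lamp n p \<in> carrier (PVT n)" using Cons.prems l lams_subset_PVT lams_image by fastforce
  then show ?case using Cons PVT_inv by (simp add: word_eval_def l PVT_mult)
qed (simp add: word_eval_def PVT_one)

lemma rigid_raag_PVT:
  assumes n: "5 \<le> n"
  shows "rigid_raag (PVT n) (lamp n) (pairs n) disjoint_pairs"
proof -
  interpret vt: virtual_twin n "VT n"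
    unfolding virtual_twin_def virtual_twin_axioms_def using group_VT by simp
  interpret sp: signed_pairs n "presented_group (pairs n) (comm_rels (pairs n) disjoint_pairs)"
    unfolding signed_pairs_def signed_pairs_axioms_def using group_presented_group by simp
  have irr: "\<not> disjoint_pairs p p" for p by (simp add: disjoint_pairs_def)
  interpret r: raag "PVT n" "lamp n" "pairs n" disjoint_pairs
  proof (unfold raag_def raag_axioms_def, intro conjI allI impI)
    show "group (PVT n)" by (rule group_PVT)
    show "lamp n \<in> pairs n \<rightarrow> carrier (PVT n)" using lams_subset_PVT lams_image by blast
    show "finite (pairs n)" by (rule finite_pairs)
    show "\<not> disjoint_pairs p p" for p by (rule irr)
    show "disjoint_pairs q p" if "disjoint_pairs p q" for p q using that by (auto simp: disjoint_pairs_def)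
  next
    fix p q assume "p \<in> pairs n" "q \<in> pairs n" "disjoint_pairs p q"
    then show "lamp n p \<otimes>\<^bsub>PVT n\<^esub> lamp n q = lamp n q \<otimes>\<^bsub>PVT n\<^esub> lamp n p"
      unfolding PVT_mult lamp_def by (intro vt.lam_comm) (auto simp: pairs_def disjoint_pairs_def)
  next
    fix g assume "g \<in> carrier (PVT n)"
    then show "\<exists>w\<in>words (pairs n). word_eval (PVT n) (lamp n) w = g"
      using vt.pure_generated[of g] word_eval_PVT by (metis PVT_carrier)
  next
    fix w assume "w \<in> words (pairs n)" "word_eval (PVT n) (lamp n) w = \<one>\<^bsub>PVT n\<^esub>"
    then show "word_eq (pairs n) (comm_rels (pairs n) disjoint_pairs) w []"
      using sp.pure_faithful word_eval_PVT by (simp add: PVT_one)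
  qed
  have st: "v \<notin> r.st a \<longleftrightarrow> v \<noteq> a \<and> \<not> disjoint_pairs a v" if "v \<in> pairs n" for a v
    using that by (auto simp: r.st_def r.lk_def)
  have st': "v \<in> pairs n - r.st a \<longleftrightarrow> v \<in> pairs n \<and> v \<noteq> a \<and> \<not> disjoint_pairs a v" for a v
    by (metis Diff_iff st)
  show ?thesis
  proof (unfold rigid_raag_def rigid_raag_axioms_def, intro conjI allI impI)
    show "raag (PVT n) (lamp n) (pairs n) disjoint_pairs" by (rule r.raag_axioms)
    fix a b assume a: "a \<in> pairs n" and b: "b \<in> pairs n"
    show "card (r.lk a) = card (r.lk b)" unfolding r.lk_def using card_disj a b by simp
    show "card (r.lk a) + 2 \<le> card (r.lk a \<union> r.lk b)" if "a \<noteq> b"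
      unfolding r.lk_def using kneser_spread[OF n a b that] .
    show "\<exists>v\<in>pairs n. v \<notin> r.st a \<and> v \<notin> r.st b"
      using kneser_avoid[OF n a b] st by metis
  next
    fix a u v assume "a \<in> pairs n" "u \<in> pairs n - r.st a" "v \<in> pairs n - r.st a"
    then show "(u, v) \<in> {(u, v). u \<in> pairs n - r.st a \<and> v \<in> pairs n - r.st a \<and> disjoint_pairs u v}\<^sup>*"
      unfolding st' by (intro kneser_connected[OF n]) auto
  qed
qed

text \<open>Edges are defined by commutation in the group, which every automorphism preserves and
  reflects; only permuting \<open>lams n\<close> is left to ask for.\<close>

lemma pvt_graph_aut_auto:
  assumes a: "\<alpha> \<in> auto (PVT n)" and im: "\<alpha> ` lams n = lams n"
  shows "pvt_graph_aut n \<alpha>"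
  unfolding pvt_graph_aut_def
proof (intro conjI ballI)
  interpret group "PVT n" by (rule group_PVT)
  have inj: "inj_on \<alpha> (carrier (PVT n))" using a by (simp add: auto_def Bij_def bij_betw_def)
  then show "bij_betw \<alpha> (lams n) (lams n)"
    using inj_on_subset[OF inj lams_subset_PVT] im by (simp add: bij_betw_def)
  fix y z assume yz: "y \<in> lams n" "z \<in> lams n"
  then have c: "y \<in> carrier (PVT n)" "z \<in> carrier (PVT n)" using lams_subset_PVT by auto
  have "\<alpha> (y \<otimes>\<^bsub>PVT n\<^esub> z) = \<alpha> y \<otimes>\<^bsub>PVT n\<^esub> \<alpha> z" "\<alpha> (z \<otimes>\<^bsub>PVT n\<^esub> y) = \<alpha> z \<otimes>\<^bsub>PVT n\<^esub> \<alpha> y"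
    using a c by (auto simp: auto_def hom_def)
  then have "\<alpha> y \<otimes>\<^bsub>PVT n\<^esub> \<alpha> z = \<alpha> z \<otimes>\<^bsub>PVT n\<^esub> \<alpha> y \<longleftrightarrow> y \<otimes>\<^bsub>PVT n\<^esub> z = z \<otimes>\<^bsub>PVT n\<^esub> y"
    using inj_on_eq_iff[OF inj, of "y \<otimes>\<^bsub>PVT n\<^esub> z" "z \<otimes>\<^bsub>PVT n\<^esub> y"] c by simp
  moreover have "\<alpha> y = \<alpha> z \<longleftrightarrow> y = z" using inj_on_eq_iff[OF inj c] .
  moreover have "\<alpha> y \<in> lams n" "\<alpha> z \<in> lams n" using im yz by blast+
  ultimately show "pvt_adj n (\<alpha> y) (\<alpha> z) \<longleftrightarrow> pvt_adj n y z" using yz by (simp add: pvt_adj_def)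
qed

theorem theorem5p6:
  fixes n :: nat
  assumes "n \<ge> 5"
  shows "carrier (AutoGroup (PVT n)) =
    generate (AutoGroup (PVT n)) (Aut_gr n \<union> Aut_inv n \<union> Inn (PVT n))"
proof
  interpret r: rigid_raag "PVT n" "lamp n" "pairs n" disjoint_pairs by (rule rigid_raag_PVT[OF assms])
  let ?A = "AutoGroup (PVT n)"
  interpret A: group ?A by (rule r.AutoGroup)
  have cA: "carrier ?A = auto (PVT n)" by (simp add: AutoGroup_def)
  have "Aut_gr n \<subseteq> carrier ?A" "Aut_inv n \<subseteq> carrier ?A"
    unfolding Aut_gr_def Aut_inv_def by (rule A.generate_incl; auto simp: cA)+
  moreover have "Inn (PVT n) \<subseteq> carrier ?A" unfolding Inn_def cA using r.inner_auto by blast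
  ultimately show "generate ?A (Aut_gr n \<union> Aut_inv n \<union> Inn (PVT n)) \<subseteq> carrier ?A"
    by (intro A.generate_incl) blast
  have "r.graph_autos \<subseteq> Aut_gr n"
  proof
    fix \<alpha> assume "\<alpha> \<in> r.graph_autos"
    then obtain \<sigma> where a: "\<alpha> \<in> auto (PVT n)" and s: "bij_betw \<sigma> (pairs n) (pairs n)"
      and ax: "\<And>p. p \<in> pairs n \<Longrightarrow> \<alpha> (lamp n p) = lamp n (\<sigma> p)"
      unfolding r.graph_autos_def by blast
    \<comment> \<open>Here \<sigma> permutes index pairs; on group elements \<alpha> itself serves
      as the graph automorphism, once it is known to map \<open>lams n\<close> onto itself.\<close>
    have "(\<lambda>p. \<alpha> (lamp n p)) ` pairs n = (\<lambda>p. lamp n (\<sigma> p)) ` pairs n" using ax by (rule image_cong[OF HOL.refl])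
    then have "\<alpha> ` lams n = lamp n ` (\<sigma> ` pairs n)" by (simp only: lams_image image_image)
    then have "\<alpha> ` lams n = lams n" using bij_betw_imp_surj_on[OF s] by (simp add: lams_image)
    then show "\<alpha> \<in> Aut_gr n"
      unfolding Aut_gr_def using a pvt_graph_aut_auto[OF a] by (intro generate.incl) blast
  qed
  moreover have "r.inversions \<subseteq> Aut_inv n"
  proof
    fix \<alpha> assume "\<alpha> \<in> r.inversions"
    then show "\<alpha> \<in> Aut_inv n"
      unfolding Aut_inv_def r.inversions_def lams_image by (intro generate.incl) blast
  qed
  ultimately have "r.graph_autos \<union> r.inversions \<union> Inn (PVT n) \<subseteq> Aut_gr n \<union> Aut_inv n \<union> Inn (PVT n)" by blast
  then show "carrier ?A \<subseteq> generate ?A (Aut_gr n \<union> Aut_inv n \<union> Inn (PVT n))"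
    unfolding cA using r.auto_generated A.mono_generate by blast
qed

end
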